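(* Let $d\ge 1$ and let $(U_i)_{i\ge1}$ be i.i.d. random vectors uniformly distributed on $[0,1]^d$. Let $(a_n)_{n\ge1}\subset(0,1]$ satisfy $$a_n\downarrow 0,\qquad na_n^d\uparrow\infty,\qquad \liminf_{n\to\infty}\frac{\log(1/a_n)}{\log\log n}>1 .$$ For $u\in[0,1]^d$, $a\in[0,1]$ and $t\in[0,1]^d$ set $$\Delta_n(u,a,t):=\frac{\sum_{i=1}^n\big(\mathds{1}_{[u,u+at]}(U_i)-\lambda([0,at])\big)}{\sqrt{na^d}}.$$ Then, almost surely, for every hypercube $I$ with $\lambda(I)>0$ and $I\subset[0,1-\delta]^d$ for some $\delta>0$, the following hold: (i) for every closed set $F\subset D([0,1]^d)$, $$\limsup_{n\to\infty}\frac{\lambda^*\big(\{u\in I:\ \Delta_n(u,a_n,\cdot)\in F\}\big)}{\lambda(I)}\le \mathbb{P}(W\in F);$$ (ii) for every open set $O\subset D([0,1]^d)$, $$\liminf_{n\to\infty}\frac{\lambda_*\big(\{u\in I:\ \Delta_n(u,a_n,\cdot)\in O\}\big)}{\lambda(I)}\ge \mathbb{P}(W\in O).$$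
   Context: $D([0,1]^d)$ denotes the space of distribution functions $t\mapsto\mu([0,t])$ of finite signed measures $\mu$ on $[0,1]^d$, endowed with the sup norm $\|f\|_{[0,1]^d}=\sup_{t\in[0,1]^d}|f(t)|$ (open/closed refer to this norm). For $s,t\in\mathbb{R}^d$, $[s,t]=\prod_{k=1}^d[s^{(k)},t^{(k)}]$; for $u\in\mathbb{R}^d$, $a\in\mathbb{R}$, $t\in\mathbb{R}^d$, $u+at$ is the vector with coordinates $u^{(k)}+at^{(k)}$, and $0$ is the origin. $\lambda$ is Lebesgue measure on $[0,1]^d$, $\lambda^*$ and $\lambda_*$ the outer and inner Lebesgue measures. $W$ is the standard Wiener sheet on $[0,1]^d$, i.e. the centered Gaussian process with $\mathrm{Cov}(W(s),W(t))=\prod_{k=1}^d (s^{(k)}\wedge t^{(k)})$ (with continuous paths).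
   Formalization: Closed and open sets are taken among all real functions on [0,1]^d in the sup norm, not inside D: W is a.s. of unbounded variation, so P(W in D)=0 while every Δ_n lies in D, and (i) fails literally for F=D. Hypercubes are closed cubes. *)

theory Defs
  imports "HOL-Probability.Probability"
begin

definition inner_measure_of :: "'a measure \<Rightarrow> 'a set \<Rightarrow> ennreal" where
  "inner_measure_of M A = (SUP B \<in> {B \<in> sets M. B \<subseteq> A}. emeasure M B)"

text \<open>Sup-norm distance on the unit cube [0,1]^d (values in ereal, so unbounded
  differences give infinity).\<close>
definition sup_dist :: "(real^'d \<Rightarrow> real) \<Rightarrow> (real^'d \<Rightarrow> real) \<Rightarrow> ereal" where
  "sup_dist f g = (SUP t \<in> cbox (0::real^'d) 1. ereal \<bar>f t - g t\<bar>)"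

definition sup_open :: "(real^'d \<Rightarrow> real) set \<Rightarrow> bool" where
  "sup_open G \<longleftrightarrow> (\<forall>f\<in>G. \<exists>e>0. \<forall>g. sup_dist f g < ereal e \<longrightarrow> g \<in> G)"

definition sup_closed :: "(real^'d \<Rightarrow> real) set \<Rightarrow> bool" where
  "sup_closed F \<longleftrightarrow> sup_open (- F)"

definition sheet_cov :: "real^'d \<Rightarrow> real^'d \<Rightarrow> real" where
  "sheet_cov s t = (\<Prod>k\<in>UNIV. min (s$k) (t$k))"

text \<open>Standard Wiener sheet on [0,1]^d: a centered Gaussian process (every finite linear
  combination of its values is centered normal, degenerate normal = 0 a.s.) with covariance
  sheet_cov and continuous paths.\<close>
definition wiener_sheet :: "'b measure \<Rightarrow> ('b \<Rightarrow> real^'d \<Rightarrow> real) \<Rightarrow> bool" where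
  "wiener_sheet N W \<longleftrightarrow> prob_space N \<and>
     (\<forall>t \<in> cbox 0 1. (\<lambda>\<omega>. W \<omega> t) \<in> borel_measurable N) \<and>
     (\<forall>\<omega>\<in>space N. continuous_on (cbox 0 1) (W \<omega>)) \<and>
     (\<forall>(ts :: (real^'d) list) (cs :: real list).
        length cs = length ts \<and> set ts \<subseteq> cbox 0 1 \<longrightarrow>
        (let v = (\<Sum>j<length ts. \<Sum>k<length ts. cs!j * cs!k * sheet_cov (ts!j) (ts!k));
             X = (\<lambda>\<omega>. \<Sum>j<length ts. cs!j * W \<omega> (ts!j))
         in if v > 0 then distributed N lborel X (normal_density 0 (sqrt v))
            else (AE \<omega> in N. X \<omega> = 0)))"

definition Delta :: "(nat \<Rightarrow> real^'d) \<Rightarrow> nat \<Rightarrow> real^'d \<Rightarrow> real \<Rightarrow> real^'d \<Rightarrow> real" where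
  "Delta Us n u a t =
     (\<Sum>i\<in>{1..n}. indicator (cbox u (u + a *\<^sub>R t)) (Us i) - measure lborel (cbox 0 (a *\<^sub>R t)))
     / sqrt (real n * a ^ CARD('d))"

end

(*
  Fix a cube I and a functional phi of a path which is bounded by 1 and L-Lipschitz for the sup
  norm. Moving one sample point changes Delta_n(u, a_n, .) by at most (n a_n^d)^(-1/2), and only for
  u in a set of measure at most 2 a_n^d, so the average of phi(Delta_n(u, a_n, .)) over u in I has
  bounded differences of order a_n^d (n a_n^d)^(-1/2). McDiarmid's inequality bounds the probability
  of an e-deviation of this average from its mean by exp(-K e^2 / a_n^d), which is summable over all
  n because a_n is eventually at most (log n)^(-y) with y > 1. Hence, almost surely, these averages
  behave like their expectations for countably many functionals and rational cubes, hence for all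
  cubes.
  Trigonometric functionals give convergence of characteristic functions, which Stone-Weierstrass
  upgrades to weak convergence of finite-dimensional marginals. A capped oscillation functional,
  whose mean is controlled by exponential moments and dyadic chaining, gives tightness.
*)
theory Submission
  imports Defs
begin

section \<open>McDiarmid's inequality\<close>

text \<open>The exceptional null set has to be fixed before the cube and before the closed set, and
  the sup-closed sets form no countable family. Randomness is therefore spent on countably many
  functionals of finitely many grid values; on the resulting event \<open>typical\<close> everything
  is deterministic, and weak convergence is proved for a fixed sample, with the corner u as the
  random variable. The set of corners whose path lies in F need not be measurable. Its indicator is
  dominated by a Borel function of u: a Lipschitz approximation of the indicator of F at the path
  discretised on a dyadic grid, plus a multiple of the oscillation functional, plus a constant.
  Chaining cannot reach arbitrarily fine levels, because the sub-Gaussian moment bound holds only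
  for parameters up to sqrt (n a_n^d). It stops at a level J with 2^J comparable to n a_n^d, below
  which monotonicity of the count takes over. Hence the oscillation functional varies with n, but
  its Lipschitz constant does not, and the same concentration bound covers it.\<close>

lemma Hoeffding_exp_le:
  fixes f :: "'a \<Rightarrow> real"
  assumes "prob_space M" and [measurable]: "f \<in> borel_measurable M"
    and bd: "\<And>y. y \<in> space M \<Longrightarrow> \<bar>f y - (\<integral>y. f y \<partial>M)\<bar> \<le> c"
  shows "(\<integral>\<^sup>+y. exp (f y - (\<integral>y. f y \<partial>M)) \<partial>M) \<le> ennreal (exp (c\<^sup>2 / 2))"
proof -
  interpret prob_space M by fact
  define m where "m = (\<integral>y. f y \<partial>M)"
  interpret interval_bounded_random_variable M f "m - c" "m + c"
    by standard (use bd in \<open>auto simp: m_def abs_le_iff intro!: AE_I2\<close>, (smt (verit) bd)+)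
  have "(\<integral>\<^sup>+y. exp (1 * (f y - expectation f)) \<partial>M) \<le> ennreal (exp (1\<^sup>2 * ((m + c) - (m - c))\<^sup>2 / 8))"
    by (rule Hoeffdings_lemma_nn_integral) simp
  also have "(1::real)\<^sup>2 * ((m + c) - (m - c))\<^sup>2 / 8 = c\<^sup>2 / 2"
    by (simp add: power2_eq_square field_simps)
  finally show ?thesis by (simp add: m_def)
qed

abbreviation iid_space :: "'i set \<Rightarrow> 'a measure \<Rightarrow> ('i \<Rightarrow> 'a) measure" where
  "iid_space I M \<equiv> PiM I (\<lambda>_. M)"

lemma fun_upd_PiM:
  assumes "x \<in> space (iid_space I M)" "y \<in> space M"
  shows "x(i := y) \<in> space (iid_space (insert i I) M)"
  using assms by (auto simp: space_PiM PiE_iff extensional_def)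

lemma integral_PiM_insert_bounded:
  fixes F :: "('i \<Rightarrow> 'a) \<Rightarrow> real"
  assumes M: "prob_space M" and I: "finite I" "i \<notin> I"
    and F[measurable]: "F \<in> borel_measurable (iid_space (insert i I) M)"
    and bd: "\<And>x. x \<in> space (iid_space (insert i I) M) \<Longrightarrow> \<bar>F x\<bar> \<le> B"
  shows "(\<integral>x. F x \<partial>iid_space (insert i I) M) = (\<integral>x. (\<integral>y. F (x(i:=y)) \<partial>M) \<partial>iid_space I M)"
proof -
  interpret prob_space M by fact
  interpret product_prob_space "\<lambda>_. M" UNIV by standard
  interpret PR: prob_space "iid_space (insert i I) M" by (rule prob_space_PiM) (rule M)
  have "integrable (iid_space (insert i I) M) F"
    by (rule PR.integrable_const_bound[where B = B]) (auto intro!: AE_I2 bd)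
  then have "(\<integral>x. F x \<partial>iid_space (insert i I) M) = (\<integral>x. (\<integral>y. F (merge I {i} (x, y)) \<partial>PiM {i} (\<lambda>_. M)) \<partial>iid_space I M)"
    using product_integral_fold[of I "{i}" F] I by auto
  also have "\<dots> = (\<integral>x. (\<integral>y. F (x(i:=y)) \<partial>M) \<partial>iid_space I M)"
  proof (rule Bochner_Integration.integral_cong[OF refl])
    fix x assume x: "x \<in> space (iid_space I M)"
    then have ext: "x \<in> extensional I" by (auto simp: space_PiM PiE_def)
    have eq: "merge I {i} (x, y) = x(i := y i)" if "y \<in> space (PiM {i} (\<lambda>_. M))" for y
      using that ext I by (auto simp: merge_def fun_eq_iff extensional_def)
    have "(\<integral>y. F (merge I {i} (x, y)) \<partial>PiM {i} (\<lambda>_. M)) = (\<integral>y. F (x(i := y i)) \<partial>PiM {i} (\<lambda>_. M))"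
      by (rule Bochner_Integration.integral_cong[OF refl]) (simp add: eq)
    also have "\<dots> = (\<integral>y. F (x(i:=y)) \<partial>M)"
      using x
      by (intro product_integral_singleton[of "\<lambda>y. F (x(i := y))" i]) measurable
    finally show "(\<integral>y. F (merge I {i} (x, y)) \<partial>PiM {i} (\<lambda>_. M)) = (\<integral>y. F (x(i:=y)) \<partial>M)" .
  qed
  finally show ?thesis .
qed

text \<open>The martingale argument as an induction on the index set: integrating out the new
  coordinate leaves \<open>G\<close>, which keeps the bound \<open>B\<close> and the differences
  \<open>c\<close>, while Hoeffding's lemma pays one factor \<open>exp (c\<^sup>2 / 2)\<close> for
  that coordinate. A deviation of at most \<open>c\<close> on each side of the mean is an interval
  of length \<open>2 * c\<close>, so the exponent is four times the sharp one.\<close>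

lemma bounded_differences_exp_le:
  fixes F :: "('i \<Rightarrow> 'a) \<Rightarrow> real"
  assumes M: "prob_space M" and "finite I"
    and "F \<in> borel_measurable (iid_space I M)"
    and "\<And>x. x \<in> space (iid_space I M) \<Longrightarrow> \<bar>F x\<bar> \<le> B"
    and "\<And>x i y. x \<in> space (iid_space I M) \<Longrightarrow> i \<in> I \<Longrightarrow> y \<in> space M \<Longrightarrow> \<bar>F (x(i:=y)) - F x\<bar> \<le> c"
  shows "(\<integral>\<^sup>+x. exp (F x - (\<integral>x. F x \<partial>iid_space I M)) \<partial>iid_space I M)
           \<le> ennreal (exp (real (card I) * c\<^sup>2 / 2))"
  using assms(2-)
proof (induction I arbitrary: F rule: finite_induct)
  case empty
  then show ?case
    by (simp add: space_PiM PiM_empty nn_integral_count_space_finite lebesgue_integral_count_space_finite)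
next
  case (insert i I)
  interpret prob_space M by fact
  interpret product_prob_space "\<lambda>_. M" UNIV by standard
  interpret PR: prob_space "iid_space I M" by (rule prob_space_PiM) (rule M)
  note insert.prems(1)[measurable]
  have bdF: "\<bar>F x\<bar> \<le> B" if "x \<in> space (iid_space (insert i I) M)" for x
    using that by (rule insert.prems(2))
  have diffF: "\<bar>F (x(j:=y)) - F x\<bar> \<le> c"
    if "x \<in> space (iid_space (insert i I) M)" "j \<in> insert i I" "y \<in> space M" for x j y
    using that by (rule insert.prems(3))
  define G where "G x = (\<integral>y. F (x(i:=y)) \<partial>M)" for x
  have Gm[measurable]: "G \<in> borel_measurable (iid_space I M)"
    unfolding G_def by measurable
  have Fint: "integrable M (\<lambda>y. F (x(i:=y)))" if x: "x \<in> space (iid_space I M)" for x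
  proof (rule finite_measure.integrable_const_bound[OF prob_space.finite_measure[OF M], where B = B])
    show "AE y in M. norm (F (x(i:=y))) \<le> B"
      unfolding real_norm_def by (intro AE_I2 bdF fun_upd_PiM[OF x])
    show "(\<lambda>y. F (x(i:=y))) \<in> borel_measurable M" using x by measurable
  qed
  have EG: "(\<integral>x. F x \<partial>iid_space (insert i I) M) = (\<integral>x. G x \<partial>iid_space I M)"
    unfolding G_def using bdF
    by (intro integral_PiM_insert_bounded[OF M insert.hyps(1,2) insert.prems(1)]) auto
  have tot: "measure M (space M) = 1" by (rule prob_space.prob_space[OF M])
  have avg: "\<bar>(\<integral>y. h y \<partial>M) - b\<bar> \<le> C" if "integrable M h" "\<And>y. y \<in> space M \<Longrightarrow> \<bar>h y - b\<bar> \<le> C" for h :: "'a \<Rightarrow> real" and b C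
  proof -
    have "(\<integral>y. h y \<partial>M) - b = (\<integral>y. h y - b \<partial>M)" using that(1) by (simp add: tot)
    also have "\<bar>\<dots>\<bar> \<le> (\<integral>y. \<bar>h y - b\<bar> \<partial>M)" by (rule integral_abs_bound)
    also have "\<dots> \<le> (\<integral>y. C \<partial>M)" using that by (intro integral_mono) auto
    finally show ?thesis by (simp add: tot)
  qed
  have Gb: "\<bar>G x\<bar> \<le> B" if x: "x \<in> space (iid_space I M)" for x
  proof -
    have "\<bar>F (x(i:=y)) - 0\<bar> \<le> B" if "y \<in> space M" for y
      using bdF[of "x(i:=y)"] fun_upd_PiM[OF x that, of i] by simp
    then show ?thesis
      using avg[OF Fint[OF x], of 0 B] by (simp add: G_def)
  qed
  have Gd: "\<bar>G (x(j:=z)) - G x\<bar> \<le> c"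
    if x: "x \<in> space (iid_space I M)" and j: "j \<in> I" and z: "z \<in> space M" for x j z
  proof -
    have x': "x(j:=z) \<in> space (iid_space I M)" using fun_upd_PiM[OF x z, of j] j by (simp add: insert_absorb)
    have ij: "i \<noteq> j" using j insert.hyps by auto
    have "G (x(j:=z)) - G x = (\<integral>y. F (x(j:=z, i:=y)) - F (x(i:=y)) \<partial>M)"
      unfolding G_def by (rule Bochner_Integration.integral_diff[symmetric]) (intro Fint x x')+
    moreover have "\<bar>F (x(j:=z, i:=y)) - F (x(i:=y)) - 0\<bar> \<le> c" if "y \<in> space M" for y
      using diffF[of "x(i:=y)" j z] fun_upd_PiM[OF x that, of i] j z ij by (simp add: fun_upd_twist)
    ultimately show ?thesis
      using avg[of "\<lambda>y. F (x(j:=z, i:=y)) - F (x(i:=y))" 0 c] Fint[OF x] Fint[OF x'] by simp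
  qed
  have inner: "(\<integral>\<^sup>+y. exp (F (x(i:=y)) - G x) \<partial>M) \<le> ennreal (exp (c\<^sup>2 / 2))"
    if x: "x \<in> space (iid_space I M)" for x
    unfolding G_def
  proof (rule Hoeffding_exp_le[OF M])
    show "(\<lambda>y. F (x(i := y))) \<in> borel_measurable M" using x by measurable
    fix y assume y: "y \<in> space M"
    have "\<bar>F (x(i:=y')) - F (x(i:=y))\<bar> \<le> c" if "y' \<in> space M" for y'
      using diffF[of "x(i:=y)" i y'] fun_upd_PiM[OF x y, of i] that by simp
    then have "\<bar>(\<integral>y'. F (x(i:=y')) \<partial>M) - F (x(i:=y))\<bar> \<le> c" by (intro avg Fint x)
    then show "\<bar>F (x(i:=y)) - (\<integral>y'. F (x(i:=y')) \<partial>M)\<bar> \<le> c" by linarith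
  qed
  let ?m = "\<integral>x. G x \<partial>iid_space I M"
  have "(\<integral>\<^sup>+x. exp (F x - (\<integral>x. F x \<partial>iid_space (insert i I) M)) \<partial>iid_space (insert i I) M)
      = (\<integral>\<^sup>+x. (\<integral>\<^sup>+y. ennreal (exp (F (x(i:=y)) - ?m)) \<partial>M) \<partial>iid_space I M)"
    unfolding EG by (rule product_nn_integral_insert[OF insert.hyps(1,2)]) measurable
  \<comment> \<open>Splits \<open>F - ?m\<close> into \<open>(F - G) + (G - ?m)\<close>; the second
    part does not depend on the new coordinate.\<close>
  also have "\<dots> = (\<integral>\<^sup>+x. ennreal (exp (G x - ?m)) * (\<integral>\<^sup>+y. ennreal (exp (F (x(i:=y)) - G x)) \<partial>M) \<partial>iid_space I M)"
    by (intro nn_integral_cong, subst nn_integral_cmult[symmetric])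
       (auto simp: ennreal_mult'[symmetric] exp_add[symmetric] intro!: measurable_compose[OF _ measurable_ennreal]
         borel_measurable_exp borel_measurable_diff, measurable)
  also have "\<dots> \<le> (\<integral>\<^sup>+x. ennreal (exp (G x - ?m)) * ennreal (exp (c\<^sup>2 / 2)) \<partial>iid_space I M)"
    by (intro nn_integral_mono mult_left_mono inner) auto
  also have "\<dots> = (\<integral>\<^sup>+x. ennreal (exp (G x - ?m)) \<partial>iid_space I M) * ennreal (exp (c\<^sup>2 / 2))"
    by (rule nn_integral_multc) measurable
  also have "\<dots> \<le> ennreal (exp (real (card I) * c\<^sup>2 / 2)) * ennreal (exp (c\<^sup>2 / 2))"
    by (intro mult_right_mono insert.IH Gm Gb Gd) auto
  also have "\<dots> = ennreal (exp (real (card (insert i I)) * c\<^sup>2 / 2))"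
    using insert.hyps by (simp add: ennreal_mult'[symmetric] exp_add[symmetric] field_simps)
  finally show ?case .
qed

theorem McDiarmid_ineq:
  fixes F :: "('i \<Rightarrow> 'a) \<Rightarrow> real"
  assumes M: "prob_space M" and I: "finite I" "I \<noteq> {}" and c: "c > 0" and e: "e \<ge> 0"
    and F[measurable]: "F \<in> borel_measurable (iid_space I M)"
    and bd: "\<And>x. x \<in> space (iid_space I M) \<Longrightarrow> \<bar>F x\<bar> \<le> B"
    and diff: "\<And>x i y. x \<in> space (iid_space I M) \<Longrightarrow> i \<in> I \<Longrightarrow> y \<in> space M \<Longrightarrow> \<bar>F (x(i:=y)) - F x\<bar> \<le> c"
  shows "measure (iid_space I M) {x \<in> space (iid_space I M). F x \<ge> (\<integral>x. F x \<partial>iid_space I M) + e}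
           \<le> exp (- e\<^sup>2 / (2 * real (card I) * c\<^sup>2))"
proof -
  interpret PR: prob_space "iid_space I M" by (rule prob_space_PiM) (rule M)
  let ?P = "iid_space I M" and ?m = "\<integral>x. F x \<partial>iid_space I M"
  have n: "real (card I) > 0" using I by (simp add: card_gt_0_iff)
  \<comment> \<open>Minimiser of the Chernoff exponent
    \<open>real (card I) * (s * c)\<^sup>2 / 2 - s * e\<close>.\<close>
  define s where "s = e / (real (card I) * c\<^sup>2)"
  have s: "s \<ge> 0" using e n by (simp add: s_def)
  define A where "A = {x \<in> space ?P. F x \<ge> ?m + e}"
  have [measurable]: "A \<in> sets ?P" unfolding A_def by measurable
  have le: "(\<integral>\<^sup>+x. exp (s * F x - (\<integral>x. s * F x \<partial>?P)) \<partial>?P) \<le> ennreal (exp (real (card I) * (s * c)\<^sup>2 / 2))"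
  proof (rule bounded_differences_exp_le[OF M I(1), where B = "s * B"])
    show "\<bar>s * F x\<bar> \<le> s * B" if "x \<in> space ?P" for x
      using bd[OF that] s by (simp add: abs_mult mult_left_mono)
    show "\<bar>s * F (x(i := y)) - s * F x\<bar> \<le> s * c" if "x \<in> space ?P" "i \<in> I" "y \<in> space M" for x i y
      using mult_left_mono[OF diff[OF that] s] s by (simp add: abs_mult right_diff_distrib[symmetric])
  qed measurable
  have "ennreal (exp (s * e)) * emeasure ?P A = (\<integral>\<^sup>+x. ennreal (exp (s * e)) * indicator A x \<partial>?P)"
    by (simp add: nn_integral_cmult_indicator)
  also have "\<dots> \<le> (\<integral>\<^sup>+x. exp (s * F x - (\<integral>x. s * F x \<partial>?P)) \<partial>?P)"
  proof (rule nn_integral_mono)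
    fix x assume "x \<in> space ?P"
    have "s * e \<le> s * F x - s * ?m" if "x \<in> A"
      using mult_left_mono[of e "F x - ?m" s] s that by (auto simp: A_def algebra_simps)
    then show "ennreal (exp (s * e)) * indicator A x \<le> ennreal (exp (s * F x - (\<integral>x. s * F x \<partial>?P)))"
      by (auto simp: indicator_def intro!: ennreal_leI)
  qed
  also note le
  finally have "ennreal (exp (s * e) * measure ?P A) \<le> ennreal (exp (real (card I) * (s * c)\<^sup>2 / 2))"
    by (simp add: PR.emeasure_eq_measure ennreal_mult)
  then have "exp (s * e) * measure ?P A \<le> exp (real (card I) * (s * c)\<^sup>2 / 2)"
    by (subst (asm) ennreal_le_iff) auto
  then have "measure ?P A \<le> exp (real (card I) * (s * c)\<^sup>2 / 2) / exp (s * e)"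
    by (simp add: field_simps)
  also have "\<dots> = exp (real (card I) * (s * c)\<^sup>2 / 2 - s * e)" by (simp add: exp_diff)
  also have "real (card I) * (s * c)\<^sup>2 / 2 - s * e = - e\<^sup>2 / (2 * real (card I) * c\<^sup>2)"
    using n c unfolding s_def by (simp add: field_simps power2_eq_square)
  finally show ?thesis by (simp add: A_def)
qed

section \<open>Averages over windows concentrate\<close>

abbreviation cube :: "real^'d \<Rightarrow> real \<Rightarrow> (real^'d) set" where
  "cube c r \<equiv> cbox c (c + r *\<^sub>R 1)"

abbreviation shrunk_cube :: "real \<Rightarrow> (real^'d) set" where
  "shrunk_cube \<delta> \<equiv> cbox 0 ((1 - \<delta>) *\<^sub>R 1)"

abbreviation unif_close :: "real \<Rightarrow> (real^'d \<Rightarrow> real) \<Rightarrow> (real^'d \<Rightarrow> real) \<Rightarrow> bool" where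
  "unif_close e f g \<equiv> \<forall>t\<in>cbox 0 1. \<bar>f t - g t\<bar> \<le> e"

abbreviation window_space :: "nat \<Rightarrow> ((nat \<Rightarrow> real^'d) \<times> (real^'d)) measure" where
  "window_space n \<equiv> PiM {1..n} (\<lambda>_. borel) \<Otimes>\<^sub>M borel"

abbreviation unif_cube :: "(real^'d) measure" where
  "unif_cube \<equiv> uniform_measure lborel (cbox 0 1)"

lemma mem_corner_box:
  "y \<in> cbox u (u + a *\<^sub>R t) \<longleftrightarrow> (\<forall>k. u $ k \<le> y $ k \<and> y $ k \<le> u $ k + a * t $ k)" for u y t :: "real^'d"
  by (simp add: mem_box_cart)

lemma measure_corner_box:
  fixes u t :: "real^'d"
  assumes "a \<ge> 0" "\<And>k. t $ k \<ge> 0"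
  shows "measure lborel (cbox u (u + a *\<^sub>R t)) = a ^ CARD('d) * (\<Prod>k\<in>UNIV. t $ k)"
proof -
  have "u \<in> cbox u (u + a *\<^sub>R t)" using assms by (simp add: mem_corner_box)
  then have "measure lborel (cbox u (u + a *\<^sub>R t)) = (\<Prod>k\<in>UNIV. a * t $ k)"
    by (subst content_cbox_cart) auto
  then show ?thesis by (simp add: prod.distrib)
qed

lemma measure_cube: "r \<ge> 0 \<Longrightarrow> measure lborel (cube c r) = r ^ CARD('d)" for c :: "real^'d"
  using measure_corner_box[of r 1 c] by simp

lemma emeasure_cube: "r \<ge> 0 \<Longrightarrow> emeasure lborel (cube c r) = ennreal (r ^ CARD('d))" for c :: "real^'d"
  by (subst emeasure_eq_ennreal_measure)
     (auto simp: measure_cube emeasure_lborel_cbox_eq top_unique intro!: prod_nonneg split: if_splits)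

lemma prob_space_unif_cube: "prob_space (unif_cube :: (real^'d) measure)"
  using emeasure_cube[of 1 "0::real^'d"] by (intro prob_space_uniform_measure) auto

lemma measurable_vec_nth[measurable]: "(\<lambda>x. x $ k) \<in> borel_measurable (borel :: (real^'d) measure)"
  by (intro borel_measurable_continuous_onI continuous_intros)

text \<open>Membership in the moving box is rewritten as finitely many coordinate inequalities, from
  which joint measurability in the sample and the corner is automatic.\<close>

lemma measurable_Delta[measurable]:
  assumes [measurable]: "\<And>i. i \<in> {1..n} \<Longrightarrow> (\<lambda>p. X p i) \<in> borel_measurable N" "v \<in> borel_measurable N"
  shows "(\<lambda>p. Delta (X p) n (v p) a (t::real^'d)) \<in> borel_measurable N"
proof -
  have *: "Delta (X p) n (v p) a t = (\<Sum>i\<in>{1..n}. (if \<forall>k\<in>UNIV. v p $ k \<le> X p i $ k \<and> X p i $ k \<le> v p $ k + a * t $ k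
      then 1 else 0) - measure lborel (cbox 0 (a *\<^sub>R t)))
     / sqrt (real n * a ^ CARD('d))" for p
    unfolding Delta_def by (intro arg_cong2[where f="(/)"] sum.cong refl) (auto simp: mem_corner_box indicator_def)
  show ?thesis unfolding * by measurable
qed

lemma Delta_cong: "(\<And>i. i \<in> {1..n} \<Longrightarrow> X i = Y i) \<Longrightarrow> Delta X n u a = Delta Y n u a"
  unfolding Delta_def by (intro ext arg_cong2[where f="(/)"] sum.cong) auto

text \<open>A box with lower corner \<open>u\<close> and sides at most \<open>a\<close> contains a
  point only if \<open>u\<close> lies in the cube of side \<open>a\<close> whose upper corner is
  that point. Hence only corners in one cube at the old position and one at the new position notice
  the change; the centring terms cancel.\<close>

lemma Delta_upd_diff:
  fixes x :: "nat \<Rightarrow> real^'d"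
  assumes t: "t \<in> cbox 0 1" and n: "n \<ge> 1" and a: "a > 0"
  shows "\<bar>Delta (x(i := y)) n u a t - Delta x n u a t\<bar> \<le>
    indicator (cube (x i - a *\<^sub>R 1) a \<union> cube (y - a *\<^sub>R 1) a) u / sqrt (real n * a ^ CARD('d))"
proof (cases "i \<in> {1..n}")
  case False
  then have "Delta (x(i := y)) n u a = Delta x n u a" by (intro Delta_cong) auto
  then show ?thesis using n a by (auto intro!: divide_nonneg_nonneg simp: indicator_def)
next
  case i: True
  have "u \<in> cube (z - a *\<^sub>R 1) a" if "z \<in> cbox u (u + a *\<^sub>R t)" for z
  proof -
    have "a * t $ k \<le> a" for k using t a mult_left_mono[of "t $ k" 1 a] by (auto simp: mem_box_cart)
    then show ?thesis using that by (auto simp: mem_box_cart algebra_simps) (smt (verit))+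
  qed
  then have ind: "\<bar>indicator (cbox u (u + a *\<^sub>R t)) y - indicator (cbox u (u + a *\<^sub>R t)) (x i) :: real\<bar>
      \<le> indicator (cube (x i - a *\<^sub>R 1) a \<union> cube (y - a *\<^sub>R 1) a) u"
    by (auto simp: indicator_def)
  let ?d = "indicator (cbox u (u + a *\<^sub>R t)) y - indicator (cbox u (u + a *\<^sub>R t)) (x i) :: real"
  have "Delta (x(i := y)) n u a t - Delta x n u a t = (\<Sum>j\<in>{1..n}. if j = i then ?d else 0) / sqrt (real n * a ^ CARD('d))"
    unfolding Delta_def diff_divide_distrib[symmetric] sum_subtractf[symmetric]
    by (intro arg_cong2[where f="(/)"] sum.cong) auto
  also have "(\<Sum>j\<in>{1..n}. if j = i then ?d else 0) = ?d" using i by (subst sum.delta) auto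
  finally have "Delta (x(i := y)) n u a t - Delta x n u a t = ?d / sqrt (real n * a ^ CARD('d))" .
  then show ?thesis using ind n a by (simp add: divide_right_mono)
qed

locale uniform_sample = prob_space M for M :: "'a measure" +
  fixes U :: "nat \<Rightarrow> 'a \<Rightarrow> real^'d"
  assumes indep: "indep_vars (\<lambda>_. borel) U {1..}"
    and unif: "\<And>i. i \<ge> 1 \<Longrightarrow> distr M borel (U i) = unif_cube"
begin

abbreviation sample :: "'a \<Rightarrow> nat \<Rightarrow> real^'d" where
  "sample w \<equiv> \<lambda>i. U i w"

lemma measurable_U[measurable]: "i \<ge> 1 \<Longrightarrow> U i \<in> borel_measurable M"
  using indep by (auto simp: indep_vars_def)

lemma distr_sample:
  assumes "n \<ge> 1"
  shows "distr M (PiM {1..n} (\<lambda>_. borel)) (\<lambda>w. \<lambda>i\<in>{1..n}. U i w) = iid_space {1..n} unif_cube"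
proof -
  have "indep_vars (\<lambda>_. borel) U {1..n}" by (rule indep_vars_subset[OF indep]) auto
  then have "distr M (PiM {1..n} (\<lambda>_. borel)) (\<lambda>w. \<lambda>i\<in>{1..n}. U i w) = PiM {1..n} (\<lambda>i. distr M borel (U i))"
    using assms by (subst (asm) indep_vars_iff_distr_eq_PiM') auto
  also have "\<dots> = iid_space {1..n} unif_cube" by (intro PiM_cong refl unif) auto
  finally show ?thesis .
qed

text \<open>No sigma-algebra is chosen on path space, so measurability is assumed for the composite
  in (sample, corner) only. Its sections and pullbacks supply what Fubini needs.\<close>

lemma window_measurable:
  assumes meas: "(\<lambda>p. \<phi> (Delta (fst p) n (snd p) a)) \<in> borel_measurable (window_space n)"
  shows "(\<lambda>u. \<phi> (Delta x n u a)) \<in> borel_measurable borel"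
    and "(\<lambda>p. \<phi> (Delta (sample (fst p)) n (snd p) a)) \<in> borel_measurable (M \<Otimes>\<^sub>M borel)"
proof -
  have eq: "Delta (restrict x {1..n}) n u a = Delta x n u a" for x u by (rule Delta_cong) simp
  have "restrict x {1..n} \<in> space (PiM {1..n} (\<lambda>_. borel))" by (simp add: space_PiM)
  from measurable_compose[OF measurable_Pair1'[OF this] meas]
  show "(\<lambda>u. \<phi> (Delta x n u a)) \<in> borel_measurable borel" by (simp only: eq fst_conv snd_conv)
  have "(\<lambda>p. (restrict (sample (fst p)) {1..n}, snd p)) \<in> measurable (M \<Otimes>\<^sub>M borel) (window_space n)"
    by measurable
  from measurable_compose[OF this meas]
  show "(\<lambda>p. \<phi> (Delta (sample (fst p)) n (snd p) a)) \<in> borel_measurable (M \<Otimes>\<^sub>M borel)"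
    by (simp only: eq fst_conv snd_conv)
qed

text \<open>One sample point moves the average over \<open>I\<close> by at most
  \<open>c = 2 * L * a ^ CARD('d) / sqrt ?N\<close>, and
  \<open>n * c\<^sup>2 = 4 * L\<^sup>2 * a ^ CARD('d)\<close> no longer contains \<open>n\<close>:
  this is why the bandwidth alone enters the exponent. By Fubini the mean of the average is an
  average of pointwise means. A one-sided bound suffices, since the negative of a functional is
  again admissible.\<close>

lemma window_average_concentration:
  fixes \<phi> :: "(real^'d \<Rightarrow> real) \<Rightarrow> real" and I :: "(real^'d) set"
  assumes n: "n \<ge> 1" and a: "a > 0" and L: "L > 0" and e: "e \<ge> 0"
    and lip: "\<And>f g e. unif_close e f g \<Longrightarrow> \<bar>\<phi> f - \<phi> g\<bar> \<le> L * e"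
    and bd: "\<And>f. \<bar>\<phi> f\<bar> \<le> 1"
    and meas[measurable]: "(\<lambda>p. \<phi> (Delta (fst p) n (snd p) a)) \<in> borel_measurable (window_space n)"
    and I[measurable]: "I \<in> sets borel" and Ifin: "emeasure lborel I < \<infinity>"
    and mean: "\<And>u. u \<in> I \<Longrightarrow> (\<integral>w. \<phi> (Delta (sample w) n u a) \<partial>M) \<le> b"
  shows "prob {w\<in>space M. b * measure lborel I + e \<le> (LINT u:I|lborel. \<phi> (Delta (sample w) n u a))}
    \<le> exp (- e\<^sup>2 / (8 * L\<^sup>2 * a ^ CARD('d)))"
proof -
  let ?J = "{1..n}"
  let ?P = "iid_space ?J unif_cube :: (nat \<Rightarrow> real^'d) measure"
  let ?r = "\<lambda>w. \<lambda>i\<in>?J. U i w"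
  have setsP: "sets ?P = sets (PiM ?J (\<lambda>_. borel))" by (intro sets_PiM_cong) auto
  note [measurable_cong] = setsP
  define F where "F x = (LINT u:I|lborel. \<phi> (Delta x n u a))" for x
  have Fr: "F (sample w) = F (?r w)" for w
    unfolding F_def using Delta_cong[of n "sample w" "?r w"] by simp
  have Fm[measurable]: "F \<in> borel_measurable (PiM ?J (\<lambda>_. borel))"
    unfolding F_def set_lebesgue_integral_def by measurable
  have r[measurable]: "?r \<in> measurable M (PiM ?J (\<lambda>_. borel))" by measurable
  have Iint: "integrable lborel (\<lambda>u. indicator I u *\<^sub>R \<phi> (Delta x n u a))" if "x \<in> space ?P" for x
    using window_measurable(1)[OF meas] Ifin bd by (intro integrableI_bounded_set_indicator[where B = 1]) auto
  have Fb: "\<bar>F x\<bar> \<le> measure lborel I" if x: "x \<in> space ?P" for x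
  proof -
    have "\<bar>F x\<bar> \<le> (\<integral>u. \<bar>indicator I u *\<^sub>R \<phi> (Delta x n u a)\<bar> \<partial>lborel)"
      unfolding F_def set_lebesgue_integral_def by (rule integral_abs_bound)
    also have "\<dots> \<le> (\<integral>u. indicator I u \<partial>lborel)"
    proof (rule integral_mono)
      show "integrable lborel (indicator I :: _ \<Rightarrow> real)" using Ifin by (intro integrable_real_indicator) auto
      show "\<bar>indicator I u *\<^sub>R \<phi> (Delta x n u a)\<bar> \<le> indicator I u" for u
        using bd by (auto simp: indicator_def)
    qed (use Iint[OF x] in \<open>rule integrable_abs\<close>)
    finally show ?thesis by simp
  qed
  let ?N = "real n * a ^ CARD('d)"
  have N: "?N > 0" using n a by simp
  define c where "c = 2 * L * a ^ CARD('d) / sqrt ?N"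
  have c: "c > 0" using L a N by (simp add: c_def)
  have Fd: "\<bar>F (x(i:=y)) - F x\<bar> \<le> c" if x: "x \<in> space ?P" and i: "i \<in> ?J" and y: "y \<in> space unif_cube" for x i y
  proof -
    have x': "x(i:=y) \<in> space ?P" using x i y fun_upd_PiM[of x ?J unif_cube y i] by (simp add: insert_absorb)
    let ?C1 = "cube (x i - a *\<^sub>R 1) a" and ?C2 = "cube (y - a *\<^sub>R 1) a"
    have fin: "emeasure lborel (cbox p q) < \<infinity>" for p q :: "real^'d"
      by (simp add: emeasure_lborel_cbox_eq)
    have pt: "\<bar>\<phi> (Delta (x(i:=y)) n u a) - \<phi> (Delta x n u a)\<bar> \<le> L / sqrt ?N * (indicator ?C1 u + indicator ?C2 u)" for u
    proof -
      have "\<bar>\<phi> (Delta (x(i:=y)) n u a) - \<phi> (Delta x n u a)\<bar> \<le> L * (indicator (?C1 \<union> ?C2) u / sqrt ?N)"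
        by (rule lip) (use Delta_upd_diff[OF _ n a] in blast)
      also have "\<dots> \<le> L / sqrt ?N * (indicator ?C1 u + indicator ?C2 u)"
      proof -
        have "L / sqrt ?N * indicator (?C1 \<union> ?C2) u \<le> L / sqrt ?N * (indicator ?C1 u + indicator ?C2 u)"
          using L N by (intro mult_left_mono divide_nonneg_nonneg) (auto simp: indicator_def)
        then show ?thesis by simp
      qed
      finally show ?thesis .
    qed
    have "F (x(i:=y)) - F x = (\<integral>u. indicator I u * (\<phi> (Delta (x(i:=y)) n u a) - \<phi> (Delta x n u a)) \<partial>lborel)"
      unfolding F_def set_lebesgue_integral_def
      by (subst Bochner_Integration.integral_diff[symmetric, OF Iint[OF x'] Iint[OF x]]) (simp add: right_diff_distrib)
    also have "\<bar>\<dots>\<bar> \<le> (\<integral>u. \<bar>indicator I u * (\<phi> (Delta (x(i:=y)) n u a) - \<phi> (Delta x n u a))\<bar> \<partial>lborel)"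
      by (rule integral_abs_bound)
    also have "\<dots> \<le> (\<integral>u. L / sqrt ?N * (indicator ?C1 u + indicator ?C2 u) \<partial>lborel)"
    proof (rule integral_mono)
      show "integrable lborel (\<lambda>u. \<bar>indicator I u * (\<phi> (Delta (x(i:=y)) n u a) - \<phi> (Delta x n u a))\<bar>)"
        using Bochner_Integration.integrable_diff[OF Iint[OF x'] Iint[OF x]]
        by (intro integrable_abs) (simp add: right_diff_distrib)
      show "\<bar>indicator I u * (\<phi> (Delta (x(i:=y)) n u a) - \<phi> (Delta x n u a))\<bar>
          \<le> L / sqrt ?N * (indicator ?C1 u + indicator ?C2 u)" for u
        using pt[of u] L N by (cases "u \<in> I") auto
    qed (use fin in \<open>auto intro!: integrable_real_indicator\<close>)
    also have "\<dots> = L / sqrt ?N * (measure lborel ?C1 + measure lborel ?C2)"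
      using fin by (subst integral_mult_right_zero, subst Bochner_Integration.integral_add)
        (auto intro!: integrable_real_indicator)
    also have "\<dots> = c" using a by (simp only: measure_cube less_imp_le) (simp add: c_def field_simps)
    finally show ?thesis .
  qed
  have "measure ?P {x \<in> space ?P. F x \<ge> (\<integral>x. F x \<partial>?P) + e} \<le> exp (- e\<^sup>2 / (2 * real (card ?J) * c\<^sup>2))"
  proof (rule McDiarmid_ineq[OF prob_space_unif_cube _ _ c e])
    show "F \<in> borel_measurable ?P" by measurable
  qed (use n Fb Fd in auto)
  also have "2 * real (card ?J) * c\<^sup>2 = 8 * L\<^sup>2 * a ^ CARD('d)"
  proof -
    have "c\<^sup>2 = 4 * L\<^sup>2 * (a ^ CARD('d))\<^sup>2 / ?N"
      using N by (simp add: c_def power_mult_distrib power_divide)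
    then show ?thesis using n a by (simp add: field_simps power2_eq_square)
  qed
  finally have conc: "measure ?P {x \<in> space ?P. F x \<ge> (\<integral>x. F x \<partial>?P) + e} \<le> exp (- e\<^sup>2 / (8 * L\<^sup>2 * a ^ CARD('d)))" .
  interpret pair_sigma_finite M lborel ..
  have "Delta (?r w) n u a = Delta (sample w) n u a" for w u by (rule Delta_cong) simp
  with window_measurable(2)[OF meas]
  have meas2: "(\<lambda>p. \<phi> (Delta (?r (fst p)) n (snd p) a)) \<in> borel_measurable (M \<Otimes>\<^sub>M lborel)"
    by simp
  have "emeasure (M \<Otimes>\<^sub>M lborel) (space M \<times> I) < \<infinity>"
    using Ifin by (simp add: lborel.emeasure_pair_measure_Times emeasure_space_1)
  then have "integrable (M \<Otimes>\<^sub>M lborel) (\<lambda>p. indicator (space M \<times> I) p *\<^sub>R \<phi> (Delta (?r (fst p)) n (snd p) a))"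
    using meas2 bd by (intro integrableI_bounded_set_indicator[where B = 1]) auto
  then have int2: "integrable (M \<Otimes>\<^sub>M lborel) (\<lambda>(w,u). indicator I u * \<phi> (Delta (?r w) n u a))"
    by (rule Bochner_Integration.integrable_cong[THEN iffD1, OF refl, rotated])
       (auto simp: space_pair_measure indicator_def)
  have "(\<integral>x. F x \<partial>?P) = (\<integral>w. F (sample w) \<partial>M)"
    unfolding distr_sample[OF n, symmetric] Fr by (rule integral_distr) measurable
  also have "\<dots> = (\<integral>w. \<integral>u. indicator I u * \<phi> (Delta (?r w) n u a) \<partial>lborel \<partial>M)"
    unfolding Fr by (simp add: F_def set_lebesgue_integral_def)
  also have "\<dots> = (\<integral>u. \<integral>w. indicator I u * \<phi> (Delta (?r w) n u a) \<partial>M \<partial>lborel)"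
    using Fubini_integral[OF int2] by simp
  also have "\<dots> \<le> (\<integral>u. indicator I u * b \<partial>lborel)"
  proof (rule integral_mono)
    show "integrable lborel (\<lambda>u. indicator I u * b)"
      using Ifin by (auto intro!: integrable_real_indicator)
    show "integrable lborel (\<lambda>u. \<integral>w. indicator I u * \<phi> (Delta (?r w) n u a) \<partial>M)"
      by (rule integrable_snd[OF int2])
    have *: "Delta (?r w) n u a = Delta (sample w) n u a" for u w by (rule Delta_cong) simp
    show "(\<integral>w. indicator I u * \<phi> (Delta (?r w) n u a) \<partial>M) \<le> indicator I u * b" for u
      unfolding * using mean[of u] by (cases "u \<in> I") auto
  qed
  also have "\<dots> = b * measure lborel I" by simp
  finally have EF: "(\<integral>x. F x \<partial>?P) \<le> b * measure lborel I" .
  have "prob {w\<in>space M. b * measure lborel I + e \<le> F (sample w)}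
      \<le> prob {w\<in>space M. (\<integral>x. F x \<partial>?P) + e \<le> F (?r w)}"
    unfolding Fr
  proof (rule finite_measure_mono)
    show "{w\<in>space M. (\<integral>x. F x \<partial>?P) + e \<le> F (?r w)} \<in> events" by measurable
  qed (use EF in auto)
  also have "\<dots> = measure ?P {x \<in> space ?P. F x \<ge> (\<integral>x. F x \<partial>?P) + e}"
    unfolding distr_sample[OF n, symmetric]
  proof (subst measure_distr)
    show "{x \<in> space (distr M (PiM ?J (\<lambda>_. borel)) ?r). (\<integral>x. F x \<partial>distr M (PiM ?J (\<lambda>_. borel)) ?r) + e \<le> F x} \<in> sets (PiM ?J (\<lambda>_. borel))"
      unfolding space_distr by measurable
  qed (auto intro!: arg_cong[where f=prob] simp: space_PiM)
  also note conc
  finally show ?thesis by (simp add: F_def)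
qed

end

section \<open>Almost sure bounds for all cubes at once\<close>

definition rat_cube :: "rat^'d \<Rightarrow> rat \<Rightarrow> (real^'d) set" where
  "rat_cube c r = cube (\<chi> k. of_rat (c $ k)) (of_rat r)"

text \<open>Approximation from inside, so that the inclusion in a \<open>shrunk_cube\<close> is
  inherited. The corner moves by less than \<open>h / 2\<close> and the side loses between
  \<open>h / 2\<close> and \<open>h\<close>, so the rational cube cannot stick out.\<close>

lemma ex_rat_cube_subset:
  fixes c :: "real^'d"
  assumes r: "r > 0" and e: "e > 0"
  obtains c' r' where "r' > 0" "rat_cube c' r' \<subseteq> cube c r" "r ^ CARD('d) - of_rat r' ^ CARD('d) < e"
proof -
  have "((\<lambda>h. r ^ CARD('d) - (r - h) ^ CARD('d)) \<longlongrightarrow> r ^ CARD('d) - (r - 0) ^ CARD('d)) (at_right 0)"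
    by (intro tendsto_intros)
  then have "\<forall>\<^sub>F h in at_right 0. r ^ CARD('d) - (r - h) ^ CARD('d) < e"
    by (rule order_tendstoD) (use e in simp)
  moreover have "\<forall>\<^sub>F h in at_right (0::real). 0 < h \<and> h < r"
    using r by (auto simp: eventually_at_right[OF r])
  ultimately obtain h where h: "0 < h" "h < r" "r ^ CARD('d) - (r - h) ^ CARD('d) < e"
    using eventually_happens'[OF trivial_limit_at_right_real eventually_conj] by blast
  have "\<exists>q. c $ k < of_rat q \<and> of_rat q < c $ k + h / 2" for k
    using of_rat_dense[of "c $ k" "c $ k + h / 2"] h by auto
  then obtain q where q: "\<And>k. c $ k < of_rat (q k)" "\<And>k. of_rat (q k) < c $ k + h / 2" by metis
  obtain r' where r': "r - h < of_rat r'" "of_rat r' < r - h / 2"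
    using of_rat_dense[of "r - h" "r - h / 2"] h by auto
  show thesis
  proof
    show "r' > 0" using r' h by (smt (verit) zero_less_of_rat_iff)
    have "x \<in> cube c r" if "x \<in> rat_cube (\<chi> k. q k) r'" for x
    proof -
      have "of_rat (q k) \<le> x $ k \<and> x $ k \<le> of_rat (q k) + of_rat r'" for k
        using that by (simp add: rat_cube_def mem_box_cart)
      then have "c $ k \<le> x $ k \<and> x $ k \<le> c $ k + r" for k
        using q[of k] r' by (smt (verit) field_sum_of_halves)
      then show ?thesis by (simp add: mem_box_cart)
    qed
    then show "rat_cube (\<chi> k. q k) r' \<subseteq> cube c r" by blast
    have "(r - h) ^ CARD('d) \<le> of_rat r' ^ CARD('d)" using r' h by (intro power_mono) auto
    then show "r ^ CARD('d) - of_rat r' ^ CARD('d) < e" using h(3) by linarith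
  qed
qed

lemma set_lebesgue_integral_subset_le:
  fixes f :: "'a \<Rightarrow> real"
  assumes [measurable]: "f \<in> borel_measurable M" "A \<in> sets M" "B \<in> sets M" and "A \<subseteq> B"
    and fin: "emeasure M B < \<infinity>" and bd: "\<And>x. \<bar>f x\<bar> \<le> 1"
  shows "(LINT x:B|M. f x) \<le> (LINT x:A|M. f x) + (measure M B - measure M A)"
proof -
  have int: "set_integrable M C f" if "C \<subseteq> B" "C \<in> sets M" for C
  proof -
    have "emeasure M C < \<infinity>" using that fin emeasure_mono[of C B M] by (auto simp: order.strict_trans1)
    then show ?thesis
      unfolding set_integrable_def using that bd by (intro integrableI_bounded_set_indicator[where B = 1]) auto
  qed
  have finD: "emeasure M (B - A) < \<infinity>" using fin emeasure_mono[of "B - A" B M] by (auto simp: order.strict_trans1)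
  have "(LINT x:B|M. f x) = (LINT x:A \<union> (B - A)|M. f x)" using \<open>A \<subseteq> B\<close> by (simp add: Un_absorb1)
  also have "\<dots> = (LINT x:A|M. f x) + (LINT x:B - A|M. f x)"
    using \<open>A \<subseteq> B\<close> by (intro set_integral_Un int) auto
  also have "(LINT x:B - A|M. f x) \<le> (\<integral>x. indicator (B - A) x \<partial>M)"
    unfolding set_lebesgue_integral_def
  proof (rule integral_mono)
    show "integrable M (indicator (B - A) :: _ \<Rightarrow> real)" using finD by (intro integrable_real_indicator) auto
    show "indicator (B - A) x *\<^sub>R f x \<le> indicator (B - A) x" for x
      using bd[of x] by (auto simp: indicator_def)
  qed (use int[of "B - A"] in \<open>auto simp: set_integrable_def\<close>)
  also have "\<dots> = measure M B - measure M A"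
    using \<open>A \<subseteq> B\<close> fin by (simp add: measure_Diff top.not_eq_extremum)
  finally show ?thesis by simp
qed

context uniform_sample
begin

text \<open>Borel-Cantelli along all \<open>n\<close>. The slack in the means and the deviation each
  take half of \<open>e\<close>; the values 1/(j+1) then give all \<open>e\<close> outside one null
  set.\<close>

lemma AE_eventually_window_average_box:
  fixes \<phi> :: "nat \<Rightarrow> (real^'d \<Rightarrow> real) \<Rightarrow> real" and I :: "(real^'d) set"
  assumes a: "\<And>n. n \<ge> 1 \<Longrightarrow> a n > 0" and L: "L > 0"
    and summ: "\<And>K. K > 0 \<Longrightarrow> summable (\<lambda>n. exp (- K / a n ^ CARD('d)))"
    and lip: "\<And>n f g e. unif_close e f g \<Longrightarrow> \<bar>\<phi> n f - \<phi> n g\<bar> \<le> L * e"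
    and bd: "\<And>n f. \<bar>\<phi> n f\<bar> \<le> 1"
    and meas: "\<And>n. (\<lambda>p. \<phi> n (Delta (fst p) n (snd p) (a n))) \<in> borel_measurable (window_space n)"
    and I[measurable]: "I \<in> sets borel" and Ifin: "emeasure lborel I < \<infinity>"
    and mean: "\<And>e. e > 0 \<Longrightarrow> eventually (\<lambda>n. \<forall>u\<in>I. (\<integral>w. \<phi> n (Delta (sample w) n u (a n)) \<partial>M) \<le> b + e) sequentially"
  shows "AE w in M. \<forall>e>0. eventually (\<lambda>n. (LINT u:I|lborel. \<phi> n (Delta (sample w) n u (a n))) \<le> b * measure lborel I + e) sequentially"
proof -
  let ?A = "\<lambda>n w. LINT u:I|lborel. \<phi> n (Delta (sample w) n u (a n))"
  let ?m = "measure lborel I"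
  have Am[measurable]: "?A n \<in> borel_measurable M" for n
  proof -
    have [measurable]: "(\<lambda>p. \<phi> n (Delta (sample (fst p)) n (snd p) (a n))) \<in> borel_measurable (M \<Otimes>\<^sub>M lborel)"
      using window_measurable(2)[OF meas[of n]] by simp
    show ?thesis unfolding set_lebesgue_integral_def by measurable
  qed
  have main: "AE w in M. eventually (\<lambda>n. ?A n w \<le> b * ?m + e) sequentially" if e: "e > 0" for e
  proof -
    define S where "S n = {w\<in>space M. b * ?m + e < ?A n w}" for n
    have [measurable]: "S n \<in> events" for n unfolding S_def by measurable
    \<comment> \<open>Makes the slack in the mean, multiplied by the measure of \<open>I\<close>, at
      most \<open>e / 2\<close>; the summand 1 covers a null set \<open>I\<close>.\<close>
    define e' where "e' = e / (2 * (?m + 1))"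
    have e': "e' > 0" "e' * ?m \<le> e / 2"
      using e by (auto simp: e'_def field_simps add_pos_nonneg)
    define K where "K = (e/2)\<^sup>2 / (8 * L\<^sup>2)"
    have K: "K > 0" using e L by (simp add: K_def)
    have "eventually (\<lambda>n. prob (S n) \<le> exp (- K / a n ^ CARD('d))) sequentially"
      using mean[OF e'(1)] eventually_ge_at_top[of 1]
    proof eventually_elim
      case (elim n)
      have "prob (S n) \<le> prob {w\<in>space M. (b + e') * ?m + e / 2 \<le> ?A n w}"
      proof (rule finite_measure_mono)
        show "S n \<subseteq> {w\<in>space M. (b + e') * ?m + e / 2 \<le> ?A n w}"
          using e' by (auto simp: S_def algebra_simps)
      qed measurable
      also have "\<dots> \<le> exp (- (e/2)\<^sup>2 / (8 * L\<^sup>2 * a n ^ CARD('d)))"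
        using elim a[OF elim(2)] L e
        by (intro window_average_concentration lip bd meas I Ifin) auto
      also have "\<dots> = exp (- K / a n ^ CARD('d))" by (simp add: K_def)
      finally show ?case .
    qed
    then have "summable (\<lambda>n. prob (S n))"
      by (intro summable_comparison_test_ev[OF _ summ[OF K]]) auto
    then have "AE w in M. eventually (\<lambda>n. w \<in> space M - S n) sequentially"
      by (intro borel_cantelli_AE1) (auto simp: emeasure_eq_measure)
    then show ?thesis
      by eventually_elim (auto simp: S_def elim!: eventually_mono)
  qed
  have "AE w in M. \<forall>j::nat. eventually (\<lambda>n. ?A n w \<le> b * ?m + 1 / real (Suc j)) sequentially"
    by (subst AE_all_countable) (auto intro!: main)
  then show ?thesis
  proof eventually_elim
    case (elim w)
    show ?case
    proof (intro allI impI)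
      fix e :: real assume "e > 0"
      then obtain j where "1 / real (Suc j) < e" by (metis nat_approx_posE)
      with elim show "eventually (\<lambda>n. ?A n w \<le> b * ?m + e) sequentially"
        by (auto elim!: eventually_mono[of _ sequentially] dest!: spec[of _ j])
    qed
  qed
qed

text \<open>Countably many rational cubes suffice: the functionals are bounded by 1, so replacing a
  cube by a rational subcube costs at most the difference of the volumes.\<close>

lemma AE_eventually_window_average:
  fixes \<phi> :: "nat \<Rightarrow> (real^'d \<Rightarrow> real) \<Rightarrow> real"
  assumes a: "\<And>n. n \<ge> 1 \<Longrightarrow> a n > 0" and L: "L > 0"
    and summ: "\<And>K. K > 0 \<Longrightarrow> summable (\<lambda>n. exp (- K / a n ^ CARD('d)))"
    and lip: "\<And>n f g e. unif_close e f g \<Longrightarrow> \<bar>\<phi> n f - \<phi> n g\<bar> \<le> L * e"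
    and bd: "\<And>n f. \<bar>\<phi> n f\<bar> \<le> 1"
    and meas: "\<And>n. (\<lambda>p. \<phi> n (Delta (fst p) n (snd p) (a n))) \<in> borel_measurable (window_space n)"
    and mean: "\<And>e \<delta>. e > 0 \<Longrightarrow> \<delta> > 0 \<Longrightarrow> eventually (\<lambda>n. \<forall>u\<in>shrunk_cube \<delta>.
        (\<integral>w. \<phi> n (Delta (sample w) n u (a n)) \<partial>M) \<le> b + e) sequentially"
  shows "AE w in M. \<forall>c r \<delta>. r > 0 \<and> \<delta> > 0 \<and> cube c r \<subseteq> shrunk_cube \<delta> \<longrightarrow>
    (\<forall>e>0. eventually (\<lambda>n. (LINT u:cube c r|lborel. \<phi> n (Delta (sample w) n u (a n))) \<le> b * r ^ CARD('d) + e) sequentially)"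
proof -
  let ?A = "\<lambda>I n w. LINT u:I|lborel. \<phi> n (Delta (sample w) n u (a n))"
  have "AE w in M. \<forall>c r. r > 0 \<longrightarrow> (\<exists>\<delta>>0. rat_cube c r \<subseteq> shrunk_cube \<delta>) \<longrightarrow>
     (\<forall>e>0. eventually (\<lambda>n. ?A (rat_cube c r) n w \<le> b * of_rat r ^ CARD('d) + e) sequentially)"
    unfolding AE_all_countable
  proof (intro allI AE_impI impI)
    fix c :: "rat^'d" and r assume r: "r > 0" and "\<exists>\<delta>>0. rat_cube c r \<subseteq> shrunk_cube \<delta>"
    then obtain \<delta> where \<delta>: "\<delta> > 0" "rat_cube c r \<subseteq> shrunk_cube \<delta>" by blast
    have m: "measure lborel (rat_cube c r) = of_rat r ^ CARD('d)" "emeasure lborel (rat_cube c r) < \<infinity>"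
      using r by (simp_all add: rat_cube_def measure_cube emeasure_cube)
    show "AE w in M. \<forall>e>0. eventually (\<lambda>n. ?A (rat_cube c r) n w \<le> b * of_rat r ^ CARD('d) + e) sequentially"
      unfolding m(1)[symmetric]
    proof (rule AE_eventually_window_average_box[OF a L summ lip bd meas _ m(2)])
      fix e :: real assume "e > 0"
      from mean[OF this \<delta>(1)] show "eventually (\<lambda>n. \<forall>u\<in>rat_cube c r. (\<integral>w. \<phi> n (Delta (sample w) n u (a n)) \<partial>M) \<le> b + e) sequentially"
        by eventually_elim (use \<delta>(2) in blast)
    qed (auto simp: rat_cube_def)
  qed
  with AE_space show ?thesis
  proof eventually_elim
    case (elim w)
    show ?case
    proof (intro allI impI, elim conjE)
      fix c :: "real^'d" and r \<delta> e :: real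
      assume r: "r > 0" and \<delta>: "\<delta> > 0" and sub: "cube c r \<subseteq> shrunk_cube \<delta>" and e: "e > 0"
      \<comment> \<open>The gap in volume is paid once for the integral, through the bound 1, and
        once for the limit, through \<open>\<bar>b\<bar>\<close>; hence the factor
        \<open>1 + \<bar>b\<bar>\<close>.\<close>
      obtain c' r' where q: "r' > 0" "rat_cube c' r' \<subseteq> cube c r"
        "r ^ CARD('d) - of_rat r' ^ CARD('d) < e / (2 * (1 + \<bar>b\<bar>))"
        by (rule ex_rat_cube_subset[OF r, of "e / (2 * (1 + \<bar>b\<bar>))" c]) (use e in \<open>auto intro!: divide_pos_pos\<close>)
      have ev: "eventually (\<lambda>n. ?A (rat_cube c' r') n w \<le> b * of_rat r' ^ CARD('d) + e / 2) sequentially"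
        using elim(2) q(1,2) sub \<delta> e by (meson half_gt_zero order_trans)
      have D: "0 \<le> r ^ CARD('d) - of_rat r' ^ CARD('d)"
      proof -
        have "measure lborel (rat_cube c' r') \<le> measure lborel (cube c r)"
          using q(2) r by (intro measure_mono_fmeasurable) (auto simp: rat_cube_def)
        then show ?thesis using r q(1) by (simp add: measure_cube rat_cube_def)
      qed
      have small: "(1 + \<bar>b\<bar>) * (r ^ CARD('d) - of_rat r' ^ CARD('d)) \<le> e / 2"
        using q(3) by (simp add: field_simps)
      show "eventually (\<lambda>n. ?A (cube c r) n w \<le> b * r ^ CARD('d) + e) sequentially"
        using ev
      proof eventually_elim
        case (elim n)
        have "(\<lambda>u. \<phi> n (Delta (sample w) n u (a n))) \<in> borel_measurable lborel"
          using window_measurable(1)[OF meas[of n]] by simp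
        then have "?A (cube c r) n w \<le> ?A (rat_cube c' r') n w + (measure lborel (cube c r) - measure lborel (rat_cube c' r'))"
          using r by (intro set_lebesgue_integral_subset_le q(2) bd) (auto simp: rat_cube_def emeasure_cube)
        also have "\<dots> \<le> b * of_rat r' ^ CARD('d) + e / 2 + (r ^ CARD('d) - of_rat r' ^ CARD('d))"
          using elim r q(1) by (simp add: measure_cube rat_cube_def)
        also have "\<dots> \<le> b * r ^ CARD('d) + e"
        proof -
          have "- b * (r ^ CARD('d) - of_rat r' ^ CARD('d)) \<le> \<bar>b\<bar> * (r ^ CARD('d) - of_rat r' ^ CARD('d))"
            using D by (intro mult_right_mono) auto
          then show ?thesis using small by (simp add: algebra_simps)
        qed
        finally show ?case .
      qed
    qed
  qed
qed

end

section \<open>Exponential moments and chaining\<close>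

text \<open>For negative \<open>x\<close> put \<open>y = - x\<close> and multiply
  \<open>1 - y + y\<^sup>2\<close> by the quadratic lower bound of \<open>exp y\<close>: the product
  is \<open>1 + (y\<^sup>2 + y ^ 3 + y ^ 4) / 2\<close>, which is at least 1.\<close>

lemma exp_le_quadratic:
  fixes x :: real
  assumes "\<bar>x\<bar> \<le> 1"
  shows "exp x \<le> 1 + x + x\<^sup>2"
proof (cases "x \<ge> 0")
  case True
  then show ?thesis using assms exp_bound[of x] by simp
next
  case False
  define y where "y = - x"
  have y: "0 \<le> y" "y \<le> 1" using False assms by (auto simp: y_def)
  have "1 \<le> 1 + (y\<^sup>2 + y ^ 3 + y ^ 4) / 2" using y by simp
  also have "\<dots> = (1 - y + y\<^sup>2) * (1 + y + y\<^sup>2 / 2)"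
    by (simp add: field_simps power2_eq_square power3_eq_cube power4_eq_xxxx)
  also have "\<dots> \<le> (1 - y + y\<^sup>2) * exp y"
    using y exp_lower_Taylor_quadratic[of y] by (intro mult_left_mono) (auto simp: add_increasing2)
  finally show ?thesis by (simp add: y_def exp_minus field_simps)
qed

text \<open>A maximal inequality without Jensen: \<open>x \<le> exp x\<close>, applied to
  \<open>s\<close> times the maximum minus \<open>ln (2 * card Z)\<close>, replaces the maximum by a
  normalised sum of exponentials. The price is \<open>exp b\<close> in place of \<open>b\<close>,
  harmless because \<open>b\<close> stays bounded in the applications. \<open>C\<close> provides
  integrability and does not enter the bound.\<close>

lemma (in prob_space) expectation_Max_abs_le:
  fixes Y :: "'z \<Rightarrow> 'a \<Rightarrow> real"
  assumes Z: "finite Z" "Z \<noteq> {}" and s: "s > 0"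
    and Y[measurable]: "\<And>z. z \<in> Z \<Longrightarrow> Y z \<in> borel_measurable M"
    and bd: "\<And>z w. z \<in> Z \<Longrightarrow> \<bar>Y z w\<bar> \<le> C"
    and mgf: "\<And>z. z \<in> Z \<Longrightarrow> expectation (\<lambda>w. exp (s * Y z w)) \<le> exp b"
       "\<And>z. z \<in> Z \<Longrightarrow> expectation (\<lambda>w. exp (- s * Y z w)) \<le> exp b"
  shows "expectation (\<lambda>w. Max ((\<lambda>z. \<bar>Y z w\<bar>) ` Z)) \<le> (ln (2 * real (card Z)) + exp b) / s"
    and "integrable M (\<lambda>w. Max ((\<lambda>z. \<bar>Y z w\<bar>) ` Z))"
proof -
  let ?K = "real (card Z)"
  have K: "?K > 0" using Z by (simp add: card_gt_0_iff)
  have inte: "integrable M (\<lambda>w. exp (r * Y z w))" if "z \<in> Z" for z r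
  proof (rule integrable_const_bound[where B = "exp (\<bar>r\<bar> * C)"])
    have "r * Y z w \<le> \<bar>r\<bar> * C" for w
    proof -
      have "r * Y z w \<le> \<bar>r\<bar> * \<bar>Y z w\<bar>" by (metis abs_ge_self abs_mult)
      also have "\<dots> \<le> \<bar>r\<bar> * C" using bd[OF that] by (intro mult_left_mono) auto
      finally show ?thesis .
    qed
    then show "AE w in M. norm (exp (r * Y z w)) \<le> exp (\<bar>r\<bar> * C)" by simp
  qed (use that in measurable)
  show int: "integrable M (\<lambda>w. Max ((\<lambda>z. \<bar>Y z w\<bar>) ` Z))"
  proof (rule integrable_const_bound[where B = C])
    have "0 \<le> Max ((\<lambda>z. \<bar>Y z w\<bar>) ` Z)" for w
    proof -
      obtain z where "z \<in> Z" using Z by auto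
      then have "\<bar>Y z w\<bar> \<le> Max ((\<lambda>z. \<bar>Y z w\<bar>) ` Z)" using Z by (intro Max_ge) auto
      then show ?thesis by linarith
    qed
    moreover have "Max ((\<lambda>z. \<bar>Y z w\<bar>) ` Z) \<le> C" for w
      using Z bd by (subst Max_le_iff) auto
    ultimately show "AE w in M. norm (Max ((\<lambda>z. \<bar>Y z w\<bar>) ` Z)) \<le> C" by simp
  qed (use Z in measurable)
  let ?l = "ln (2 * ?K)"
  have pt: "s * Max ((\<lambda>z. \<bar>Y z w\<bar>) ` Z) \<le> ?l + (1 / (2 * ?K)) * (\<Sum>z\<in>Z. exp (s * Y z w) + exp (- s * Y z w))" for w
  proof -
    have "Max ((\<lambda>z. \<bar>Y z w\<bar>) ` Z) \<in> (\<lambda>z. \<bar>Y z w\<bar>) ` Z" using Z by (intro Max_in) auto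
    then obtain z where z: "z \<in> Z" "Max ((\<lambda>z. \<bar>Y z w\<bar>) ` Z) = \<bar>Y z w\<bar>" by auto
    have "s * \<bar>Y z w\<bar> - ?l \<le> exp (s * \<bar>Y z w\<bar> - ?l)" using exp_ge_add_one_self[of "s * \<bar>Y z w\<bar> - ?l"] by linarith
    also have "\<dots> = 1 / (2 * ?K) * exp (s * \<bar>Y z w\<bar>)" using K by (simp add: exp_diff)
    also have "\<dots> \<le> 1 / (2 * ?K) * (exp (s * Y z w) + exp (- s * Y z w))"
      using K by (intro mult_left_mono) (auto simp: abs_if)
    also have "\<dots> \<le> 1 / (2 * ?K) * (\<Sum>z\<in>Z. exp (s * Y z w) + exp (- s * Y z w))"
      using K Z z by (intro mult_left_mono member_le_sum) auto
    finally show ?thesis using z by simp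
  qed
  have "s * expectation (\<lambda>w. Max ((\<lambda>z. \<bar>Y z w\<bar>) ` Z)) = expectation (\<lambda>w. s * Max ((\<lambda>z. \<bar>Y z w\<bar>) ` Z))" by simp
  also have "\<dots> \<le> expectation (\<lambda>w. ?l + (1 / (2 * ?K)) * (\<Sum>z\<in>Z. exp (s * Y z w) + exp (- s * Y z w)))"
    by (intro integral_mono integrable_mult_right int pt Bochner_Integration.integrable_add Bochner_Integration.integrable_sum inte) auto
  also have "\<dots> = ?l + (1 / (2 * ?K)) * (\<Sum>z\<in>Z. expectation (\<lambda>w. exp (s * Y z w)) + expectation (\<lambda>w. exp (- s * Y z w)))"
  proof -
    have i1: "integrable M (\<lambda>w. exp (s * Y z w) + exp (- s * Y z w))" if "z \<in> Z" for z
      by (intro Bochner_Integration.integrable_add inte that)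
    have "expectation (\<lambda>w. \<Sum>z\<in>Z. exp (s * Y z w) + exp (- s * Y z w))
      = (\<Sum>z\<in>Z. expectation (\<lambda>w. exp (s * Y z w) + exp (- s * Y z w)))"
      by (intro Bochner_Integration.integral_sum i1)
    also have "\<dots> = (\<Sum>z\<in>Z. expectation (\<lambda>w. exp (s * Y z w)) + expectation (\<lambda>w. exp (- s * Y z w)))"
      by (intro sum.cong refl Bochner_Integration.integral_add inte)
    finally have E: "expectation (\<lambda>w. \<Sum>z\<in>Z. exp (s * Y z w) + exp (- s * Y z w))
      = (\<Sum>z\<in>Z. expectation (\<lambda>w. exp (s * Y z w)) + expectation (\<lambda>w. exp (- s * Y z w)))" .
    have i2: "integrable M (\<lambda>w. \<Sum>z\<in>Z. exp (s * Y z w) + exp (- s * Y z w))"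
      by (intro Bochner_Integration.integrable_sum i1)
    show ?thesis
      by (subst Bochner_Integration.integral_add[OF integrable_const integrable_mult_right[OF i2]], subst integral_mult_right_zero, subst E)
         (simp add: prob_space)
  qed
  also have "\<dots> \<le> ?l + (1 / (2 * ?K)) * (\<Sum>z\<in>Z. exp b + exp b)"
    using K mgf by (intro add_left_mono mult_left_mono sum_mono add_mono) auto
  also have "\<dots> = ?l + exp b" using K by simp
  finally show "expectation (\<lambda>w. Max ((\<lambda>z. \<bar>Y z w\<bar>) ` Z)) \<le> (?l + exp b) / s"
    using s by (simp add: field_simps)
qed

text \<open>Keeps the window inside the cube on which the sample is uniform, so that hitting
  probabilities are exactly volumes; this is what the distance \<open>\<delta>\<close> from the
  upper faces buys.\<close>

lemma corner_box_subset_unit_cube: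
  fixes u t :: "real^'d"
  assumes "u \<in> shrunk_cube \<delta>" "t \<in> cbox 0 1" "0 < a" "a \<le> \<delta>"
  shows "cbox u (u + a *\<^sub>R t) \<subseteq> cbox 0 1"
proof
  fix y assume y: "y \<in> cbox u (u + a *\<^sub>R t)"
  have "0 \<le> y $ k \<and> y $ k \<le> 1" for k
  proof -
    have "0 \<le> u $ k" "u $ k \<le> 1 - \<delta>" using assms(1) by (auto simp: mem_box_cart)
    moreover have "a * t $ k \<le> a * 1" using assms by (intro mult_left_mono) (auto simp: mem_box_cart)
    moreover have "u $ k \<le> y $ k" "y $ k \<le> u $ k + a * t $ k" using y by (auto simp: mem_corner_box)
    ultimately show ?thesis using assms by linarith
  qed
  then show "y \<in> cbox 0 1" by (simp add: mem_box_cart)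
qed

lemma Delta_alt:
  fixes u t :: "real^'d"
  assumes "t \<in> cbox 0 1" "a > 0"
  shows "Delta X n u a t = (\<Sum>i\<in>{1..n}. indicator (cbox u (u + a *\<^sub>R t)) (X i) - a ^ CARD('d) * (\<Prod>k\<in>UNIV. t $ k))
     / sqrt (real n * a ^ CARD('d))"
proof -
  have "measure lborel (cbox 0 (a *\<^sub>R t)) = a ^ CARD('d) * (\<Prod>k\<in>UNIV. t $ k)"
    using measure_corner_box[of a t 0] assms by (simp add: mem_box_cart)
  then show ?thesis by (simp add: Delta_def)
qed

lemma prod_diff_le_sum:
  fixes s t :: "real^'d"
  assumes "s \<in> cbox 0 1" "t \<in> cbox 0 1" "\<And>k. s $ k \<le> t $ k"
  shows "(\<Prod>k\<in>UNIV. t $ k) - (\<Prod>k\<in>UNIV. s $ k) \<le> (\<Sum>k\<in>UNIV. t $ k - s $ k)"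
proof -
  have "norm ((\<Prod>k\<in>UNIV. t $ k) - (\<Prod>k\<in>UNIV. s $ k)) \<le> (\<Sum>k\<in>UNIV. norm (t $ k - s $ k))"
    using assms by (intro norm_prod_diff) (auto simp: mem_box_cart)
  then show ?thesis using assms by simp
qed

lemma prod_unit_bounds:
  fixes t :: "real^'d"
  assumes "t \<in> cbox 0 1"
  shows "0 \<le> (\<Prod>k\<in>UNIV. t $ k)" "(\<Prod>k\<in>UNIV. t $ k) \<le> 1"
  using assms by (auto simp: mem_box_cart intro!: prod_nonneg prod_le_1)

context uniform_sample
begin

lemma prob_U:
  assumes [measurable]: "B \<in> sets borel" and "B \<subseteq> cbox 0 1" and i: "i \<ge> 1"
  shows "expectation (\<lambda>w. indicator B (U i w)) = measure lborel B"
proof -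
  have [measurable]: "U i \<in> borel_measurable M" using i by simp
  have "expectation (\<lambda>w. indicator B (U i w)) = (\<integral>x. (indicator B x :: real) \<partial>distr M borel (U i))"
    by (rule integral_distr[symmetric]) auto
  also have "\<dots> = measure unif_cube B" unfolding unif[OF i] by simp
  also have "\<dots> = measure lborel B"
    using assms(2) measure_cube[of 1 "0::real^'d"] emeasure_cube[of 1 "0::real^'d"]
    by (subst measure_uniform_measure) (auto simp: Int_absorb1 Int_absorb2)
  finally show ?thesis .
qed

text \<open>The exact moment of one summand is at most
  \<open>exp (?p * (exp \<theta> - 1 - \<theta>))\<close>. The factor \<open>?p\<close> must
  survive, since it will be of order \<open>a ^ CARD('d)\<close>; Hoeffding's lemma would lose it.
  The price is the restriction on \<open>\<theta>\<close>.\<close>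

lemma mgf_centered_count:
  assumes B[measurable]: "B \<in> sets borel" and Bsub: "B \<subseteq> cbox 0 1" and th: "\<bar>\<theta>\<bar> \<le> 1"
  shows "expectation (\<lambda>w. exp (\<theta> * (\<Sum>i\<in>{1..n}. indicator B (U i w) - measure lborel B)))
    \<le> exp (real n * measure lborel B * \<theta>\<^sup>2)"
proof -
  let ?p = "measure lborel B"
  let ?X = "\<lambda>i w. exp (\<theta> * (indicator B (U i w) - ?p))"
  have one: "expectation (?X i) = exp (- \<theta> * ?p) * (1 + ?p * (exp \<theta> - 1))"
    and int: "integrable M (?X i)" if i: "i \<in> {1..n}" for i
  proof -
    have [measurable]: "U i \<in> borel_measurable M" using i by simp
    have X: "?X i w = exp (- \<theta> * ?p) + exp (- \<theta> * ?p) * (exp \<theta> - 1) * indicator B (U i w)" for w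
      by (auto simp: indicator_def exp_add[symmetric] algebra_simps)
    have ii: "integrable M (\<lambda>w. indicator B (U i w) :: real)"
      by (rule integrable_const_bound[where B = 1]) auto
    show "integrable M (?X i)" unfolding X using ii by auto
    show "expectation (?X i) = exp (- \<theta> * ?p) * (1 + ?p * (exp \<theta> - 1))"
      unfolding X using ii prob_U[OF B Bsub, of i] i by (simp add: prob_space algebra_simps)
  qed
  have ind: "indep_vars (\<lambda>_. borel) ?X {1..n}"
  proof -
    have "indep_vars (\<lambda>_. borel) U {1..n}" by (rule indep_vars_subset[OF indep]) auto
    from indep_vars_compose2[OF this, of "\<lambda>_ x. exp (\<theta> * (indicator B x - ?p))" "\<lambda>_. borel"] show ?thesis by simp
  qed
  have "expectation (\<lambda>w. exp (\<theta> * (\<Sum>i\<in>{1..n}. indicator B (U i w) - ?p))) = expectation (\<lambda>w. \<Prod>i\<in>{1..n}. ?X i w)"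
    by (simp only: sum_distrib_left exp_sum[OF finite_atLeastAtMost])
  also have "\<dots> = (\<Prod>i\<in>{1..n}. expectation (?X i))"
    by (rule indep_vars_lebesgue_integral[OF _ ind int]) auto
  also have "\<dots> = (\<Prod>i\<in>{1..n}. exp (- \<theta> * ?p) * (1 + ?p * (exp \<theta> - 1)))" by (intro prod.cong one) auto
  also have "\<dots> = (exp (- \<theta> * ?p) * (1 + ?p * (exp \<theta> - 1))) ^ n" by simp
  also have "\<dots> \<le> (exp (?p * \<theta>\<^sup>2)) ^ n"
  proof (rule power_mono)
    have p1: "?p \<le> 1"
    proof -
      have "?p \<le> measure lborel (cbox 0 (1::real^'d))"
        using Bsub by (intro measure_mono_fmeasurable) auto
      then show ?thesis using measure_cube[of 1 "0::real^'d"] by simp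
    qed
    have "?p * (1 - exp \<theta>) \<le> ?p * 1" by (intro mult_left_mono) auto
    also note p1
    finally have "?p * (1 - exp \<theta>) \<le> 1" by simp
    then show "0 \<le> exp (- \<theta> * ?p) * (1 + ?p * (exp \<theta> - 1))" by (intro mult_nonneg_nonneg) (auto simp: algebra_simps)
    have "1 + ?p * (exp \<theta> - 1) \<le> exp (?p * (exp \<theta> - 1))" by (rule exp_ge_add_one_self)
    also have "\<dots> \<le> exp (?p * (\<theta> + \<theta>\<^sup>2))"
      using exp_le_quadratic[OF th] by (auto intro!: mult_left_mono)
    finally have "exp (- \<theta> * ?p) * (1 + ?p * (exp \<theta> - 1)) \<le> exp (- \<theta> * ?p) * exp (?p * (\<theta> + \<theta>\<^sup>2))"
      by (intro mult_left_mono) auto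
    then show "exp (- \<theta> * ?p) * (1 + ?p * (exp \<theta> - 1)) \<le> exp (?p * \<theta>\<^sup>2)"
      by (simp add: exp_add[symmetric] algebra_simps)
  qed
  also have "\<dots> = exp (real n * ?p * \<theta>\<^sup>2)" by (simp add: exp_of_nat_mult[symmetric] mult.assoc)
  finally show ?thesis .
qed

text \<open>This is \<open>mgf_centered_count\<close> at
  \<open>\<theta> = r / sqrt (real n * a ^ CARD('d))\<close>; the condition on \<open>r\<close> is
  the condition on \<open>\<theta>\<close>.\<close>

lemma mgf_scaled_count:
  assumes B[measurable]: "B \<in> sets borel" and Bsub: "B \<subseteq> cbox 0 1" and n: "n \<ge> 1" and a: "a > 0"
    and q: "measure lborel B = a ^ CARD('d) * q"
    and r: "\<bar>r\<bar> \<le> sqrt (real n * a ^ CARD('d))"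
  shows "expectation (\<lambda>w. exp (r * ((\<Sum>i\<in>{1..n}. indicator B (U i w) - a ^ CARD('d) * q) / sqrt (real n * a ^ CARD('d)))))
    \<le> exp (r\<^sup>2 * q)"
proof -
  let ?N = "real n * a ^ CARD('d)"
  have N: "?N > 0" using n a by simp
  have "expectation (\<lambda>w. exp (r / sqrt ?N * (\<Sum>i\<in>{1..n}. indicator B (U i w) - measure lborel B)))
    \<le> exp (real n * measure lborel B * (r / sqrt ?N)\<^sup>2)"
    using r N by (intro mgf_centered_count B Bsub) (simp add: abs_divide)
  also have "real n * measure lborel B * (r / sqrt ?N)\<^sup>2 = r\<^sup>2 * q"
    using N n a by (simp add: q power_divide field_simps)
  finally show ?thesis by (simp add: q)
qed

lemma mgf_Delta:
  assumes u: "u \<in> shrunk_cube \<delta>" and t: "t \<in> cbox 0 1" and a: "0 < a" "a \<le> \<delta>" and n: "n \<ge> 1"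
    and r: "\<bar>r\<bar> \<le> sqrt (real n * a ^ CARD('d))"
  shows "expectation (\<lambda>w. exp (r * Delta (sample w) n u a t)) \<le> exp (r\<^sup>2)"
proof -
  have "expectation (\<lambda>w. exp (r * Delta (sample w) n u a t)) \<le> exp (r\<^sup>2 * (\<Prod>k\<in>UNIV. t $ k))"
    unfolding Delta_alt[OF t a(1)] using t a
    by (intro mgf_scaled_count n r a corner_box_subset_unit_cube[OF u] measure_corner_box) (auto simp: mem_box_cart)
  also have "\<dots> \<le> exp (r\<^sup>2)" using prod_unit_bounds[OF t] by (simp add: mult_left_le)
  finally show ?thesis .
qed

text \<open>The increment counts points in the difference of two nested boxes, whose volume is at
  most \<open>a ^ CARD('d)\<close> times the l1 distance of \<open>s\<close> and
  \<open>t\<close>.\<close>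

lemma mgf_Delta_increment:
  assumes u: "u \<in> shrunk_cube \<delta>" and s: "s \<in> cbox 0 1" and t: "t \<in> cbox 0 1" and st: "\<And>k. s $ k \<le> t $ k"
    and a: "0 < a" "a \<le> \<delta>" and n: "n \<ge> 1"
    and r: "\<bar>r\<bar> \<le> sqrt (real n * a ^ CARD('d))"
    and v: "(\<Sum>k\<in>UNIV. t $ k - s $ k) \<le> v"
  shows "expectation (\<lambda>w. exp (r * (Delta (sample w) n u a t - Delta (sample w) n u a s))) \<le> exp (r\<^sup>2 * v)"
proof -
  let ?s = "\<Prod>k\<in>UNIV. s $ k" and ?t = "\<Prod>k\<in>UNIV. t $ k"
  let ?S = "cbox u (u + a *\<^sub>R s)" and ?T = "cbox u (u + a *\<^sub>R t)"
  have sub: "?S \<subseteq> ?T"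
  proof -
    have "a * s $ k \<le> a * t $ k" for k using st a by (intro mult_left_mono) auto
    then show ?thesis unfolding subset_iff mem_corner_box by (meson add_left_mono order_trans)
  qed
  have D: "Delta (sample w) n u a t - Delta (sample w) n u a s
     = (\<Sum>i\<in>{1..n}. indicator (?T - ?S) (U i w) - a ^ CARD('d) * (?t - ?s)) / sqrt (real n * a ^ CARD('d))" for w
    unfolding Delta_alt[OF t a(1)] Delta_alt[OF s a(1)] diff_divide_distrib[symmetric] sum_subtractf[symmetric]
    using sub by (intro arg_cong2[where f="(/)"] sum.cong refl) (auto simp: indicator_def algebra_simps)
  have m: "measure lborel (?T - ?S) = a ^ CARD('d) * (?t - ?s)"
    using sub a s t by (subst measure_Diff)
      (auto simp: measure_corner_box mem_box_cart right_diff_distrib emeasure_lborel_cbox_eq)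
  have "expectation (\<lambda>w. exp (r * (Delta (sample w) n u a t - Delta (sample w) n u a s))) \<le> exp (r\<^sup>2 * (?t - ?s))"
    unfolding D using corner_box_subset_unit_cube[OF u t a]
    by (intro mgf_scaled_count n r a m) auto
  also have "\<dots> \<le> exp (r\<^sup>2 * v)"
    using prod_diff_le_sum[OF s t st] v by (auto intro!: mult_left_mono)
  finally show ?thesis .
qed

end

section \<open>Dyadic grids and chaining of paths\<close>

definition dfloor :: "nat \<Rightarrow> real^'d \<Rightarrow> real^'d" where
  "dfloor j t = (\<chi> k. of_int \<lfloor>2 ^ j * t $ k\<rfloor> / 2 ^ j)"

definition dceil :: "nat \<Rightarrow> real^'d \<Rightarrow> real^'d" where
  "dceil j t = (\<chi> k. of_int \<lceil>2 ^ j * t $ k\<rceil> / 2 ^ j)"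

definition dgrid :: "nat \<Rightarrow> (real^'d) set" where
  "dgrid j = (\<lambda>f. \<chi> k. of_int (f k) / 2 ^ j) ` (PiE UNIV (\<lambda>_. {0..2 ^ j :: int}))"

lemma mem_dgrid: "t \<in> dgrid j \<longleftrightarrow> (\<forall>k. \<exists>i\<in>{0..2 ^ j :: int}. t $ k = of_int i / 2 ^ j)"
proof
  assume "\<forall>k. \<exists>i\<in>{0..2 ^ j :: int}. t $ k = of_int i / 2 ^ j"
  then obtain f where "\<And>k. f k \<in> {0..2 ^ j :: int}" "\<And>k. t $ k = of_int (f k) / 2 ^ j" by metis
  then show "t \<in> dgrid j"
    unfolding dgrid_def by (intro image_eqI[of _ _ f]) (auto simp: vec_eq_iff)
qed (auto simp: dgrid_def)

lemma finite_dgrid: "finite (dgrid j)"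
  unfolding dgrid_def by (intro finite_imageI finite_PiE) auto

lemma card_dgrid_le: "card (dgrid j :: (real^'d) set) \<le> (2 ^ j + 1) ^ CARD('d)"
proof -
  have "card (dgrid j :: (real^'d) set) \<le> card (PiE (UNIV :: 'd set) (\<lambda>_. {0..2 ^ j :: int}))"
    unfolding dgrid_def by (intro card_image_le finite_PiE) auto
  also have "\<dots> = (2 ^ j + 1) ^ CARD('d)"
    by (subst card_PiE) (auto simp: nat_add_distrib nat_power_eq)
  finally show ?thesis .
qed

lemma dgrid_subset_cube: "dgrid j \<subseteq> cbox 0 (1 :: real^'d)"
proof
  fix t :: "real^'d" assume t: "t \<in> dgrid j"
  have "0 \<le> t $ k \<and> t $ k \<le> 1" for k
  proof -
    obtain i :: int where i: "i \<in> {0..2 ^ j}" "t $ k = of_int i / 2 ^ j"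
      using t unfolding mem_dgrid by blast
    then have "real_of_int i \<le> of_int (2 ^ j)" by (simp only: of_int_le_iff) simp
    then show ?thesis using i by simp
  qed
  then show "t \<in> cbox 0 1" by (simp add: mem_box_cart)
qed

lemma dgrid_Suc: "dgrid j \<subseteq> dgrid (Suc j)"
proof
  fix t :: "real^'a" assume "t \<in> dgrid j"
  then have "\<exists>i\<in>{0..2 ^ Suc j :: int}. t $ k = of_int i / 2 ^ Suc j" for k
  proof -
    obtain i :: int where "i \<in> {0..2 ^ j}" "t $ k = of_int i / 2 ^ j"
      using \<open>t \<in> dgrid j\<close> unfolding mem_dgrid by blast
    then show ?thesis by (intro bexI[of _ "2 * i"]) auto
  qed
  then show "t \<in> dgrid (Suc j)" by (simp add: mem_dgrid)
qed

lemma dfloor_in_grid: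
  assumes "t \<in> cbox 0 1" shows "dfloor j t \<in> dgrid j"
proof -
  have "\<lfloor>2 ^ j * t $ k\<rfloor> \<in> {0..2 ^ j}" for k
  proof -
    have "2 ^ j * t $ k < 2 ^ j + 1" "0 \<le> 2 ^ j * t $ k" using assms by (auto simp: mem_box_cart intro: order.strict_trans1[of _ "2 ^ j * 1"])
    then show ?thesis by (simp add: floor_le_iff)
  qed
  then show ?thesis by (auto simp: mem_dgrid dfloor_def)
qed

lemma dceil_in_grid:
  assumes "t \<in> cbox 0 1" shows "dceil j t \<in> dgrid j"
proof -
  have "\<lceil>2 ^ j * t $ k\<rceil> \<in> {0..2 ^ j}" for k
  proof -
    have "2 ^ j * t $ k \<le> 2 ^ j" "0 \<le> 2 ^ j * t $ k" using assms by (auto simp: mem_box_cart)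
    then show ?thesis by (auto simp: ceiling_le_iff le_ceiling_iff intro: order.strict_trans2[of "-1" 0])
  qed
  then show ?thesis by (auto simp: mem_dgrid dceil_def)
qed

lemma dfloor_le: "dfloor j t $ k \<le> t $ k"
  by (simp add: dfloor_def divide_le_eq mult.commute)

lemma dfloor_ge: "t $ k \<le> dfloor j t $ k + 1 / 2 ^ j"
proof -
  have "2 ^ j * t $ k \<le> of_int \<lfloor>2 ^ j * t $ k\<rfloor> + 1" by linarith
  then show ?thesis by (simp add: dfloor_def field_simps)
qed

lemma dceil_ge: "t $ k \<le> dceil j t $ k"
  by (simp add: dceil_def le_divide_eq mult.commute)

lemma dceil_le_floor: "dceil j t $ k \<le> dfloor j t $ k + 1 / 2 ^ j"
proof -
  have "real_of_int \<lceil>2 ^ j * t $ k\<rceil> \<le> of_int \<lfloor>2 ^ j * t $ k\<rfloor> + 1"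
    using ceiling_diff_floor_le_1[of "2 ^ j * t $ k"] by linarith
  then show ?thesis by (simp add: dfloor_def dceil_def field_simps)
qed

lemma dfloor_mono_level: "dfloor j t $ k \<le> dfloor (Suc j) t $ k"
proof -
  have "2 * \<lfloor>2 ^ j * t $ k\<rfloor> \<le> \<lfloor>2 * (2 ^ j * t $ k)\<rfloor>" by linarith
  then have "2 * real_of_int \<lfloor>2 ^ j * t $ k\<rfloor> \<le> real_of_int \<lfloor>2 * (2 ^ j * t $ k)\<rfloor>" by linarith
  then show ?thesis by (simp add: dfloor_def field_simps mult.assoc)
qed

text \<open>Two mesh widths admit both kinds of link: from a dyadic floor at the previous level to
  the one at level \<open>j\<close>, and from floor to ceiling at level \<open>j\<close>. Pairs are
  ordered so that increments come from nested boxes.\<close>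

definition grid_steps :: "nat \<Rightarrow> ((real^'d) \<times> (real^'d)) set" where
  "grid_steps j = {(s, t). s \<in> dgrid j \<and> t \<in> dgrid j \<and> (\<forall>k. s $ k \<le> t $ k \<and> t $ k \<le> s $ k + 2 / 2 ^ j)}"

definition max_incr :: "((real^'d) \<times> (real^'d)) set \<Rightarrow> (real^'d \<Rightarrow> real) \<Rightarrow> real" where
  "max_incr Z f = Max ((\<lambda>z. \<bar>f (snd z) - f (fst z)\<bar>) ` Z)"

definition chain_ends :: "nat \<Rightarrow> nat \<Rightarrow> ((real^'d) \<times> (real^'d)) set" where
  "chain_ends m J = (\<lambda>t. (dfloor m t, dfloor J t)) ` cbox 0 1"

text \<open>Stand-in for the sup distance between a path and its discretisation at level
  \<open>m\<close>. Maxima over finitely many grid pairs give a measurable Lipschitz functional;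
  what happens between the points of level \<open>J\<close> is left to
  \<open>Delta_dist_dfloor\<close>.\<close>

definition osc_bound :: "nat \<Rightarrow> nat \<Rightarrow> (real^'d \<Rightarrow> real) \<Rightarrow> real" where
  "osc_bound m J f = max_incr (chain_ends m J) f + max_incr (grid_steps J) f"

lemma grid_steps_subset: "grid_steps j \<subseteq> dgrid j \<times> dgrid j"
  by (auto simp: grid_steps_def)

lemma finite_grid_steps: "finite (grid_steps j)"
  by (rule finite_subset[OF grid_steps_subset]) (simp add: finite_dgrid)

lemma grid_steps_ne: "grid_steps j \<noteq> {}"
proof -
  have "(0 :: real^'d, 0) \<in> grid_steps j" by (auto simp: grid_steps_def mem_dgrid)
  then show ?thesis by blast
qed

lemma chain_ends_subset: "chain_ends m J \<subseteq> dgrid m \<times> dgrid J"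
  by (auto simp: chain_ends_def dfloor_in_grid)

lemma finite_chain_ends: "finite (chain_ends m J)"
  by (rule finite_subset[OF chain_ends_subset]) (simp add: finite_dgrid)

lemma chain_ends_ne: "chain_ends m J \<noteq> ({} :: ((real^'d) \<times> (real^'d)) set)"
proof -
  have "(0::real^'d) \<in> cbox 0 1" by (simp add: mem_box_cart)
  then show ?thesis unfolding chain_ends_def by blast
qed

lemma max_incr_ge: "finite Z \<Longrightarrow> (s, t) \<in> Z \<Longrightarrow> \<bar>f t - f s\<bar> \<le> max_incr Z f"
  unfolding max_incr_def by (intro Max_ge) (auto intro!: image_eqI[of _ _ "(s, t)"])

lemma max_incr_le:
  assumes "finite Z" "Z \<noteq> {}" "\<And>s t. (s, t) \<in> Z \<Longrightarrow> \<bar>f t - f s\<bar> \<le> b"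
  shows "max_incr Z f \<le> b"
  using assms unfolding max_incr_def by (subst Max_le_iff) auto

lemma max_incr_nonneg: "finite Z \<Longrightarrow> Z \<noteq> {} \<Longrightarrow> 0 \<le> max_incr Z f"
  using max_incr_ge[of Z _ _ f] by (metis abs_ge_zero ex_in_conv order_trans surj_pair)

lemma max_incr_lip:
  assumes Z: "finite Z" "Z \<noteq> {}" "Z \<subseteq> cbox 0 1 \<times> cbox 0 1" and fg: "unif_close e f g"
  shows "\<bar>max_incr Z f - max_incr Z g\<bar> \<le> 2 * e"
proof -
  have *: "max_incr Z f \<le> max_incr Z g + 2 * e"
    if fg: "unif_close e f g" for f g
  proof (rule max_incr_le[OF Z(1,2)])
    fix s t assume st: "(s, t) \<in> Z"
    then have "\<bar>f t - g t\<bar> \<le> e" "\<bar>f s - g s\<bar> \<le> e" using fg Z(3) by auto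
    with max_incr_ge[OF Z(1) st, of g] show "\<bar>f t - f s\<bar> \<le> max_incr Z g + 2 * e" by linarith
  qed
  have "unif_close e g f" using fg by (simp add: abs_minus_commute)
  from *[OF fg] *[OF this] show ?thesis by linarith
qed

lemma osc_bound_lip:
  assumes "unif_close e f g"
  shows "\<bar>osc_bound m J f - osc_bound m J g\<bar> \<le> 4 * e"
proof -
  have "chain_ends m J \<subseteq> cbox 0 1 \<times> cbox (0::real^'a) 1" "grid_steps J \<subseteq> cbox 0 1 \<times> cbox (0::real^'a) 1"
    using chain_ends_subset grid_steps_subset dgrid_subset_cube by fastforce+
  from max_incr_lip[OF finite_chain_ends chain_ends_ne this(1) assms]
    max_incr_lip[OF finite_grid_steps grid_steps_ne this(2) assms]
  show ?thesis unfolding osc_bound_def by linarith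
qed

lemma osc_bound_nonneg: "0 \<le> osc_bound m J f"
  unfolding osc_bound_def
  by (intro add_nonneg_nonneg max_incr_nonneg finite_chain_ends chain_ends_ne finite_grid_steps grid_steps_ne)

lemma dfloor_step:
  assumes "t \<in> cbox 0 1"
  shows "(dfloor j t, dfloor (Suc j) t) \<in> grid_steps (Suc j)"
proof -
  have "dfloor (Suc j) t $ k \<le> dfloor j t $ k + 2 / 2 ^ Suc j" for k
    using dfloor_le[of "Suc j" t k] dfloor_ge[of t k j] by simp
  then show ?thesis
    using assms dfloor_in_grid dgrid_Suc[of j]
    by (auto simp: grid_steps_def dfloor_mono_level simp del: power_Suc intro: set_mp)
qed

text \<open>Telescoping along the dyadic floors of one point, each link being a member of
  \<open>grid_steps\<close>.\<close>

lemma chain_increment_le: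
  assumes "m \<le> J"
  shows "max_incr (chain_ends m J) f \<le> (\<Sum>j\<in>{m<..J}. max_incr (grid_steps j) f)"
proof (rule max_incr_le[OF finite_chain_ends chain_ends_ne])
  fix s t' :: "real^'a" assume "(s, t') \<in> chain_ends m J"
  then obtain t where t: "t \<in> cbox 0 1" and st: "s = dfloor m t" "t' = dfloor J t"
    by (auto simp: chain_ends_def)
  show "\<bar>f t' - f s\<bar> \<le> (\<Sum>j\<in>{m<..J}. max_incr (grid_steps j) f)"
    unfolding st using assms
  proof (induction J rule: dec_induct)
    case (step J)
    have "{m<..Suc J} = insert (Suc J) {m<..J}" using step by auto
    then show ?case using step.IH max_incr_ge[OF finite_grid_steps dfloor_step[OF t, of J], of f] by simp
  qed simp
qed

text \<open>A deterministic bound: chain from level \<open>m\<close> to \<open>J\<close>, then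
  sandwich \<open>t\<close> between its floor and ceiling at level \<open>J\<close>. The count
  \<open>C\<close> is monotone, so its increment up to \<open>t\<close> is at most the one up to the
  ceiling. The centring enters with the opposite sign and contributes at most \<open>sqrt ?N\<close>
  times a difference of volumes, which is the last summand.\<close>

lemma Delta_dist_dfloor:
  fixes t u :: "real^'d"
  assumes t: "t \<in> cbox 0 1" and a: "a > 0" and n: "n \<ge> 1"
  shows "\<bar>Delta X n u a t - Delta X n u a (dfloor m t)\<bar>
    \<le> osc_bound m J (Delta X n u a) + sqrt (real n * a ^ CARD('d)) * real CARD('d) / 2 ^ J"
proof -
  let ?N = "real n * a ^ CARD('d)"
  have N: "?N > 0" using n a by simp
  define C where "C s = (\<Sum>i\<in>{1..n}. indicator (cbox u (u + a *\<^sub>R s)) (X i) :: real)" for s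
  define p where "p s = (\<Prod>k\<in>UNIV. s $ k)" for s :: "real^'d"
  have D: "Delta X n u a s = (C s - ?N * p s) / sqrt ?N" if "s \<in> cbox 0 1" for s
    by (simp add: Delta_alt[OF that a] C_def p_def sum_subtractf)
  have D': "Delta X n u a s' - Delta X n u a s = (C s' - C s) / sqrt ?N - sqrt ?N * (p s' - p s)"
    if "s \<in> cbox 0 1" "s' \<in> cbox 0 1" for s s'
  proof -
    have "?N / sqrt ?N = sqrt ?N" using N by (simp add: real_div_sqrt)
    then show ?thesis unfolding D[OF that(1)] D[OF that(2)]
      by (simp add: diff_divide_distrib right_diff_distrib) (metis (no_types, opaque_lifting) times_divide_eq_left mult.commute)
  qed
  have mono: "C s \<le> C s'" if "\<And>k. s $ k \<le> s' $ k" for s s'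
  proof -
    have "a * s $ k \<le> a * s' $ k" for k using that a by (intro mult_left_mono) auto
    then have "cbox u (u + a *\<^sub>R s) \<subseteq> cbox u (u + a *\<^sub>R s')"
      unfolding subset_iff mem_corner_box by (meson add_left_mono order_trans)
    then show ?thesis unfolding C_def by (intro sum_mono) (auto simp: indicator_def)
  qed
  let ?l = "dfloor J t" and ?r = "dceil J t"
  have lr: "?l \<in> cbox 0 1" "?r \<in> cbox 0 1"
    using dfloor_in_grid[OF t, of J] dceil_in_grid[OF t, of J] dgrid_subset_cube by blast+
  have step: "(?l, ?r) \<in> grid_steps J"
  proof -
    have "dceil J t $ k \<le> dfloor J t $ k + 2 / 2 ^ J" for k
    proof -
      have "1 / 2 ^ J \<le> (2 / 2 ^ J :: real)" by (intro divide_right_mono) auto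
      then show ?thesis using dceil_le_floor[of J t k] by linarith
    qed
    then show ?thesis
      using dfloor_in_grid[OF t, of J] dceil_in_grid[OF t, of J]
        dfloor_le[of J t] dceil_ge[of t _ J]
      by (auto simp: grid_steps_def intro: order_trans)
  qed
  have pd: "p ?r - p ?l \<le> real CARD('d) / 2 ^ J"
  proof -
    have "p ?r - p ?l \<le> (\<Sum>k\<in>UNIV. ?r $ k - ?l $ k)"
      unfolding p_def using lr dfloor_le[of J t] dceil_ge[of t _ J]
      by (intro prod_diff_le_sum) (auto intro: order_trans)
    also have "\<dots> \<le> (\<Sum>k\<in>(UNIV::'d set). 1 / 2 ^ J)"
      using dceil_le_floor[of J t] by (intro sum_mono) (simp add: algebra_simps)
    finally show ?thesis by simp
  qed
  have p_mono: "p ?l \<le> p t" "p t \<le> p ?r"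
    unfolding p_def using lr t dfloor_le[of J t] dceil_ge[of t _ J]
    by (auto intro!: prod_mono simp: mem_box_cart)
  let ?err = "sqrt ?N * (p ?r - p ?l)"
  have "\<bar>Delta X n u a t - Delta X n u a ?l\<bar> \<le> max_incr (grid_steps J) (Delta X n u a) + ?err"
  proof -
    have "(C t - C ?l) / sqrt ?N \<le> (C ?r - C ?l) / sqrt ?N" "0 \<le> (C t - C ?l) / sqrt ?N"
      using N mono[of ?l t] mono[of t ?r] dfloor_le[of J t] dceil_ge[of t _ J]
      by (auto intro!: divide_right_mono)
    moreover have "0 \<le> sqrt ?N * (p t - p ?l)" "sqrt ?N * (p t - p ?l) \<le> ?err"
      using N p_mono by (auto intro!: mult_left_mono)
    ultimately show ?thesis
      using D'[OF lr(1) t] D'[OF lr] max_incr_ge[OF finite_grid_steps step, of "Delta X n u a"]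
        max_incr_nonneg[OF finite_grid_steps grid_steps_ne, of J "Delta X n u a"] by linarith
  qed
  moreover have "\<bar>Delta X n u a ?l - Delta X n u a (dfloor m t)\<bar> \<le> max_incr (chain_ends m J) (Delta X n u a)"
    using t by (intro max_incr_ge finite_chain_ends) (auto simp: chain_ends_def)
  moreover have "?err \<le> sqrt ?N * real CARD('d) / 2 ^ J"
    using mult_left_mono[OF pd, of "sqrt ?N"] N by simp
  ultimately show ?thesis unfolding osc_bound_def by linarith
qed

text \<open>Value of the maximal inequality at level \<open>j\<close> with parameter
  \<open>sqrt (2 ^ j)\<close>: the first two summands bound \<open>ln (2 * card)\<close> for at most
  \<open>2 ^ ((j + 1) * 2 * d)\<close> pairs, and \<open>exp (2 * d)\<close> bounds the moments,
  since a step has l1 length at most \<open>2 * d / 2 ^ j\<close>.\<close>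

definition chain_rate :: "real \<Rightarrow> nat \<Rightarrow> real" where
  "chain_rate d j = (1 + 2 * d * (real j + 1) + exp (2 * d)) / sqrt (2 ^ j)"

lemma chain_rate_nonneg: "d \<ge> 0 \<Longrightarrow> 0 \<le> chain_rate d j"
  by (simp add: chain_rate_def)

lemma summable_chain_rate: "summable (chain_rate d)"
proof -
  let ?z = "1 / sqrt 2 :: real"
  have z: "norm ?z < 1" by simp
  have eq: "chain_rate d j = (1 + exp (2 * d)) * ?z ^ j + 2 * d * (real (Suc j) * ?z ^ j)" for j
    by (simp add: chain_rate_def real_sqrt_power power_divide add_divide_distrib algebra_simps)
  have "summable (\<lambda>j. (1 + exp (2 * d)) * ?z ^ j + 2 * d * (real (Suc j) * ?z ^ j))"
    using geometric_deriv_sums[OF z] summable_geometric[OF z]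
    by (intro summable_add summable_mult) (auto simp: sums_iff)
  then show ?thesis unfolding eq[abs_def] .
qed

context uniform_sample
begin

text \<open>Crude and not uniform in \<open>n\<close>; it feeds integrability.\<close>

lemma Delta_bounded:
  fixes t u :: "real^'d"
  assumes t: "t \<in> cbox 0 1" and a: "a > 0" and n: "n \<ge> 1"
  shows "\<bar>Delta X n u a t\<bar> \<le> real n * (1 + a ^ CARD('d)) / sqrt (real n * a ^ CARD('d))"
proof -
  have "\<bar>indicator (cbox u (u + a *\<^sub>R t)) (X i) - a ^ CARD('d) * (\<Prod>k\<in>UNIV. t $ k)\<bar> \<le> 1 + a ^ CARD('d)" for i
  proof -
    have "a ^ CARD('d) * (\<Prod>k\<in>UNIV. t $ k) \<le> a ^ CARD('d) * 1"
      using prod_unit_bounds[OF t] a by (intro mult_left_mono) auto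
    moreover have "0 \<le> a ^ CARD('d) * (\<Prod>k\<in>UNIV. t $ k)" using prod_unit_bounds[OF t] a by simp
    ultimately show ?thesis by (auto simp: indicator_def)
  qed
  then have "\<bar>\<Sum>i\<in>{1..n}. indicator (cbox u (u + a *\<^sub>R t)) (X i) - a ^ CARD('d) * (\<Prod>k\<in>UNIV. t $ k)\<bar>
      \<le> (\<Sum>i\<in>{1..n}. 1 + a ^ CARD('d))"
    by (intro order_trans[OF sum_abs] sum_mono)
  then show ?thesis
    unfolding Delta_alt[OF t a] abs_divide using a n by (intro divide_mono) auto
qed

text \<open>The hypothesis on \<open>j\<close> is precisely what allows the parameter
  \<open>sqrt (2 ^ j)\<close> in \<open>mgf_Delta_increment\<close>, at which the moments of all
  steps are bounded independently of \<open>j\<close>. It forces the chain to end at a level with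
  \<open>2 ^ J \<le> real n * a ^ CARD('d)\<close>.\<close>

lemma expectation_grid_steps_le:
  assumes u: "u \<in> shrunk_cube \<delta>" and a: "0 < a" "a \<le> \<delta>" and n: "n \<ge> 1"
    and j: "2 ^ j \<le> real n * a ^ CARD('d)"
  shows "expectation (\<lambda>w. max_incr (grid_steps j) (Delta (sample w) n u a)) \<le> chain_rate (real CARD('d)) j"
    and "integrable M (\<lambda>w. max_incr (grid_steps j) (Delta (sample w) n u a))"
proof -
  let ?N = "real n * a ^ CARD('d)" and ?d = "real CARD('d)"
  let ?Z = "grid_steps j :: ((real^'d) \<times> (real^'d)) set"
  define s where "s = sqrt (2 ^ j :: real)"
  have s: "s > 0" "\<bar>s\<bar> \<le> sqrt ?N" "s\<^sup>2 = 2 ^ j" using j by (auto simp: s_def)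
  let ?Y = "\<lambda>z w. Delta (sample w) n u a (snd z) - Delta (sample w) n u a (fst z)"
  define C where "C = real n * (1 + a ^ CARD('d)) / sqrt ?N"
  have Z: "fst z \<in> cbox 0 1" "snd z \<in> cbox 0 1" "\<And>k. fst z $ k \<le> snd z $ k" "\<And>k. snd z $ k \<le> fst z $ k + 2 / 2 ^ j"
    if "z \<in> ?Z" for z
    using that dgrid_subset_cube[of j] by (auto simp: grid_steps_def)
  have m: "?Y z \<in> borel_measurable M" for z by measurable
  have b: "\<bar>?Y z w\<bar> \<le> 2 * C" if "z \<in> ?Z" for z w
    using Delta_bounded[OF Z(1)[OF that] a(1) n, of "sample w" u] Delta_bounded[OF Z(2)[OF that] a(1) n, of "sample w" u]
    unfolding C_def by linarith
  have g: "expectation (\<lambda>w. exp (r * ?Y z w)) \<le> exp (2 * ?d)" if z: "z \<in> ?Z" and r: "\<bar>r\<bar> \<le> sqrt ?N" "r\<^sup>2 = 2 ^ j" for z r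
  proof -
    have "(\<Sum>k\<in>UNIV. snd z $ k - fst z $ k) \<le> (\<Sum>k\<in>(UNIV::'d set). 2 / 2 ^ j)"
      using Z(4)[OF z] by (intro sum_mono) (simp add: algebra_simps)
    then have "expectation (\<lambda>w. exp (r * ?Y z w)) \<le> exp (r\<^sup>2 * (?d * (2 / 2 ^ j)))"
      by (intro mgf_Delta_increment[OF u Z(1-3)[OF z] a n r(1)]) auto
    also have "r\<^sup>2 * (?d * (2 / 2 ^ j)) = 2 * ?d" by (simp add: r(2))
    finally show ?thesis .
  qed
  have E: "expectation (\<lambda>w. Max ((\<lambda>z. \<bar>?Y z w\<bar>) ` ?Z)) \<le> (ln (2 * real (card ?Z)) + exp (2 * ?d)) / s"
    and I: "integrable M (\<lambda>w. Max ((\<lambda>z. \<bar>?Y z w\<bar>) ` ?Z))"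
    using g[of _ s] g[of _ "- s"] s
    by (intro expectation_Max_abs_le[OF finite_grid_steps grid_steps_ne s(1) m b]; simp)+
  show "integrable M (\<lambda>w. max_incr ?Z (Delta (sample w) n u a))"
    using I by (simp add: max_incr_def)
  have "ln (2 * real (card ?Z)) \<le> 1 + 2 * ?d * (real j + 1)"
  proof -
    have "card ?Z \<le> card (dgrid j \<times> dgrid j :: ((real^'d) \<times> (real^'d)) set)"
      by (intro card_mono grid_steps_subset) (simp add: finite_dgrid)
    also have "\<dots> \<le> (2 ^ j + 1) ^ CARD('d) * (2 ^ j + 1) ^ CARD('d)"
      unfolding card_cartesian_product by (intro mult_le_mono card_dgrid_le)
    also have "\<dots> = (2 ^ j + 1) ^ (2 * CARD('d))" by (simp add: power_add[symmetric] mult_2)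
    also have "\<dots> \<le> (2 ^ Suc j) ^ (2 * CARD('d))" by (intro power_mono) auto
    also have "\<dots> = 2 ^ (Suc j * (2 * CARD('d)))" by (simp only: power_mult)
    finally have "real (card ?Z) \<le> 2 ^ (Suc j * (2 * CARD('d)))"
      by (metis of_nat_le_iff of_nat_numeral of_nat_power)
    moreover have c: "card ?Z > 0" by (simp add: card_gt_0_iff finite_grid_steps grid_steps_ne)
    ultimately have "ln (2 * real (card ?Z)) \<le> ln (2 * 2 ^ (Suc j * (2 * CARD('d))))"
      by (subst ln_le_cancel_iff) auto
    also have "\<dots> = ln 2 * (1 + real (Suc j * (2 * CARD('d))))"
      by (simp add: ln_mult ln_realpow algebra_simps)
    also have "\<dots> \<le> 1 * (1 + real (Suc j * (2 * CARD('d))))"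
      using ln_2_less_1 by (intro mult_right_mono) auto
    finally show ?thesis by (simp add: algebra_simps)
  qed
  then have "(ln (2 * real (card ?Z)) + exp (2 * ?d)) / s \<le> chain_rate ?d j"
    unfolding chain_rate_def s_def by (intro divide_right_mono) auto
  with E show "expectation (\<lambda>w. max_incr ?Z (Delta (sample w) n u a)) \<le> chain_rate ?d j"
    by (simp add: max_incr_def)
qed

lemma expectation_osc_bound_le:
  assumes u: "u \<in> shrunk_cube \<delta>" and a: "0 < a" "a \<le> \<delta>" and n: "n \<ge> 1"
    and J: "2 ^ J \<le> real n * a ^ CARD('d)" and mJ: "m \<le> J"
  shows "expectation (\<lambda>w. min 1 (osc_bound m J (Delta (sample w) n u a)))
    \<le> (\<Sum>i. chain_rate (real CARD('d)) (i + Suc m)) + chain_rate (real CARD('d)) J"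
proof -
  let ?D = "\<lambda>w. Delta (sample w) n u a" and ?d = "real CARD('d)"
  have jJ: "2 ^ j \<le> real n * a ^ CARD('d)" if "j \<le> J" for j
    using power_increasing[OF that, of "2::real"] J by linarith
  note G = expectation_grid_steps_le[OF u a n]
  \<comment> \<open>Level \<open>J\<close> is paid for twice, as the last link of the chain and as
    the step from floor to ceiling.\<close>
  have "expectation (\<lambda>w. min 1 (osc_bound m J (?D w)))
    \<le> expectation (\<lambda>w. (\<Sum>j\<in>{m<..J}. max_incr (grid_steps j) (?D w)) + max_incr (grid_steps J) (?D w))"
  proof (rule integral_mono')
    show "integrable M (\<lambda>w. (\<Sum>j\<in>{m<..J}. max_incr (grid_steps j) (?D w)) + max_incr (grid_steps J) (?D w))"
      using G(2) jJ by (intro Bochner_Integration.integrable_add Bochner_Integration.integrable_sum) auto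
    show "min 1 (osc_bound m J (?D w)) \<le> (\<Sum>j\<in>{m<..J}. max_incr (grid_steps j) (?D w)) + max_incr (grid_steps J) (?D w)" for w
      using chain_increment_le[OF mJ, of "?D w"] unfolding osc_bound_def by linarith
    show "0 \<le> (\<Sum>j\<in>{m<..J}. max_incr (grid_steps j) (?D w)) + max_incr (grid_steps J) (?D w)" for w
      by (intro add_nonneg_nonneg sum_nonneg max_incr_nonneg finite_grid_steps grid_steps_ne)
  qed
  also have "\<dots> = (\<Sum>j\<in>{m<..J}. expectation (\<lambda>w. max_incr (grid_steps j) (?D w))) + expectation (\<lambda>w. max_incr (grid_steps J) (?D w))"
    using G(2) jJ by (subst Bochner_Integration.integral_add) (auto intro!: Bochner_Integration.integrable_sum Bochner_Integration.integral_sum)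
  also have "\<dots> \<le> (\<Sum>j\<in>{m<..J}. chain_rate ?d j) + chain_rate ?d J"
    using G(1) jJ by (intro add_mono sum_mono) auto
  also have "(\<Sum>j\<in>{m<..J}. chain_rate ?d j) = (\<Sum>i<J - m. chain_rate ?d (i + Suc m))"
    using mJ by (intro sum.reindex_bij_witness[of _ "\<lambda>i. i + Suc m" "\<lambda>j. j - Suc m"]) auto
  also have "\<dots> \<le> (\<Sum>i. chain_rate ?d (i + Suc m))"
  proof (rule sum_le_suminf)
    show "summable (\<lambda>i. chain_rate ?d (i + Suc m))"
      using summable_chain_rate[of ?d] by (subst summable_iff_shift)
  qed (auto intro: chain_rate_nonneg)
  finally show ?thesis by simp
qed

end

section \<open>Characteristic functions and weak convergence\<close>

text \<open>Comparison with the constant sequence \<open>y\<close>: two numbers of modulus at most 1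
  have n-th powers differing by at most \<open>n\<close> times their distance. The one-sided
  conditions keep both bases in [0, 1] as soon as \<open>n \<ge> - y\<close>.\<close>

lemma tendsto_power_exp:
  fixes x :: "nat \<Rightarrow> real"
  assumes x: "x \<longlonglongrightarrow> y" and neg: "\<And>n. n \<ge> 1 \<Longrightarrow> x n \<le> 0" "\<And>n. n \<ge> 1 \<Longrightarrow> y \<le> x n"
  shows "(\<lambda>n. (1 + x n / real n) ^ n) \<longlonglongrightarrow> exp y"
proof -
  have "(\<lambda>n. (1 + x n / real n) ^ n - (1 + y / real n) ^ n) \<longlonglongrightarrow> 0"
  proof (rule Lim_null_comparison)
    have "\<forall>\<^sub>F n in sequentially. - y \<le> real n" using eventually_ge_at_top[of "nat \<lceil>- y\<rceil>"]
      by eventually_elim linarith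
    with eventually_ge_at_top[of 1]
    show "\<forall>\<^sub>F n in sequentially. norm ((1 + x n / real n) ^ n - (1 + y / real n) ^ n) \<le> \<bar>x n - y\<bar>"
    proof eventually_elim
      case (elim n)
      have b: "norm (1 + z / real n) \<le> 1" if "y \<le> z" "z \<le> 0" for z
      proof -
        have "- real n \<le> z" using elim that by linarith
        then have "-1 \<le> z / real n" "z / real n \<le> 0" using elim that by (auto simp: field_simps)
        then show ?thesis by simp
      qed
      have "norm ((1 + x n / real n) ^ n - (1 + y / real n) ^ n) \<le> n * norm ((1 + x n / real n) - (1 + y / real n))"
        using neg[OF elim(1)] by (intro norm_power_diff b) auto
      also have "(1 + x n / real n) - (1 + y / real n) = (x n - y) / real n" by (simp add: diff_divide_distrib)
      also have "n * norm \<dots> = \<bar>x n - y\<bar>" using elim by simp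
      finally show ?case .
    qed
    show "(\<lambda>n. \<bar>x n - y\<bar>) \<longlonglongrightarrow> 0" using x by (simp add: LIM_zero tendsto_rabs_zero)
  qed
  from tendsto_add[OF this tendsto_exp_limit_sequentially[of y]] show ?thesis by simp
qed

abbreviation sheet_var :: "(real^'d) set \<Rightarrow> (real^'d \<Rightarrow> real) \<Rightarrow> real" where
  "sheet_var T c \<equiv> \<Sum>s\<in>T. \<Sum>t\<in>T. c s * c t * sheet_cov s t"

lemma corner_box_Int:
  fixes s t u :: "real^'d"
  assumes "a \<ge> 0"
  shows "cbox u (u + a *\<^sub>R s) \<inter> cbox u (u + a *\<^sub>R t) = cbox u (u + a *\<^sub>R (\<chi> k. min (s $ k) (t $ k)))"
proof -
  have "a * min x y = min (a * x) (a * y)" for x y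
    using assms by (simp add: min_mult_distrib_left)
  then have "z \<le> b + a * min x y \<longleftrightarrow> z \<le> b + a * x \<and> z \<le> b + a * y" for x y z b :: real
    by (auto simp: min_def)
  then show ?thesis by (auto simp: set_eq_iff mem_corner_box)
qed

lemma sheet_cov_eq_measure:
  fixes s t :: "real^'d"
  assumes "s \<in> cbox 0 1" "t \<in> cbox 0 1"
  shows "sheet_cov s t = measure lborel (cbox 0 s \<inter> cbox 0 t)"
  using corner_box_Int[of 1 0 s t] measure_corner_box[of 1 "\<chi> k. min (s $ k) (t $ k)" 0] assms
  by (simp add: sheet_cov_def mem_box_cart)

text \<open>\<open>sheet_cov\<close> is a Gram matrix, with entries the L2 inner products of the
  indicators of \<open>cbox 0 s\<close> and \<open>cbox 0 t\<close>, so the form is the integral of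
  a square.\<close>

lemma sheet_cov_psd:
  fixes T :: "(real^'d) set"
  assumes T: "finite T" "T \<subseteq> cbox 0 1"
  shows "0 \<le> (sheet_var T c)"
proof -
  have i: "integrable lborel (\<lambda>x. c s * c t * indicator (cbox 0 s \<inter> cbox 0 t) x :: real)" for s t :: "real^'d"
  proof (intro integrable_mult_right integrable_real_indicator)
    have "emeasure lborel (cbox 0 s \<inter> cbox 0 t) \<le> emeasure lborel (cbox 0 s)" by (intro emeasure_mono) auto
    also have "\<dots> < \<infinity>" by (simp add: emeasure_lborel_cbox_eq)
    finally show "emeasure lborel (cbox 0 s \<inter> cbox 0 t) < \<infinity>" .
  qed auto
  have "0 \<le> (\<integral>x. (\<Sum>t\<in>T. c t * indicator (cbox 0 t) x)\<^sup>2 \<partial>lborel)" by simp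
  also have "(\<lambda>x. (\<Sum>t\<in>T. c t * indicator (cbox 0 t) x)\<^sup>2) =
      (\<lambda>x. \<Sum>s\<in>T. \<Sum>t\<in>T. c s * c t * indicator (cbox 0 s \<inter> cbox 0 t) x)"
    by (simp add: fun_eq_iff power2_eq_square sum_product indicator_inter_arith mult_ac)
  also have "(\<integral>x. (\<Sum>s\<in>T. \<Sum>t\<in>T. c s * c t * indicator (cbox 0 s \<inter> cbox 0 t) x) \<partial>lborel)
     = (\<Sum>s\<in>T. \<Sum>t\<in>T. \<integral>x. c s * c t * indicator (cbox 0 s \<inter> cbox 0 t) x \<partial>lborel)"
    by (simp only: Bochner_Integration.integral_sum Bochner_Integration.integrable_sum i)
  also have "\<dots> = (sheet_var T c)"
    using T by (intro sum.cong refl) (auto simp: sheet_cov_eq_measure subset_iff)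
  finally show ?thesis .
qed

context uniform_sample
begin

text \<open>Lindeberg's argument for a sum of \<open>n\<close> independent copies of
  \<open>h\<close>, centred, of variance \<open>V / n\<close> and bounded by
  \<open>C / sqrt N\<close>: each factor of the characteristic function differs from
  \<open>1 - V / (2 * n)\<close> by at most a sixth of the third absolute moment. The correction
  \<open>a ^ CARD('d) * q0\<^sup>2\<close> stems from the squared mean; \<open>V \<le> 4 * n\<close>
  keeps the comparison factors of modulus at most 1. The bound does not involve \<open>u\<close>,
  hence the uniformity of the limit below.\<close>

lemma char_Delta_step:
  fixes T :: "(real^'d) set" and c :: "real^'d \<Rightarrow> real"
  assumes T: "finite T" "T \<subseteq> cbox 0 1" and u: "u \<in> shrunk_cube \<delta>" and a: "0 < a" "a \<le> \<delta>" and n: "n \<ge> 1"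
  defines "N \<equiv> real n * a ^ CARD('d)"
    and "v \<equiv> sheet_var T c"
    and "q0 \<equiv> \<Sum>t\<in>T. c t * (\<Prod>k\<in>UNIV. t $ k)"
  defines "V \<equiv> v - a ^ CARD('d) * q0\<^sup>2"
  assumes a1: "a \<le> 1" and nV: "V \<le> 4 * real n"
  shows "0 \<le> V"
    and "cmod (expectation (\<lambda>w. iexp (\<Sum>t\<in>T. c t * Delta (sample w) n u a t)) - (1 - V / (2 * real n)) ^ n)
     \<le> (\<Sum>t\<in>T. \<bar>c t\<bar>) / sqrt N * V / 6"
proof -
  have N: "N > 0" using n a by (simp add: N_def)
  define q where "q t = a ^ CARD('d) * (\<Prod>k\<in>UNIV. t $ k)" for t :: "real^'d"
  let ?B = "\<lambda>t. cbox u (u + a *\<^sub>R t)"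
  define h where "h x = (\<Sum>t\<in>T. c t * (indicator (?B t) x - q t)) / sqrt N" for x :: "real^'d"
  have hm[measurable]: "h \<in> borel_measurable borel" unfolding h_def by measurable
  define C where "C = (\<Sum>t\<in>T. \<bar>c t\<bar>)"
  have q01: "0 \<le> q t" "q t \<le> 1" if "t \<in> T" for t
  proof -
    have t: "t \<in> cbox 0 1" using that T by auto
    show "0 \<le> q t" using prod_unit_bounds[OF t] a by (simp add: q_def)
    have "a ^ CARD('d) * (\<Prod>k\<in>UNIV. t $ k) \<le> 1 * 1"
      using prod_unit_bounds[OF t] a a1 by (intro mult_mono power_le_one) auto
    then show "q t \<le> 1" by (simp add: q_def)
  qed
  have hb: "\<bar>h x\<bar> \<le> C / sqrt N" for x
  proof -
    have "\<bar>\<Sum>t\<in>T. c t * (indicator (?B t) x - q t)\<bar> \<le> (\<Sum>t\<in>T. \<bar>c t * (indicator (?B t) x - q t)\<bar>)" by (rule sum_abs)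
    also have "\<dots> \<le> C" unfolding C_def
    proof (rule sum_mono)
      fix t assume "t \<in> T"
      then have "\<bar>indicator (?B t) x - q t\<bar> \<le> 1" using q01[of t] by (auto simp: indicator_def)
      then show "\<bar>c t * (indicator (?B t) x - q t)\<bar> \<le> \<bar>c t\<bar>" by (simp add: abs_mult mult_left_le)
    qed
    finally show ?thesis unfolding h_def abs_divide using N by (simp add: divide_right_mono)
  qed
  have split: "(\<Sum>t\<in>T. c t * Delta (sample w) n u a t) = (\<Sum>i\<in>{1..n}. h (U i w))" for w
  proof -
    have "(\<Sum>t\<in>T. c t * Delta (sample w) n u a t) = (\<Sum>t\<in>T. \<Sum>i\<in>{1..n}. c t * (indicator (?B t) (U i w) - q t) / sqrt N)"
      using T a by (intro sum.cong refl) (subst Delta_alt, auto simp: q_def N_def sum_distrib_left sum_divide_distrib)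
    also have "\<dots> = (\<Sum>i\<in>{1..n}. h (U i w))"
      unfolding h_def sum_divide_distrib by (rule sum.swap)
    finally show ?thesis .
  qed
  have U[measurable]: "i \<in> {1..n} \<Longrightarrow> U i \<in> borel_measurable M" for i by simp
  have bint: "integrable M f" if "f \<in> borel_measurable M" "\<And>w. \<bar>f w\<bar> \<le> K" for f :: "'a \<Rightarrow> real" and K
    using that by (intro integrable_const_bound[where B = K]) auto
  have sub: "?B t \<subseteq> cbox 0 1" if "t \<in> T" for t
    using that T by (intro corner_box_subset_unit_cube[OF u _ a]) auto
  have Eh: "expectation (\<lambda>w. h (U i w)) = 0" if i: "i \<in> {1..n}" for i
  proof -
    have "expectation (\<lambda>w. indicator (?B t) (U i w) - q t) = 0" if t: "t \<in> T" for t
    proof -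
      have "integrable M (\<lambda>w. indicator (?B t) (U i w) :: real)" using i by (intro bint[of _ 1]) auto
      then have "expectation (\<lambda>w. indicator (?B t) (U i w) - q t) = measure lborel (?B t) - q t"
        using prob_U[OF _ sub[OF t], of i] i by (simp add: prob_space)
      also have "\<dots> = 0" using measure_corner_box[of a t u] a t T by (auto simp: q_def mem_box_cart)
      finally show ?thesis .
    qed
    moreover have "integrable M (\<lambda>w. c t * (indicator (?B t) (U i w) - q t))" for t
      using i by (intro integrable_mult_right bint[of _ "1 + \<bar>q t\<bar>"]) (auto simp: indicator_def)
    ultimately show ?thesis unfolding h_def by (simp add: Bochner_Integration.integral_sum)
  qed
  have Eh2: "expectation (\<lambda>w. (h (U i w))\<^sup>2) = V / real n" if i: "i \<in> {1..n}" for i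
  proof -
    have st: "expectation (\<lambda>w. (indicator (?B s) (U i w) - q s) * (indicator (?B t) (U i w) - q t)) = a ^ CARD('d) * sheet_cov s t - q s * q t"
      if s: "s \<in> T" and t: "t \<in> T" for s t
    proof -
      have iB: "integrable M (\<lambda>w. indicator B (U i w) :: real)" if "B \<in> sets borel" for B using i that by (intro bint[of _ 1]) auto
      have pB: "expectation (\<lambda>w. indicator (?B t) (U i w)) = q t" if t: "t \<in> T" for t
        using prob_U[OF _ sub[OF t], of i] i measure_corner_box[of a t u] a t T by (auto simp: q_def mem_box_cart)
      have "(indicator (?B s) x - q s) * (indicator (?B t) x - q t)
         = indicator (?B s \<inter> ?B t) x - q s * indicator (?B t) x - q t * indicator (?B s) x + q s * q t" for x
        by (simp add: indicator_inter_arith algebra_simps)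
      then have "expectation (\<lambda>w. (indicator (?B s) (U i w) - q s) * (indicator (?B t) (U i w) - q t))
         = expectation (\<lambda>w. indicator (?B s \<inter> ?B t) (U i w)) - q s * q t - q t * q s + q s * q t"
        using iB[of "?B s \<inter> ?B t"] iB[of "?B s"] iB[of "?B t"] pB[OF s] pB[OF t] by (simp add: prob_space)
      also have "expectation (\<lambda>w. indicator (?B s \<inter> ?B t) (U i w)) = measure lborel (?B s \<inter> ?B t)"
        using sub[OF s] i by (intro prob_U) auto
      also have "?B s \<inter> ?B t = ?B (\<chi> k. min (s $ k) (t $ k))" using a by (intro corner_box_Int) simp
      also have "measure lborel \<dots> = a ^ CARD('d) * sheet_cov s t"
        using a s t T by (subst measure_corner_box) (auto simp: sheet_cov_def mem_box_cart)
      finally show ?thesis by simp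
    qed
    have sq: "(h x)\<^sup>2 = (\<Sum>s\<in>T. \<Sum>t\<in>T. c s * c t * ((indicator (?B s) x - q s) * (indicator (?B t) x - q t))) / N" for x
      using N by (simp add: h_def power_divide power2_eq_square sum_product mult_ac)
    have iST: "integrable M (\<lambda>w. c s * c t * ((indicator (?B s) (U i w) - q s) * (indicator (?B t) (U i w) - q t)))" for s t
      using i by (intro integrable_mult_right bint[of _ "(1 + \<bar>q s\<bar>) * (1 + \<bar>q t\<bar>)"])
        (auto simp: abs_mult indicator_def intro!: mult_mono)
    have "expectation (\<lambda>w. (h (U i w))\<^sup>2) = (\<Sum>s\<in>T. \<Sum>t\<in>T. c s * c t * (a ^ CARD('d) * sheet_cov s t - q s * q t)) / N"
      unfolding sq using iST st by (simp add: Bochner_Integration.integral_sum Bochner_Integration.integrable_sum)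
    also have "(\<Sum>s\<in>T. \<Sum>t\<in>T. c s * c t * (a ^ CARD('d) * sheet_cov s t - q s * q t)) = a ^ CARD('d) * v - (\<Sum>s\<in>T. c s * q s) * (\<Sum>t\<in>T. c t * q t)"
    proof -
      have "(\<Sum>s\<in>T. \<Sum>t\<in>T. c s * c t * (a ^ CARD('d) * sheet_cov s t - q s * q t))
         = (\<Sum>s\<in>T. \<Sum>t\<in>T. a ^ CARD('d) * (c s * c t * sheet_cov s t) - (c s * q s) * (c t * q t))"
        by (intro sum.cong refl) (simp add: algebra_simps)
      also have "\<dots> = (\<Sum>s\<in>T. \<Sum>t\<in>T. a ^ CARD('d) * (c s * c t * sheet_cov s t)) - (\<Sum>s\<in>T. \<Sum>t\<in>T. (c s * q s) * (c t * q t))"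
        by (simp only: sum_subtractf)
      finally show ?thesis by (simp only: sum_product[symmetric]) (simp only: v_def sum_distrib_left)
    qed
    also have "(\<Sum>s\<in>T. c s * q s) = a ^ CARD('d) * q0"
      by (simp add: q_def q0_def sum_distrib_left mult_ac)
    also have "(a ^ CARD('d) * v - a ^ CARD('d) * q0 * (a ^ CARD('d) * q0)) / N = V / real n"
      using a n by (simp add: N_def V_def field_simps power2_eq_square)
    finally show ?thesis .
  qed
  show V: "0 \<le> V"
  proof -
    have "V / real n = expectation (\<lambda>w. (h (U 1 w))\<^sup>2)" using n by (intro Eh2[symmetric]) auto
    moreover have "0 \<le> expectation (\<lambda>w. (h (U 1 w))\<^sup>2)" by simp
    ultimately have "0 \<le> V / real n" by (simp only:)
    then show ?thesis using n by (simp add: zero_le_divide_iff)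
  qed
  have step: "cmod (expectation (\<lambda>w. iexp (h (U i w))) - (1 - V / (2 * real n))) \<le> C / sqrt N * V / (6 * real n)"
    if i: "i \<in> {1..n}" for i
  proof -
    have [measurable]: "U i \<in> borel_measurable M" using i by simp
    have ih2: "integrable M (\<lambda>w. (h (U i w))\<^sup>2)"
    proof (rule bint[of _ "(C / sqrt N)\<^sup>2"])
      fix w
      have "\<bar>h (U i w)\<bar>\<^sup>2 \<le> (C / sqrt N)\<^sup>2" by (intro power_mono hb) auto
      then show "\<bar>(h (U i w))\<^sup>2\<bar> \<le> (C / sqrt N)\<^sup>2" by simp
    qed measurable
    have ih: "integrable M (\<lambda>w. h (U i w))" using hb by (intro bint) auto
    have "cmod (char (distr M borel (\<lambda>w. h (U i w))) 1 - (1 - 1^2 * (V / real n) / 2))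
       \<le> (1^2 / 6) * expectation (\<lambda>w. min (6 * (h (U i w))\<^sup>2) (\<bar>1\<bar> * \<bar>h (U i w)\<bar> ^ 3))"
      using ih ih2 Eh[OF i] Eh2[OF i] by (intro char_approx3') auto
    also have "char (distr M borel (\<lambda>w. h (U i w))) 1 = expectation (\<lambda>w. iexp (h (U i w)))"
      by (simp add: char_def integral_distr)
    also have "expectation (\<lambda>w. min (6 * (h (U i w))\<^sup>2) (\<bar>1\<bar> * \<bar>h (U i w)\<bar> ^ 3)) \<le> expectation (\<lambda>w. C / sqrt N * (h (U i w))\<^sup>2)"
    proof (rule integral_mono')
      fix w
      have "\<bar>h (U i w)\<bar> * (h (U i w))\<^sup>2 \<le> C / sqrt N * (h (U i w))\<^sup>2" by (intro mult_right_mono hb) auto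
      then show "min (6 * (h (U i w))\<^sup>2) (\<bar>1\<bar> * \<bar>h (U i w)\<bar> ^ 3) \<le> C / sqrt N * (h (U i w))\<^sup>2"
        by (simp add: power3_eq_cube power2_eq_square abs_mult[symmetric])
      show "0 \<le> C / sqrt N * (h (U i w))\<^sup>2" using N by (auto simp: C_def intro!: sum_nonneg)
    qed (use ih2 in auto)
    also have "\<dots> = C / sqrt N * (V / real n)" using Eh2[OF i] by simp
    finally show ?thesis by (simp add: mult_ac)
  qed
  have iint: "integrable M (\<lambda>w. iexp (h (U i w)))" if i: "i \<in> {1..n}" for i
  proof -
    have [measurable]: "U i \<in> borel_measurable M" using i by simp
    show ?thesis by (intro integrable_const_bound[where B = 1]) auto
  qed
  have "indep_vars (\<lambda>_. borel) (\<lambda>i w. iexp (h (U i w))) {1..n}"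
  proof -
    have "indep_vars (\<lambda>_. borel) U {1..n}" by (rule indep_vars_subset[OF indep]) auto
    from indep_vars_compose2[OF this, of "\<lambda>_ x. iexp (h x)" "\<lambda>_. borel"] show ?thesis by simp
  qed
  then have "expectation (\<lambda>w. \<Prod>i\<in>{1..n}. iexp (h (U i w))) = (\<Prod>i\<in>{1..n}. expectation (\<lambda>w. iexp (h (U i w))))"
    using iint by (intro indep_vars_lebesgue_integral) auto
  moreover have "iexp (\<Sum>i\<in>{1..n}. h (U i w)) = (\<Prod>i\<in>{1..n}. iexp (h (U i w)))" for w
    by (simp only: of_real_sum sum_distrib_left exp_sum[OF finite_atLeastAtMost])
  ultimately have "expectation (\<lambda>w. iexp (\<Sum>t\<in>T. c t * Delta (sample w) n u a t)) = (\<Prod>i\<in>{1..n}. expectation (\<lambda>w. iexp (h (U i w))))"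
    by (simp only: split)
  then have "cmod (expectation (\<lambda>w. iexp (\<Sum>t\<in>T. c t * Delta (sample w) n u a t)) - (1 - V / (2 * real n)) ^ n)
    = cmod ((\<Prod>i\<in>{1..n}. expectation (\<lambda>w. iexp (h (U i w)))) - (\<Prod>i\<in>{1..n}. (1 - V / (2 * real n))))" by simp
  also have "\<dots> \<le> (\<Sum>i\<in>{1..n}. cmod (expectation (\<lambda>w. iexp (h (U i w))) - (1 - V / (2 * real n))))"
  proof -
    have "cmod (expectation (\<lambda>w. iexp (h (U i w)))) \<le> 1" if "i \<in> {1..n}" for i
    proof -
      have "cmod (expectation (\<lambda>w. iexp (h (U i w)))) \<le> expectation (\<lambda>w. cmod (iexp (h (U i w))))"
        by (rule integral_norm_bound)
      then show ?thesis by (simp add: prob_space)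
    qed
    moreover have "cmod (complex_of_real (1 - V / (2 * real n))) \<le> 1"
    proof -
      have "\<bar>1 - V / (2 * real n)\<bar> \<le> 1" using V nV n by (auto simp: abs_le_iff field_simps)
      then show ?thesis by (simp only: norm_of_real)
    qed
    ultimately show ?thesis unfolding of_real_prod by (intro norm_prod_diff) blast+
  qed
  also have "\<dots> \<le> (\<Sum>i\<in>{1..n}. C / sqrt N * V / (6 * real n))"
    using step by (intro sum_mono) auto
  also have "\<dots> = C / sqrt N * V / 6" using n by simp
  finally show "cmod (expectation (\<lambda>w. iexp (\<Sum>t\<in>T. c t * Delta (sample w) n u a t)) - (1 - V / (2 * real n)) ^ n)
     \<le> (\<Sum>t\<in>T. \<bar>c t\<bar>) / sqrt N * V / 6" by (simp add: C_def)
qed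

lemma char_Delta_uniform_limit:
  fixes T :: "(real^'d) set" and c :: "real^'d \<Rightarrow> real"
  assumes T: "finite T" "T \<subseteq> cbox 0 1"
    and a: "\<And>n. n \<ge> 1 \<Longrightarrow> 0 < a n \<and> a n \<le> 1" and a0: "a \<longlonglongrightarrow> 0"
    and N: "filterlim (\<lambda>n. real n * a n ^ CARD('d)) at_top sequentially"
    and e: "e > 0" and \<delta>: "\<delta> > 0"
  shows "\<forall>\<^sub>F n in sequentially. \<forall>u\<in>shrunk_cube \<delta>.
    cmod (expectation (\<lambda>w. iexp (\<Sum>t\<in>T. c t * Delta (sample w) n u (a n) t))
      - exp (- sheet_var T c / 2)) \<le> e"
proof -
  define v where "v = (sheet_var T c)"
  define q0 where "q0 = (\<Sum>t\<in>T. c t * (\<Prod>k\<in>UNIV. t $ k))"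
  define V where "V n = v - a n ^ CARD('d) * q0\<^sup>2" for n
  define C where "C = (\<Sum>t\<in>T. \<bar>c t\<bar>)"
  have Vv: "V n \<le> v" if "n \<ge> 1" for n using a[OF that] by (simp add: V_def)
  have "V \<longlonglongrightarrow> v - 0 ^ CARD('d) * q0\<^sup>2" unfolding V_def by (intro tendsto_intros a0)
  then have Vlim: "V \<longlonglongrightarrow> v" by (simp add: zero_power)
  have ev\<delta>: "\<forall>\<^sub>F n in sequentially. a n \<le> \<delta>"
    using order_tendstoD(2)[OF a0 \<delta>] by eventually_elim simp
  have evn: "\<forall>\<^sub>F n in sequentially. v \<le> 4 * real n" using eventually_ge_at_top[of "nat \<lceil>v\<rceil>"]
    by eventually_elim linarith
  have v0: "0 \<le> v" unfolding v_def by (rule sheet_cov_psd[OF T])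
  \<comment> \<open>Nonnegativity of \<open>V n\<close> is obtained below for large \<open>n\<close>
    only; the truncation gives the sign for all \<open>n \<ge> 1\<close>, as
    \<open>tendsto_power_exp\<close> requires.\<close>
  define X where "X n = - max 0 (V n) / 2" for n
  have "X \<longlonglongrightarrow> - max 0 v / 2" unfolding X_def by (intro tendsto_intros Vlim) auto
  then have "(\<lambda>n. (1 + X n / real n) ^ n) \<longlonglongrightarrow> exp (- max 0 v / 2)"
  proof (rule tendsto_power_exp)
    show "- max 0 v / 2 \<le> X n" if "n \<ge> 1" for n using Vv[OF that] by (simp add: X_def)
  qed (simp add: X_def)
  then have "(\<lambda>n. (1 + X n / real n) ^ n) \<longlonglongrightarrow> exp (- v / 2)" using v0 by simp
  from tendstoD[OF this, of "e / 2"] e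
  have lim1: "\<forall>\<^sub>F n in sequentially. \<bar>(1 + X n / real n) ^ n - exp (- v / 2)\<bar> < e / 2" by (simp add: dist_real_def)
  have "filterlim (\<lambda>n. sqrt (real n * a n ^ CARD('d))) at_top sequentially"
    by (rule filterlim_compose[OF sqrt_at_top N])
  then have "(\<lambda>n. C * v / 6 / sqrt (real n * a n ^ CARD('d))) \<longlonglongrightarrow> 0"
    by (rule real_tendsto_divide_at_top[OF tendsto_const])
  from order_tendstoD(2)[OF this, of "e / 2"] e
  have lim2: "\<forall>\<^sub>F n in sequentially. C * v / 6 / sqrt (real n * a n ^ CARD('d)) < e / 2" by simp
  show ?thesis using ev\<delta> evn eventually_ge_at_top[of 1] lim1 lim2
  proof eventually_elim
    case (elim n)
    show ?case
    proof
      fix u :: "real^'d" assume u: "u \<in> shrunk_cube \<delta>"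
      let ?E = "expectation (\<lambda>w. iexp (\<Sum>t\<in>T. c t * Delta (sample w) n u (a n) t))"
      have nV: "V n \<le> 4 * real n" using Vv[OF elim(3)] elim(2) by linarith
      then have "cmod (?E - (1 - V n / (2 * real n)) ^ n) \<le> C / sqrt (real n * a n ^ CARD('d)) * V n / 6"
        using char_Delta_step(2)[OF T u _ elim(1) elim(3), of c] a[OF elim(3)]
        unfolding V_def v_def q0_def C_def by blast
      also have "\<dots> = C * V n / 6 / sqrt (real n * a n ^ CARD('d))" by simp
      also have "\<dots> \<le> C * v / 6 / sqrt (real n * a n ^ CARD('d))"
        using Vv[OF elim(3)] a[OF elim(3)] by (intro divide_right_mono mult_left_mono) (auto simp: C_def intro!: sum_nonneg)
      also have "\<dots> < e / 2" by fact
      finally have 1: "cmod (?E - (1 - V n / (2 * real n)) ^ n) < e / 2" .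
      have "0 \<le> V n"
        using char_Delta_step(1)[OF T u _ elim(1) elim(3), of c] a[OF elim(3)] nV unfolding V_def v_def q0_def by blast
      then have "(1 - V n / (2 * real n)) ^ n = (1 + X n / real n) ^ n" by (simp add: X_def)
      then have 2: "cmod (complex_of_real ((1 - V n / (2 * real n)) ^ n) - exp (- v / 2)) < e / 2"
        using elim(4) by (metis norm_of_real of_real_diff)
      have "cmod (?E - exp (- v / 2)) \<le> cmod (?E - complex_of_real ((1 - V n / (2 * real n)) ^ n)) + cmod (complex_of_real ((1 - V n / (2 * real n)) ^ n) - exp (- v / 2))"
        using norm_triangle_ineq[of "?E - complex_of_real ((1 - V n / (2 * real n)) ^ n)" "complex_of_real ((1 - V n / (2 * real n)) ^ n) - exp (- v / 2)"]
        by simp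
      with 1 2 show "cmod (?E - exp (- sheet_var T c / 2)) \<le> e"
        by (simp add: v_def)
    qed
  qed
qed

end

section \<open>Stone-Weierstrass on function space and weak convergence from characteristic
  functions\<close>

lemma open_coord_vimage: "open U \<Longrightarrow> open {h :: 'a \<Rightarrow> 'b::topological_space. h x \<in> U}"
  using open_vimage[OF _ continuous_on_product_coordinates, of U x] by (simp add: vimage_def)

text \<open>This and the next two instances make function space, with the product topology, a
  Hausdorff type, as the Stone-Weierstrass locale \<open>function_ring_on\<close> requires.\<close>

instance "fun" :: (type, t0_space) t0_space
proof
  fix f g :: "'a \<Rightarrow> 'b" assume "f \<noteq> g"
  then obtain x where "f x \<noteq> g x" by auto
  from t0_space_class.t0_space[OF this] obtain U where "open U" "\<not> (f x \<in> U \<longleftrightarrow> g x \<in> U)" by blast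
  then show "\<exists>U. open U \<and> \<not> (f \<in> U \<longleftrightarrow> g \<in> U)"
    by (intro exI[of _ "{h. h x \<in> U}"]) (auto intro: open_coord_vimage)
qed

instance "fun" :: (type, t1_space) t1_space
proof
  fix f g :: "'a \<Rightarrow> 'b" assume "f \<noteq> g"
  then obtain x where "f x \<noteq> g x" by auto
  from t1_space_class.t1_space[OF this] obtain U where "open U" "f x \<in> U" "g x \<notin> U" by blast
  then show "\<exists>U. open U \<and> f \<in> U \<and> g \<notin> U"
    by (intro exI[of _ "{h. h x \<in> U}"]) (auto intro: open_coord_vimage)
qed

instance "fun" :: (type, t2_space) t2_space
proof
  fix f g :: "'a \<Rightarrow> 'b" assume "f \<noteq> g"
  then obtain x where "f x \<noteq> g x" by auto
  from hausdorff[OF this] obtain U V where "open U" "open V" "f x \<in> U" "g x \<in> V" "U \<inter> V = {}" by blast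
  then show "\<exists>U V. open U \<and> open V \<and> f \<in> U \<and> g \<in> V \<and> U \<inter> V = {}"
    by (intro exI[of _ "{h. h x \<in> U}"] exI[of _ "{h. h x \<in> V}"]) (auto intro: open_coord_vimage)
qed

lemma compact_PiE_UNIV:
  fixes S :: "'i \<Rightarrow> 'b::topological_space set"
  assumes "\<And>i. compact (S i)"
  shows "compact (PiE UNIV S)"
proof -
  have "compactin (product_topology (\<lambda>_. euclidean) UNIV) (PiE UNIV S)"
    unfolding compactin_PiE using assms by simp
  then show ?thesis by (simp add: euclidean_product_topology)
qed

inductive_set coord_polys :: "'t set \<Rightarrow> (('t \<Rightarrow> real) \<Rightarrow> real) set" for T where
  const: "(\<lambda>_. c) \<in> coord_polys T"
| coord: "t \<in> T \<Longrightarrow> (\<lambda>y. y t) \<in> coord_polys T"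
| add: "p \<in> coord_polys T \<Longrightarrow> q \<in> coord_polys T \<Longrightarrow> (\<lambda>y. p y + q y) \<in> coord_polys T"
| mult: "p \<in> coord_polys T \<Longrightarrow> q \<in> coord_polys T \<Longrightarrow> (\<lambda>y. p y * q y) \<in> coord_polys T"

text \<open>Products are left out of the rules because convergence of integrals is inherited by
  linear combinations only; closure under products is derived. Rational frequencies keep the
  characteristic functions to be controlled countable for finite \<open>T\<close>.\<close>

inductive_set trig_polys :: "'t set \<Rightarrow> (('t \<Rightarrow> real) \<Rightarrow> complex) set" for T where
  iexp: "(\<And>t. t \<in> T \<Longrightarrow> c t \<in> \<rat>) \<Longrightarrow> (\<lambda>x. iexp (\<Sum>t\<in>T. c t * x t)) \<in> trig_polys T"
| cmult: "p \<in> trig_polys T \<Longrightarrow> (\<lambda>x. b * p x) \<in> trig_polys T"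
| add: "p \<in> trig_polys T \<Longrightarrow> q \<in> trig_polys T \<Longrightarrow> (\<lambda>x. p x + q x) \<in> trig_polys T"

lemma trig_polys_const: "(\<lambda>_. b) \<in> trig_polys T"
  using trig_polys.cmult[OF trig_polys.iexp[of T "\<lambda>_. 0"], of b] by simp

lemma trig_polys_mult_iexp:
  assumes c: "\<And>t. t \<in> T \<Longrightarrow> c t \<in> \<rat>" and "q \<in> trig_polys T"
  shows "(\<lambda>x. iexp (\<Sum>t\<in>T. c t * x t) * q x) \<in> trig_polys T"
  using assms(2)
proof induction
  case (iexp d)
  have "(\<lambda>x. iexp (\<Sum>t\<in>T. (c t + d t) * x t)) \<in> trig_polys T"
    using c iexp by (intro trig_polys.iexp) auto
  then show ?case by (simp add: exp_add[symmetric] distrib_left distrib_right sum.distrib)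
next
  case (cmult p b)
  from trig_polys.cmult[OF cmult.IH, of b] show ?case by (simp add: mult_ac)
next
  case (add p q)
  from trig_polys.add[OF add.IH] show ?case by (simp add: distrib_left)
qed

lemma trig_polys_mult:
  assumes "p \<in> trig_polys T" "q \<in> trig_polys T"
  shows "(\<lambda>x. p x * q x) \<in> trig_polys T"
  using assms(1)
proof induction
  case (iexp c)
  then show ?case using trig_polys_mult_iexp[OF _ assms(2)] by blast
next
  case (cmult p b)
  from trig_polys.cmult[OF cmult.IH, of b] show ?case by (simp add: mult_ac)
next
  case (add p q)
  from trig_polys.add[OF add.IH] show ?case by (simp add: distrib_right)
qed

lemma trig_polys_sin:
  assumes T: "finite T" "t \<in> T" and k: "k \<in> \<rat>"
  shows "(\<lambda>x. complex_of_real (sin (k * x t))) \<in> trig_polys T"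
proof -
  have s: "(\<Sum>s\<in>T. (if s = t then b else 0) * x s) = b * x t" for b :: real and x
    using T by (simp add: if_distrib[of "\<lambda>c. c * _"] cong: if_cong)
  have "(\<lambda>x. iexp (\<Sum>s\<in>T. (if s = t then b else 0) * x s)) \<in> trig_polys T" if "b \<in> \<rat>" for b
    using that by (intro trig_polys.iexp) auto
  then have e: "(\<lambda>x. iexp (b * x t)) \<in> trig_polys T" if "b \<in> \<rat>" for b using that by (simp add: s)
  have "(\<lambda>x. 1 / (2 * \<i>) * iexp (k * x t) + (- 1 / (2 * \<i>)) * iexp ((- k) * x t)) \<in> trig_polys T"
    using k by (intro trig_polys.add trig_polys.cmult e) auto
  also have "(\<lambda>x. 1 / (2 * \<i>) * iexp (k * x t) + (- 1 / (2 * \<i>)) * iexp ((- k) * x t)) = (\<lambda>x. complex_of_real (sin (k * x t)))"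
    by (auto simp: fun_eq_iff sin_of_real[symmetric] sin_exp_eq diff_divide_distrib right_diff_distrib)
  finally show ?thesis .
qed

text \<open>Substituting sines for the coordinates turns algebraic into trigonometric polynomials; a
  rational \<open>k\<close> keeps all frequencies rational.\<close>

lemma trig_polys_coord_polys:
  assumes "p \<in> coord_polys T" and T: "finite T" and k: "k \<in> \<rat>"
  shows "(\<lambda>x. complex_of_real (p (\<lambda>t. if t \<in> T then sin (k * x t) else 0))) \<in> trig_polys T"
  using assms(1)
proof induction
  case (coord t)
  then show ?case using trig_polys_sin[OF T _ k] by simp
qed (simp_all add: trig_polys_const trig_polys.add trig_polys_mult)

text \<open>\<open>g\<close> lives on a function space without a chosen sigma-algebra. Rounding the
  coordinates in \<open>T\<close> to multiples of 1/(k+1) leaves countably many values, hence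
  measurability, and the Lipschitz condition makes the error vanish.\<close>

lemma Lipschitz_rounding_measurable:
  fixes g :: "('t \<Rightarrow> real) \<Rightarrow> real"
  assumes T: "finite T"
    and X[measurable]: "\<And>t. t \<in> T \<Longrightarrow> (\<lambda>u. X u t) \<in> borel_measurable P"
    and lip: "\<And>x y e. (\<forall>t\<in>T. \<bar>x t - y t\<bar> \<le> e) \<Longrightarrow> \<bar>g x - g y\<bar> \<le> L * e"
  shows "(\<lambda>u. g (X u)) \<in> borel_measurable P"
proof (rule borel_measurable_LIMSEQ_real)
  define f where "f k u = (\<lambda>t\<in>T. \<lfloor>real (Suc k) * X u t\<rfloor>)" for k u
  define h where "h k z = g (\<lambda>t. of_int (z t) / real (Suc k))" for k and z :: "'t \<Rightarrow> int"
  have "f k \<in> measurable P (count_space (PiE T (\<lambda>_. UNIV)))" for k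
  proof (subst measurable_count_space_eq_countable)
    show "countable (PiE T (\<lambda>_. UNIV :: int set))" using T by (intro countable_PiE) auto
    show "f k \<in> space P \<rightarrow> T \<rightarrow>\<^sub>E UNIV \<and> (\<forall>z\<in>T \<rightarrow>\<^sub>E UNIV. f k -` {z} \<inter> space P \<in> sets P)"
    proof (intro conjI ballI)
      fix z :: "'t \<Rightarrow> int" assume z: "z \<in> T \<rightarrow>\<^sub>E UNIV"
      have "f k -` {z} \<inter> space P = {u\<in>space P. \<forall>t\<in>T. \<lfloor>real (Suc k) * X u t\<rfloor> = z t}"
        using z by (auto simp: f_def fun_eq_iff PiE_def extensional_def restrict_def split: if_splits)
      also have "\<dots> \<in> sets P"
        using T by measurable
      finally show "f k -` {z} \<inter> space P \<in> sets P" .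
    qed (auto simp: f_def)
  qed
  then show "(\<lambda>u. h k (f k u)) \<in> borel_measurable P" for k
    by (rule measurable_compose) simp
  fix u
  have L: "\<bar>h k (f k u) - g (X u)\<bar> \<le> L * (1 / real (Suc k))" for k
    unfolding h_def
  proof (rule lip, rule ballI)
    fix t assume "t \<in> T"
    then have "of_int (f k u t) / real (Suc k) - X u t = (of_int \<lfloor>real (Suc k) * X u t\<rfloor> - real (Suc k) * X u t) / real (Suc k)"
      by (simp add: f_def diff_divide_distrib del: of_nat_Suc)
    also have "\<bar>\<dots>\<bar> \<le> 1 / real (Suc k)"
      unfolding abs_divide by (intro divide_mono) (auto simp del: of_nat_Suc, linarith)
    finally show "\<bar>of_int (f k u t) / real (Suc k) - X u t\<bar> \<le> 1 / real (Suc k)" .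
  qed
  have "(\<lambda>k. L * (1 / real (Suc k))) \<longlonglongrightarrow> 0"
    using tendsto_mult_right_zero[OF LIMSEQ_inverse_real_of_nat] by (simp add: inverse_eq_divide)
  then have "(\<lambda>k. h k (f k u) - g (X u)) \<longlonglongrightarrow> 0"
    by (rule Lim_null_comparison[rotated]) (use L in auto)
  then show "(\<lambda>k. h k (f k u)) \<longlonglongrightarrow> g (X u)" by (simp add: LIM_zero_iff)
qed

context
  fixes T :: "'t set" and P :: "'u measure" and Q :: "'b measure"
    and X :: "nat \<Rightarrow> 'u \<Rightarrow> 't \<Rightarrow> real" and Y :: "'b \<Rightarrow> 't \<Rightarrow> real"
  assumes T: "finite T" and P: "prob_space P" and Q: "prob_space Q"
    and X[measurable]: "\<And>n t. t \<in> T \<Longrightarrow> (\<lambda>u. X n u t) \<in> borel_measurable P"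
    and Y[measurable]: "\<And>t. t \<in> T \<Longrightarrow> (\<lambda>u. Y u t) \<in> borel_measurable Q"
    and chf: "\<And>c. (\<And>t. t \<in> T \<Longrightarrow> c t \<in> \<rat>) \<Longrightarrow>
      (\<lambda>n. \<integral>u. iexp (\<Sum>t\<in>T. c t * X n u t) \<partial>P) \<longlonglongrightarrow> (\<integral>u. iexp (\<Sum>t\<in>T. c t * Y u t) \<partial>Q)"
begin

lemma trig_polys_integral_tendsto:
  assumes "p \<in> trig_polys T"
  shows "(\<forall>n. integrable P (\<lambda>u. p (X n u))) \<and> integrable Q (\<lambda>u. p (Y u)) \<and>
     (\<lambda>n. \<integral>u. p (X n u) \<partial>P) \<longlonglongrightarrow> (\<integral>u. p (Y u) \<partial>Q)"
  using assms
proof induction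
  case (iexp c)
  interpret P: prob_space P by fact
  interpret Q: prob_space Q by fact
  have "integrable P (\<lambda>u. iexp (\<Sum>t\<in>T. c t * X n u t))" for n
    by (rule P.integrable_const_bound[where B = 1]) auto
  moreover have "integrable Q (\<lambda>u. iexp (\<Sum>t\<in>T. c t * Y u t))"
    by (rule Q.integrable_const_bound[where B = 1]) auto
  ultimately show ?case using chf[OF iexp] by auto
next
  case (cmult p b)
  then show ?case by (auto intro!: tendsto_intros)
next
  case (add p q)
  then show ?case by (auto intro!: tendsto_intros)
qed

text \<open>On the box \<open>\<bar>x t\<bar> \<le> K\<close> the map \<open>s\<close>, with
  coordinates \<open>sin (x t / K)\<close>, is inverted by \<open>arcsin\<close>, so
  \<open>g\<close> becomes a continuous \<open>G\<close> on the compact \<open>S\<close>, which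
  polynomials approximate. The polynomial after \<open>s\<close> is a trigonometric polynomial and
  stays close to \<open>G\<close> everywhere, because \<open>s\<close> always lands in
  \<open>S\<close>. Off the box, which is improbable by tightness, the error is therefore still at
  most \<open>e + 2 * B + 1\<close>.\<close>

lemma weak_convergence_of_char:
  fixes g :: "('t \<Rightarrow> real) \<Rightarrow> real"
  assumes tight: "\<And>t e. t \<in> T \<Longrightarrow> e > 0 \<Longrightarrow>
      \<exists>K. eventually (\<lambda>n. measure P {u\<in>space P. K < \<bar>X n u t\<bar>} \<le> e) sequentially"
    and lip: "\<And>x y e. (\<forall>t\<in>T. \<bar>x t - y t\<bar> \<le> e) \<Longrightarrow> \<bar>g x - g y\<bar> \<le> L * e"
    and bd: "\<And>x. \<bar>g x\<bar> \<le> B"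
  shows "(\<lambda>n. \<integral>u. g (X n u) \<partial>P) \<longlonglongrightarrow> (\<integral>u. g (Y u) \<partial>Q)"
proof (rule tendstoI)
  fix \<epsilon> :: real assume \<epsilon>: "\<epsilon> > 0"
  interpret P: prob_space P by fact
  interpret Q: prob_space Q by fact
  have B: "B \<ge> 0" using bd[of undefined] by linarith
  have L: "L \<ge> 0" using lip[of "\<lambda>_. 0" "\<lambda>_. 0" 1] by simp
  \<comment> \<open>Two approximation errors \<open>e * (2 * B + 2)\<close> and one \<open>e\<close>
    for the limit add up to \<open>e * (4 * B + 5)\<close>, strictly below
    \<open>\<epsilon>\<close>.\<close>
  define e where "e = min 1 (\<epsilon> / (4 * B + 6))"
  have e: "e > 0" "e \<le> 1" using \<epsilon> B by (auto simp: e_def)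
  define e1 where "e1 = e / (real (card T) + 1)"
  have e1: "e1 > 0" "real (card T) * e1 \<le> e"
    using e by (auto simp: e1_def field_simps)
  have tightY: "\<exists>K. measure Q {u\<in>space Q. K < \<bar>Y u t\<bar>} \<le> e1" if t: "t \<in> T" for t
  proof -
    have "(\<lambda>k. measure Q {u\<in>space Q. real k < \<bar>Y u t\<bar>}) \<longlonglongrightarrow> measure Q (\<Inter>k. {u\<in>space Q. real k < \<bar>Y u t\<bar>})"
      using t by (intro Q.finite_Lim_measure_decseq) (auto simp: decseq_def)
    also have "(\<Inter>k. {u\<in>space Q. real k < \<bar>Y u t\<bar>}) = {}"
    proof -
      have "\<not> (\<forall>k. real k < \<bar>Y u t\<bar>)" for u
        using reals_Archimedean2[of "\<bar>Y u t\<bar>"] by (meson less_asym)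
      then show ?thesis by blast
    qed
    finally have "eventually (\<lambda>k. measure Q {u\<in>space Q. real k < \<bar>Y u t\<bar>} < e1) sequentially"
      by (rule order_tendstoD) (use e1 in simp)
    then show ?thesis by (auto simp: eventually_sequentially intro: less_imp_le)
  qed
  have "\<forall>t\<in>T. \<exists>K. eventually (\<lambda>n. measure P {u\<in>space P. K < \<bar>X n u t\<bar>} \<le> e1) sequentially"
    using tight e1 by blast
  from bchoice[OF this] obtain K1 where K1: "\<And>t. t \<in> T \<Longrightarrow> eventually (\<lambda>n. measure P {u\<in>space P. K1 t < \<bar>X n u t\<bar>} \<le> e1) sequentially"
    by blast
  have "\<forall>t\<in>T. \<exists>K. measure Q {u\<in>space Q. K < \<bar>Y u t\<bar>} \<le> e1"
    using tightY by blast
  from bchoice[OF this] obtain K2 where K2: "\<And>t. t \<in> T \<Longrightarrow> measure Q {u\<in>space Q. K2 t < \<bar>Y u t\<bar>} \<le> e1"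
    by blast
  obtain k :: nat where k0: "(\<Sum>t\<in>T. \<bar>K1 t\<bar>) + (\<Sum>t\<in>T. \<bar>K2 t\<bar>) < real k" using reals_Archimedean2 by blast
  \<comment> \<open>A positive integer, so that the frequency \<open>1 / K\<close> is
    rational.\<close>
  define K where "K = real (Suc k)"
  have K: "K > 0" by (simp add: K_def)
  have KK: "K1 t \<le> K" "K2 t \<le> K" if "t \<in> T" for t
  proof -
    have "\<bar>K1 t\<bar> \<le> (\<Sum>t\<in>T. \<bar>K1 t\<bar>)" "\<bar>K2 t\<bar> \<le> (\<Sum>t\<in>T. \<bar>K2 t\<bar>)"
      using T that by (auto intro!: member_le_sum)
    moreover have "0 \<le> (\<Sum>t\<in>T. \<bar>K1 t\<bar>)" "0 \<le> (\<Sum>t\<in>T. \<bar>K2 t\<bar>)" by (auto intro!: sum_nonneg)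
    ultimately show "K1 t \<le> K" "K2 t \<le> K" using k0 by (auto simp: K_def)
  qed
  have union: "measure R {u\<in>space R. \<exists>t\<in>T. K < \<bar>Z u t\<bar>} \<le> e"
    if "finite_measure R" "\<And>t. t \<in> T \<Longrightarrow> (\<lambda>u. Z u t) \<in> borel_measurable R"
      "\<And>t. t \<in> T \<Longrightarrow> measure R {u\<in>space R. \<kappa> t < \<bar>Z u t\<bar>} \<le> e1" "\<And>t. t \<in> T \<Longrightarrow> \<kappa> t \<le> K"
    for R :: "'r measure" and Z :: "'r \<Rightarrow> 't \<Rightarrow> real" and \<kappa>
  proof -
    interpret R: finite_measure R by fact
    note that(2)[measurable]
    have "measure R {u\<in>space R. \<exists>t\<in>T. K < \<bar>Z u t\<bar>} \<le> measure R (\<Union>t\<in>T. {u\<in>space R. \<kappa> t < \<bar>Z u t\<bar>})"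
      using T that(4) by (intro R.finite_measure_mono sets.finite_UN) (auto intro: order.strict_trans1)
    also have "\<dots> \<le> (\<Sum>t\<in>T. measure R {u\<in>space R. \<kappa> t < \<bar>Z u t\<bar>})"
      using T by (intro R.finite_measure_subadditive_finite) auto
    also have "\<dots> \<le> (\<Sum>t\<in>T. e1)" by (intro sum_mono that)
    finally show ?thesis using e1 by simp
  qed
  \<comment> \<open>Coordinates outside \<open>T\<close> are pinned to 0, so that the coordinates in
    \<open>T\<close> separate the points of \<open>S\<close>.\<close>
  define S where "S = PiE UNIV (\<lambda>t. if t \<in> T then {-1..1::real} else {0})"
  have S: "compact S" unfolding S_def by (intro compact_PiE_UNIV) auto
  define G where "G y = g (\<lambda>t. K * arcsin (y t))" for y
  have coord: "continuous_on A (\<lambda>x::'t \<Rightarrow> real. x t)" for A t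
    by (rule continuous_on_subset[OF continuous_on_product_coordinates subset_UNIV])
  have Gc: "continuous_on S G"
    unfolding continuous_on_def
  proof (intro ballI tendstoI)
    fix y e' assume y: "y \<in> S" and e': "(e'::real) > 0"
    define d where "d = e' / (2 * (L + 1))"
    have "L * e' \<ge> 0" using L e' by simp
    then have d: "d > 0" "L * d < e'" using L e' by (auto simp: d_def pos_divide_less_eq algebra_simps add_nonneg_pos)
    have "eventually (\<lambda>z. \<bar>K * arcsin (z t) - K * arcsin (y t)\<bar> \<le> d) (at y within S)" if t: "t \<in> T" for t
    proof -
      have "- 1 \<le> z t \<and> z t \<le> 1" if "z \<in> S" for z
        using that t by (auto simp: S_def PiE_iff dest!: spec[of _ t])
      then have c: "continuous_on S (\<lambda>z. K * arcsin (z t))"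
        by (intro continuous_intros continuous_on_arcsin coord) blast
      then have "((\<lambda>z. K * arcsin (z t)) \<longlongrightarrow> K * arcsin (y t)) (at y within S)"
        using y by (auto simp: continuous_on_def)
      from tendstoD[OF this d(1)] show ?thesis by eventually_elim (simp add: dist_real_def)
    qed
    then have "eventually (\<lambda>z. \<forall>t\<in>T. \<bar>K * arcsin (z t) - K * arcsin (y t)\<bar> \<le> d) (at y within S)"
      using T by (simp add: eventually_ball_finite)
    then show "eventually (\<lambda>z. dist (G z) (G y) < e') (at y within S)"
    proof eventually_elim
      case (elim z)
      then show ?case using lip[OF elim] d by (simp add: G_def dist_real_def)
    qed
  qed
  interpret R: function_ring_on "coord_polys T" S
  proof
    show "continuous_on S p" if "p \<in> coord_polys T" for p
      using that by induction (auto intro!: continuous_intros coord)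
    show "\<exists>p\<in>coord_polys T. p x \<noteq> p y" if xy: "x \<in> S" "y \<in> S" "x \<noteq> y" for x y
    proof -
      obtain t where t: "x t \<noteq> y t" using xy by auto
      have "t \<in> T" using t xy(1,2) by (auto simp: S_def PiE_iff split: if_splits dest!: spec[of _ t])
      then show ?thesis using t by (intro bexI[of _ "\<lambda>y. y t"] coord_polys.coord) auto
    qed
  qed (auto intro: S coord_polys.intros)
  obtain p where p: "p \<in> coord_polys T" "\<And>y. y \<in> S \<Longrightarrow> \<bar>G y - p y\<bar> < e"
    using R.Stone_Weierstrass_basic[OF Gc e(1)] by blast
  define s where "s x = (\<lambda>t. if t \<in> T then sin (1 / K * x t) else 0)" for x :: "'t \<Rightarrow> real"
  have sS: "s x \<in> S" for x by (auto simp: s_def S_def)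
  have Gs: "G (s x) = g x" if "\<forall>t\<in>T. \<bar>x t\<bar> \<le> K" for x
  proof -
    have "\<bar>K * arcsin (s x t) - x t\<bar> \<le> 0" if t: "t \<in> T" for t
    proof -
      have "\<bar>x t / K\<bar> \<le> 1" using \<open>\<forall>t\<in>T. \<bar>x t\<bar> \<le> K\<close> t K by (simp add: divide_simps)
      \<comment> \<open>The argument stays on the branch where \<open>arcsin\<close> inverts
        \<open>sin\<close>, since 1 is at most \<open>pi / 2\<close>.\<close>
      then have "\<bar>x t / K\<bar> \<le> pi / 2" using pi_ge_two by linarith
      then have "arcsin (sin (x t / K)) = x t / K" unfolding abs_le_iff by (intro arcsin_sin) linarith+
      then show ?thesis using t K by (simp add: s_def)
    qed
    then have "\<bar>G (s x) - g x\<bar> \<le> L * 0" unfolding G_def by (intro lip) blast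
    then show ?thesis by simp
  qed
  have pt: "\<bar>g x - p (s x)\<bar> \<le> e + (2 * B + 1) * of_bool (\<exists>t\<in>T. K < \<bar>x t\<bar>)" for x
  proof (cases "\<exists>t\<in>T. K < \<bar>x t\<bar>")
    case False
    then have "\<forall>t\<in>T. \<bar>x t\<bar> \<le> K" by (auto simp: not_less)
    from Gs[OF this] show ?thesis using False p(2)[OF sS, of x] by simp
  next
    case True
    have "\<bar>G (s x)\<bar> \<le> B" unfolding G_def by (rule bd)
    then have "\<bar>g x - p (s x)\<bar> \<le> e + (2 * B + 1)" using bd[of x] p(2)[OF sS, of x] e by linarith
    then show ?thesis using True by simp
  qed
  have trig: "(\<lambda>x. complex_of_real (p (s x))) \<in> trig_polys T"
    unfolding s_def by (rule trig_polys_coord_polys[OF p(1) T]) (simp add: K_def)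
  note tt = trig_polys_integral_tendsto[OF trig]
  have intp: "integrable P (\<lambda>u. p (s (X n u)))" "integrable Q (\<lambda>u. p (s (Y u)))" for n
    using tt integrable_Re[of P "\<lambda>u. complex_of_real (p (s (X n u)))"] integrable_Re[of Q "\<lambda>u. complex_of_real (p (s (Y u)))"] by auto
  have lim: "(\<lambda>n. \<integral>u. p (s (X n u)) \<partial>P) \<longlonglongrightarrow> (\<integral>u. p (s (Y u)) \<partial>Q)"
    using tt by (simp only: integral_complex_of_real tendsto_of_real_iff)
  have close: "\<bar>(\<integral>u. g (Z u) \<partial>R) - (\<integral>u. p (s (Z u)) \<partial>R)\<bar> \<le> e * (2 * B + 2)"
    if R: "prob_space R" and Z: "\<And>t. t \<in> T \<Longrightarrow> (\<lambda>u. Z u t) \<in> borel_measurable R"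
      and ip: "integrable R (\<lambda>u. p (s (Z u)))" and m: "measure R {u\<in>space R. \<exists>t\<in>T. K < \<bar>Z u t\<bar>} \<le> e"
    for R :: "'r measure" and Z :: "'r \<Rightarrow> 't \<Rightarrow> real"
  proof -
    interpret R: prob_space R by fact
    note Z[measurable]
    let ?bad = "{u\<in>space R. \<exists>t\<in>T. K < \<bar>Z u t\<bar>}"
    have bm: "?bad \<in> sets R" using T by measurable
    have ig: "integrable R (\<lambda>u. g (Z u))"
      using bd by (intro R.integrable_const_bound[where B = B] Lipschitz_rounding_measurable[OF T Z lip]) auto
    have "(\<integral>u. g (Z u) \<partial>R) - (\<integral>u. p (s (Z u)) \<partial>R) = (\<integral>u. g (Z u) - p (s (Z u)) \<partial>R)"
      using ig ip by simp
    also have "\<bar>\<dots>\<bar> \<le> (\<integral>u. \<bar>g (Z u) - p (s (Z u))\<bar> \<partial>R)" by (rule integral_abs_bound)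
    also have "\<dots> \<le> (\<integral>u. e + (2 * B + 1) * indicator ?bad u \<partial>R)"
    proof (rule integral_mono)
      show "integrable R (\<lambda>u. e + (2 * B + 1) * indicator ?bad u)"
        using bm by (intro Bochner_Integration.integrable_add integrable_mult_right integrable_real_indicator) (auto simp: R.emeasure_eq_measure)
      show "\<bar>g (Z u) - p (s (Z u))\<bar> \<le> e + (2 * B + 1) * indicator ?bad u" if "u \<in> space R" for u
        using pt[of "Z u"] that by (auto simp: indicator_def)
    qed (use ig ip in auto)
    also have "\<dots> = e + (2 * B + 1) * measure R ?bad"
      using bm by (subst Bochner_Integration.integral_add) (auto simp: R.emeasure_eq_measure R.prob_space intro!: integrable_real_indicator)
    also have "\<dots> \<le> e + (2 * B + 1) * e" using m B by (intro add_left_mono mult_left_mono) auto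
    finally show ?thesis by (simp add: algebra_simps)
  qed
  have cQ: "\<bar>(\<integral>u. g (Y u) \<partial>Q) - (\<integral>u. p (s (Y u)) \<partial>Q)\<bar> \<le> e * (2 * B + 2)"
    by (intro close Q Y intp union[of Q Y K2] K2 KK) (auto intro: Q.finite_measure_axioms)
  have evK: "eventually (\<lambda>n. \<forall>t\<in>T. measure P {u\<in>space P. K1 t < \<bar>X n u t\<bar>} \<le> e1) sequentially"
    using T K1 by (simp add: eventually_ball_finite)
  have \<epsilon>e: "e * (2 * B + 2) + e * (2 * B + 2) + e < \<epsilon>"
  proof -
    have "e \<le> \<epsilon> / (4 * B + 6)" by (simp add: e_def)
    then have "e * (4 * B + 6) \<le> \<epsilon>" using B by (subst (asm) pos_le_divide_eq) auto
    then show ?thesis using e by (simp add: algebra_simps)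
  qed
  from evK tendstoD[OF lim e(1)]
  show "eventually (\<lambda>n. dist (\<integral>u. g (X n u) \<partial>P) (\<integral>u. g (Y u) \<partial>Q) < \<epsilon>) sequentially"
  proof eventually_elim
    case (elim n)
    have "\<bar>(\<integral>u. g (X n u) \<partial>P) - (\<integral>u. p (s (X n u)) \<partial>P)\<bar> \<le> e * (2 * B + 2)"
      using elim(1) by (intro close P X intp union[of P "X n" K1] KK) (auto intro: P.finite_measure_axioms)
    with elim(2) cQ \<epsilon>e show ?case unfolding dist_real_def by linarith
  qed
qed

end

section \<open>Functionals of the Wiener sheet\<close>

lemma wiener_sheet_char:
  fixes T :: "(real^'d) set" and W :: "'b \<Rightarrow> real^'d \<Rightarrow> real"
  assumes W: "wiener_sheet N W" and T: "finite T" "T \<subseteq> cbox 0 1"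
  shows "(\<integral>\<eta>. iexp (\<Sum>t\<in>T. c t * W \<eta> t) \<partial>N) = exp (- sheet_var T c / 2)"
proof -
  interpret prob_space N using W by (simp add: wiener_sheet_def)
  obtain ts where ts: "set ts = T" "distinct ts" using finite_distinct_list[OF T(1)] by blast
  have sum_ts: "(\<Sum>j<length ts. f (ts ! j)) = (\<Sum>t\<in>T. f t)" for f :: "real^'d \<Rightarrow> real"
    using sum.reindex_bij_betw[OF bij_betw_nth[OF ts(2) refl refl], of f] ts(1) by simp
  define v where "v = (sheet_var T c)"
  define X where "X \<eta> = (\<Sum>t\<in>T. c t * W \<eta> t)" for \<eta>
  have v0: "0 \<le> v" unfolding v_def by (rule sheet_cov_psd[OF T])
  have "(\<Sum>j<length ts. \<Sum>k<length ts. (map c ts)!j * (map c ts)!k * sheet_cov (ts!j) (ts!k)) = v"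
    unfolding v_def sum_ts[symmetric] by simp
  moreover have "(\<Sum>j<length ts. (map c ts)!j * W \<eta> (ts!j)) = X \<eta>" for \<eta>
    unfolding X_def sum_ts[symmetric] by simp
  moreover have "set ts \<subseteq> cbox 0 1" using ts T by simp
  ultimately have X: "if v > 0 then distributed N lborel X (normal_density 0 (sqrt v)) else (AE w in N. X w = 0)"
    using W unfolding wiener_sheet_def Let_def
    by (elim conjE allE[of _ ts] allE[of _ "map c ts"]) (simp split: if_splits)
  have "(\<integral>\<eta>. iexp (X \<eta>) \<partial>N) = exp (- v / 2)"
  proof (cases "v > 0")
    case True
    then have "distributed N lborel X (normal_density 0 (sqrt v))" using X by simp
    then have d: "distributed N lborel (\<lambda>x. X x / sqrt v) std_normal_density"
      using normal_standard_normal_convert[of "sqrt v" X 0] True by simp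
    then have [measurable]: "(\<lambda>x. X x / sqrt v) \<in> borel_measurable N"
      using distributed_measurable by fastforce
    have "complex_of_real (exp (- ((sqrt v)\<^sup>2) / 2)) = char std_normal_distribution (sqrt v)"
      by (simp add: char_std_normal_distribution)
    also have "std_normal_distribution = distr N lborel (\<lambda>x. X x / sqrt v)"
      using distributed_distr_eq_density[OF d] by simp
    also have "char \<dots> (sqrt v) = (\<integral>\<eta>. iexp (sqrt v * (X \<eta> / sqrt v)) \<partial>N)"
      unfolding char_def by (subst integral_distr) auto
    also have "\<dots> = (\<integral>\<eta>. iexp (X \<eta>) \<partial>N)" using True by simp
    finally show ?thesis using True by (simp add: exp_of_real)
  next
    case False
    then have ae: "AE w in N. X w = 0" and "v = 0" using X v0 by auto
    have [measurable]: "X \<in> borel_measurable N"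
      using W T unfolding X_def wiener_sheet_def by (intro borel_measurable_sum borel_measurable_times) auto
    have "(\<integral>\<eta>. iexp (X \<eta>) \<partial>N) = (\<integral>\<eta>. 1 \<partial>N)"
      using ae by (intro integral_cong_AE) auto
    then show ?thesis using \<open>v = 0\<close> by (simp add: prob_space)
  qed
  then show ?thesis by (simp add: X_def v_def)
qed

text \<open>For \<open>y\<close> strictly between 1 and the liminf, eventually
  \<open>1 / a n\<close> exceeds \<open>ln n powr y\<close>. As \<open>a n \<le> 1\<close>, the
  power \<open>d\<close> only helps, and \<open>K * ln n powr (y - 1)\<close> eventually exceeds 2
  however small \<open>K\<close> is: this is where \<open>y > 1\<close> enters. The terms are then
  at most \<open>1 / n ^ 2\<close>.\<close>

lemma summable_exp_bandwidth:
  fixes a :: "nat \<Rightarrow> real"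
  assumes a: "\<And>n. n \<ge> 1 \<Longrightarrow> 0 < a n \<and> a n \<le> 1" and d: "d \<ge> 1"
    and li: "liminf (\<lambda>n. ereal (ln (1 / a n) / ln (ln (real n)))) > 1"
    and K: "K > 0"
  shows "summable (\<lambda>n. exp (- K / a n ^ d))"
proof -
  obtain y where y: "1 < ereal y" "ereal y < liminf (\<lambda>n. ereal (ln (1 / a n) / ln (ln (real n))))"
    using ereal_dense2[OF li] by blast
  then have y1: "y > 1" by simp
  have e1: "\<forall>\<^sub>F n in sequentially. ereal y < ereal (ln (1 / a n) / ln (ln (real n)))"
    using y(2) by (rule less_LiminfD)
  have lnlim: "filterlim (\<lambda>n. ln (real n)) at_top sequentially"
    by (rule filterlim_compose[OF ln_at_top filterlim_real_sequentially])
  \<comment> \<open>The first threshold makes \<open>ln (ln n)\<close> positive; the second is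
    \<open>2 / K \<le> ln n powr (y - 1)\<close> solved for \<open>ln n\<close>.\<close>
  have e2: "\<forall>\<^sub>F n in sequentially. exp 1 \<le> ln (real n)" "\<forall>\<^sub>F n in sequentially. (2 / K) powr (1 / (y - 1)) \<le> ln (real n)"
    using lnlim by (auto simp: filterlim_at_top)
  have "\<forall>\<^sub>F n in sequentially. norm (exp (- K / a n ^ d)) \<le> 1 / real n ^ 2"
    using e1 e2 eventually_ge_at_top[of 1]
  proof eventually_elim
    case (elim n)
    note an = a[OF elim(4)]
    let ?l = "ln (real n)"
    have l: "?l > 0" "ln ?l > 0"
    proof -
      show "?l > 0" using elim(2) exp_gt_zero[of "1::real"] by linarith
      have "?l > 1" using elim(2) exp_ge_add_one_self[of "1::real"] by linarith
      then show "ln ?l > 0" by simp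
    qed
    have "y * ln ?l < ln (1 / a n)" using elim(1) l by (simp add: pos_less_divide_eq)
    then have "exp (y * ln ?l) < exp (ln (1 / a n))" by simp
    then have "?l powr y < 1 / a n" using l an by (simp add: powr_def mult.commute)
    moreover have "?l powr y = ?l * ?l powr (y - 1)"
      using l by (simp add: powr_mult_base)
    moreover have "2 / K \<le> ?l powr (y - 1)"
    proof -
      have "2 / K = ((2 / K) powr (1 / (y - 1))) powr (y - 1)" using y1 K by (simp add: powr_powr)
      also have "\<dots> \<le> ?l powr (y - 1)" using y1 elim(3) by (intro powr_mono2) auto
      finally show ?thesis .
    qed
    ultimately have "?l * (2 / K) \<le> 1 / a n" using l by (smt (verit) mult_left_mono)
    also have "1 / a n \<le> 1 / a n ^ d"
    proof -
      have "a n ^ d \<le> a n ^ 1" using an d by (intro power_decreasing) auto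
      then show ?thesis using an by (intro divide_left_mono) auto
    qed
    finally have "2 * ?l \<le> K / a n ^ d" using K by (simp add: field_simps)
    then have "exp (- K / a n ^ d) \<le> exp (- (2 * ?l))" by simp
    also have "\<dots> = 1 / real n ^ 2"
      using elim(4) by (simp add: exp_minus exp_double inverse_eq_divide)
    finally show ?case by simp
  qed
  moreover have "summable (\<lambda>n. 1 / real n ^ 2)" using inverse_power_summable[of 2, where 'a=real] by (simp add: inverse_eq_divide)
  ultimately show ?thesis by (rule summable_comparison_test_ev)
qed

section \<open>Lipschitz approximation of closed sets of paths\<close>

definition capped_dist :: "(real^'d \<Rightarrow> real) \<Rightarrow> (real^'d \<Rightarrow> real) \<Rightarrow> real" where
  "capped_dist f g = (SUP t\<in>cbox 0 1. min 1 \<bar>f t - g t\<bar>)"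

definition capped_setdist :: "(real^'d \<Rightarrow> real) set \<Rightarrow> (real^'d \<Rightarrow> real) \<Rightarrow> real" where
  "capped_setdist F f = (INF g\<in>F. capped_dist f g)"

text \<open>A \<open>k\<close>-Lipschitz approximation of the indicator of a closed set. The cap at
  1 in \<open>capped_dist\<close> keeps all suprema real without touching small distances. The
  infimum over an empty set is unspecified, hence the assumption \<open>F \<noteq> {}\<close> in
  what follows.\<close>

definition soft_ind :: "nat \<Rightarrow> (real^'d \<Rightarrow> real) set \<Rightarrow> (real^'d \<Rightarrow> real) \<Rightarrow> real" where
  "soft_ind k F f = max 0 (1 - real k * capped_setdist F f)"

lemma zero_in_unit_cube: "(0::real^'d) \<in> cbox 0 1"
  by (simp add: mem_box_cart)

lemma bdd_capped: "bdd_above ((\<lambda>t. min 1 \<bar>f t - g t\<bar> :: real) ` A)"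
  by (rule bdd_aboveI2[of _ _ 1]) simp

lemma capped_dist_upper: "t \<in> cbox 0 1 \<Longrightarrow> min 1 \<bar>f t - g t\<bar> \<le> capped_dist f g"
  unfolding capped_dist_def by (intro cSUP_upper bdd_capped)

lemma capped_dist_least: "(\<And>t. t \<in> cbox 0 1 \<Longrightarrow> min 1 \<bar>f t - g t\<bar> \<le> b) \<Longrightarrow> capped_dist f g \<le> b"
  unfolding capped_dist_def using zero_in_unit_cube by (intro cSUP_least) blast+

lemma capped_dist_nonneg: "0 \<le> capped_dist f g"
  using capped_dist_upper[OF zero_in_unit_cube, of f g] by (rule order_trans[rotated]) simp

lemma capped_dist_self: "capped_dist f f = 0"
  by (intro antisym capped_dist_nonneg capped_dist_least) simp

lemma bdd_capped_dist: "bdd_below ((\<lambda>g. capped_dist f g) ` F)"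
  by (rule bdd_belowI2[of _ 0]) (rule capped_dist_nonneg)

lemma capped_setdist_lip1:
  assumes F: "F \<noteq> {}" and fg: "unif_close e f g"
  shows "capped_setdist F f \<le> capped_setdist F g + e"
proof -
  have "capped_setdist F f - e \<le> capped_setdist F g"
    unfolding capped_setdist_def[of F g]
  proof (rule cINF_greatest[OF F])
    fix h assume h: "h \<in> F"
    have "capped_setdist F f \<le> capped_dist f h"
      unfolding capped_setdist_def by (intro cINF_lower bdd_capped_dist h)
    also have "\<dots> \<le> capped_dist g h + e"
    proof (rule capped_dist_least)
      fix t :: "real^'a" assume t: "t \<in> cbox 0 1"
      have "min 1 \<bar>f t - h t\<bar> \<le> min 1 \<bar>g t - h t\<bar> + e" using fg t by fastforce
      with capped_dist_upper[OF t, of g h] show "min 1 \<bar>f t - h t\<bar> \<le> capped_dist g h + e" by linarith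
    qed
    finally show "capped_setdist F f - e \<le> capped_dist g h" by simp
  qed
  then show ?thesis by simp
qed

lemma soft_ind_lip:
  assumes F: "F \<noteq> {}" and fg: "unif_close e f g"
  shows "\<bar>soft_ind k F f - soft_ind k F g\<bar> \<le> real k * e"
proof -
  have "unif_close e g f" using fg by (simp add: abs_minus_commute)
  then have "\<bar>capped_setdist F f - capped_setdist F g\<bar> \<le> e"
    using capped_setdist_lip1[OF F fg] capped_setdist_lip1[OF F, of g f e] by linarith
  then have "\<bar>real k * capped_setdist F f - real k * capped_setdist F g\<bar> \<le> real k * e"
    by (simp add: right_diff_distrib[symmetric] abs_mult mult_left_mono)
  then show ?thesis unfolding soft_ind_def by linarith
qed

lemma capped_setdist_nonneg: "F \<noteq> {} \<Longrightarrow> 0 \<le> capped_setdist F f"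
  unfolding capped_setdist_def by (intro cINF_greatest capped_dist_nonneg)

lemma capped_setdist_mem: "f \<in> F \<Longrightarrow> capped_setdist F f = 0"
  using cINF_lower[OF bdd_capped_dist, of f F f] capped_setdist_nonneg[of F f]
  by (auto simp: capped_setdist_def capped_dist_self intro: antisym)

lemma soft_ind_bounds: "F \<noteq> {} \<Longrightarrow> 0 \<le> soft_ind k F f \<and> soft_ind k F f \<le> 1"
  using capped_setdist_nonneg[of F f] by (simp add: soft_ind_def)

lemma soft_ind_mem: "f \<in> F \<Longrightarrow> soft_ind k F f = 1"
  by (simp add: soft_ind_def capped_setdist_mem)

lemma soft_ind_tendsto:
  assumes F: "sup_closed F" "F \<noteq> {}"
  shows "(\<lambda>k. soft_ind k F f) \<longlonglongrightarrow> indicator F f"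
proof (cases "f \<in> F")
  case True
  then show ?thesis by (simp add: soft_ind_mem)
next
  case False
  then obtain e where e: "e > 0" "\<And>g. sup_dist f g < ereal e \<Longrightarrow> g \<notin> F"
    using F(1) unfolding sup_closed_def sup_open_def by auto
  have "min (1/2) (e / 2) \<le> capped_setdist F f"
    unfolding capped_setdist_def
  proof (rule cINF_greatest[OF F(2)], rule ccontr)
    fix g assume g: "g \<in> F" and "\<not> min (1/2) (e / 2) \<le> capped_dist f g"
    then have lt: "capped_dist f g < min (1/2) (e / 2)" by (simp only: not_le)
    have "sup_dist f g \<le> ereal (e / 2)"
      unfolding sup_dist_def
    proof (rule SUP_least)
      fix t :: "real^'a" assume t: "t \<in> cbox 0 1"
      have "min 1 \<bar>f t - g t\<bar> < min (1/2) (e / 2)" using capped_dist_upper[OF t, of f g] lt by linarith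
      then show "ereal \<bar>f t - g t\<bar> \<le> ereal (e / 2)" by (auto simp: min_def split: if_splits)
    qed
    also have "\<dots> < ereal e" using e by simp
    finally show False using e(2) g by blast
  qed
  then have pos: "0 < capped_setdist F f" using e by (smt (verit) half_gt_zero min_def zero_less_divide_1_iff)
  obtain k0 :: nat where k0: "1 / capped_setdist F f < real k0" using reals_Archimedean2 by blast
  have "\<forall>\<^sub>F k in sequentially. soft_ind k F f = 0"
    using eventually_ge_at_top[of k0]
  proof eventually_elim
    case (elim k)
    then have "1 / capped_setdist F f \<le> real k" using k0 by linarith
    then have "1 \<le> real k * capped_setdist F f" using pos by (simp add: field_simps)
    then show ?case by (simp add: soft_ind_def)
  qed
  then show ?thesis using False by (simp add: tendsto_eventually)
qed

lemma dfloor_uniform_approx: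
  fixes f :: "real^'d \<Rightarrow> real"
  assumes f: "continuous_on (cbox 0 (1::real^'d)) f" and e: "e > 0"
  shows "\<forall>\<^sub>F m in sequentially. \<forall>t\<in>cbox 0 1. \<bar>f (dfloor m t) - f t\<bar> \<le> e"
proof -
  have "uniformly_continuous_on (cbox 0 (1::real^'d)) f" by (rule compact_uniformly_continuous[OF f compact_cbox])
  then obtain d where d: "d > 0" "\<And>x y. x \<in> cbox 0 1 \<Longrightarrow> y \<in> cbox 0 1 \<Longrightarrow> dist y x < d \<Longrightarrow> dist (f y) (f x) < e"
    using e unfolding uniformly_continuous_on_def by metis
  have "(\<lambda>m. real CARD('d) * (1 / 2) ^ m) \<longlonglongrightarrow> 0" by (intro tendsto_mult_right_zero LIMSEQ_realpow_zero) auto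
  from order_tendstoD(2)[OF this d(1)] show ?thesis
  proof eventually_elim
    case (elim m)
    show ?case
    proof
      fix t :: "real^'d" assume t: "t \<in> cbox 0 1"
      have "norm (dfloor m t - t) \<le> (\<Sum>k\<in>UNIV. \<bar>(dfloor m t - t) $ k\<bar>)" by (rule norm_le_l1_cart)
      also have "\<dots> \<le> (\<Sum>k\<in>(UNIV::'d set). (1 / 2) ^ m)"
        using dfloor_le[of m t] dfloor_ge[of t _ m]
        by (intro sum_mono) (simp add: abs_if power_one_over field_simps, smt (verit))
      also have "\<dots> < d" using elim by simp
      finally have "dist (dfloor m t) t < d" by (simp add: dist_norm)
      then show "\<bar>f (dfloor m t) - f t\<bar> \<le> e"
        using d(2)[OF t, of "dfloor m t"] dfloor_in_grid[OF t, of m] dgrid_subset_cube[of m]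
        by (force simp: dist_real_def)
    qed
  qed
qed

text \<open>\<open>W\<close> is assumed measurable pointwise only, so measurability of the event is
  a conclusion: grid functionals depend on finitely many values, they converge by continuity of the
  paths, and soft indicators converge to the indicator.\<close>

lemma wiener_sheet_functional_limit:
  fixes W :: "'b \<Rightarrow> real^'d \<Rightarrow> real"
  assumes W: "wiener_sheet N W" and F: "sup_closed F" "F \<noteq> {}"
  shows "(\<lambda>m. \<integral>\<eta>. soft_ind k F (\<lambda>t. W \<eta> (dfloor m t)) \<partial>N) \<longlonglongrightarrow> (\<integral>\<eta>. soft_ind k F (W \<eta>) \<partial>N)" (is ?lim1)
    and "(\<lambda>k. \<integral>\<eta>. soft_ind k F (W \<eta>) \<partial>N) \<longlonglongrightarrow> measure N {\<eta>\<in>space N. W \<eta> \<in> F}" (is ?lim2)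
    and "{\<eta>\<in>space N. W \<eta> \<in> F} \<in> sets N" (is ?meas)
proof -
  interpret prob_space N using W by (simp add: wiener_sheet_def)
  have mW: "(\<lambda>\<eta>. W \<eta> t) \<in> borel_measurable N" if "t \<in> cbox 0 1" for t using W that by (simp add: wiener_sheet_def)
  have m1: "(\<lambda>\<eta>. soft_ind k F (\<lambda>t. W \<eta> (dfloor m t))) \<in> borel_measurable N" for k m
  proof (rule Lipschitz_rounding_measurable[where T = "dgrid m" and g = "\<lambda>x. soft_ind k F (\<lambda>t. x (dfloor m t))" and X = W and L = "real k"])
    show "finite (dgrid m :: (real^'d) set)" by (rule finite_dgrid)
    show "(\<lambda>\<eta>. W \<eta> t) \<in> borel_measurable N" if "t \<in> dgrid m" for t
      using mW that dgrid_subset_cube by blast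
  qed (intro soft_ind_lip F, use dfloor_in_grid in blast)
  have pt: "(\<lambda>m. soft_ind k F (\<lambda>t. W \<eta> (dfloor m t))) \<longlonglongrightarrow> soft_ind k F (W \<eta>)" if \<eta>: "\<eta> \<in> space N" for \<eta> k
  proof (rule tendstoI)
    fix e :: real assume e: "e > 0"
    define e' where "e' = e / (real k + 1)"
    have e': "e' > 0" "real k * e' < e" using e by (auto simp: e'_def field_simps)
    have "continuous_on (cbox 0 1) (W \<eta>)" using W \<eta> by (simp add: wiener_sheet_def)
    from dfloor_uniform_approx[OF this e'(1)]
    show "\<forall>\<^sub>F m in sequentially. dist (soft_ind k F (\<lambda>t. W \<eta> (dfloor m t))) (soft_ind k F (W \<eta>)) < e"
    proof eventually_elim
      case (elim m)
      from soft_ind_lip[OF F(2) elim, of k] e'(2) show ?case by (simp add: dist_real_def)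
    qed
  qed
  have m2[measurable]: "(\<lambda>\<eta>. soft_ind k F (W \<eta>)) \<in> borel_measurable N" for k
    by (rule borel_measurable_LIMSEQ_real[OF pt m1])
  have bnd: "AE \<eta> in N. norm (soft_ind k F (f \<eta>)) \<le> 1" for k and f :: "'b \<Rightarrow> real^'d \<Rightarrow> real"
    using soft_ind_bounds[OF F(2)] by (intro AE_I2) simp
  show ?lim1
    by (rule integral_dominated_convergence[where w = "\<lambda>_. 1", OF m2 m1 _ _ bnd]) (auto intro!: AE_I2 pt)
  have im: "(\<lambda>\<eta>. indicator F (W \<eta>) :: real) \<in> borel_measurable N"
    by (rule borel_measurable_LIMSEQ_real[OF soft_ind_tendsto[OF F] m2])
  then have "(\<lambda>\<eta>. indicator F (W \<eta>) :: real) -` {1} \<inter> space N \<in> sets N" by (rule measurable_sets) simp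
  also have "(\<lambda>\<eta>. indicator F (W \<eta>) :: real) -` {1} \<inter> space N = {\<eta>\<in>space N. W \<eta> \<in> F}" by (auto simp: indicator_def)
  finally show meas: ?meas .
  have "(\<lambda>k. \<integral>\<eta>. soft_ind k F (W \<eta>) \<partial>N) \<longlonglongrightarrow> (\<integral>\<eta>. indicator F (W \<eta>) \<partial>N)"
    by (rule integral_dominated_convergence[where w = "\<lambda>_. 1", OF im m2 _ _ bnd]) (auto intro!: AE_I2 soft_ind_tendsto F)
  also have "(\<integral>\<eta>. indicator F (W \<eta>) \<partial>N) = (\<integral>\<eta>. indicator {\<eta>\<in>space N. W \<eta> \<in> F} \<eta> \<partial>N)"
    by (intro Bochner_Integration.integral_cong) (auto simp: indicator_def)
  also have "\<dots> = measure N {\<eta>\<in>space N. W \<eta> \<in> F}" using meas by simp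
  finally show ?lim2 .
qed

section \<open>Almost sure behaviour of the windows\<close>

lemma abs_cos_diff_le: "\<bar>cos x - cos y\<bar> \<le> \<bar>x - y :: real\<bar>"
proof -
  have "\<bar>cos x - cos y\<bar> = 2 * \<bar>sin ((x + y) / 2)\<bar> * \<bar>sin ((y - x) / 2)\<bar>"
    by (simp add: cos_diff_cos abs_mult)
  also have "\<dots> \<le> 2 * 1 * \<bar>(y - x) / 2\<bar>"
    by (intro mult_mono abs_sin_x_le_abs_x) auto
  finally show ?thesis by (simp add: abs_minus_commute)
qed

lemma abs_sin_diff_le: "\<bar>sin x - sin y\<bar> \<le> \<bar>x - y :: real\<bar>"
proof -
  have "\<bar>sin x - sin y\<bar> = 2 * \<bar>sin ((x - y) / 2)\<bar> * \<bar>cos ((x + y) / 2)\<bar>"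
    by (simp add: sin_diff_sin abs_mult)
  also have "\<dots> \<le> 2 * \<bar>(x - y) / 2\<bar> * 1"
    by (intro mult_mono abs_sin_x_le_abs_x) auto
  finally show ?thesis by simp
qed

text \<open>Depth of the chain when \<open>x\<close> is the expected count \<open>n a_n^d\<close>:
  the last level at which the moment bound with parameter \<open>sqrt (2 ^ j)\<close> is available,
  and fine enough for the error in \<open>Delta_dist_dfloor\<close> to be of order
  \<open>1 / sqrt x\<close>.\<close>

definition dlevel :: "real \<Rightarrow> nat" where
  "dlevel x = nat \<lfloor>log 2 x\<rfloor>"

lemma dlevel:
  assumes "x \<ge> 1"
  shows "2 ^ dlevel x \<le> x" "x < 2 * 2 ^ dlevel x"
proof -
  have l: "0 \<le> log 2 x" using assms by simp
  then have "real (dlevel x) \<le> log 2 x" "log 2 x < real (dlevel x) + 1"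
    unfolding dlevel_def by linarith+
  then have "2 powr real (dlevel x) \<le> 2 powr log 2 x" "2 powr log 2 x < 2 powr (real (dlevel x) + 1)"
    by (simp_all del: powr_log_cancel)
  then show "2 ^ dlevel x \<le> x" "x < 2 * 2 ^ dlevel x"
    using assms by (simp_all add: powr_add powr_realpow)
qed

lemma filterlim_dlevel: "filterlim dlevel at_top at_top"
  unfolding filterlim_at_top
proof
  fix k :: nat
  show "\<forall>\<^sub>F x in at_top. k \<le> dlevel x"
    using eventually_ge_at_top[of "2 ^ k :: real"]
  proof eventually_elim
    case (elim x)
    then have "log 2 (2 ^ k) \<le> log 2 x" by (intro log_mono) (auto intro: order.strict_trans2[of 0 "2 ^ k"])
    then have "real k \<le> log 2 x" by (simp add: log_nat_power)
    then show ?case unfolding dlevel_def by linarith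
  qed
qed

definition chain_tail :: "real \<Rightarrow> nat \<Rightarrow> real" where
  "chain_tail d m = (\<Sum>i. chain_rate d (i + Suc m))"

lemma chain_tail_tendsto: "chain_tail d \<longlonglongrightarrow> 0"
proof (rule LIMSEQ_I)
  fix e :: real assume "e > 0"
  from suminf_exist_split[OF this summable_chain_rate, of d] obtain n0
    where n0: "\<And>n. n \<ge> n0 \<Longrightarrow> norm (\<Sum>i. chain_rate d (i + n)) < e" by blast
  have "norm (chain_tail d m - 0) < e" if "m \<ge> n0" for m
    using n0[of "Suc m"] that by (simp only: chain_tail_def diff_zero le_SucI)
  then show "\<exists>m0. \<forall>m\<ge>m0. norm (chain_tail d m - 0) < e" by blast
qed

locale local_sample = uniform_sample M U for M :: "'a measure" and U :: "nat \<Rightarrow> 'a \<Rightarrow> real^'d" +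
  fixes a :: "nat \<Rightarrow> real"
  assumes a01: "\<And>n. n \<ge> 1 \<Longrightarrow> 0 < a n \<and> a n \<le> 1" and a0: "a \<longlonglongrightarrow> 0"
    and mass_at_top: "filterlim (\<lambda>n. real n * a n ^ CARD('d)) at_top sequentially"
    and summ: "\<And>K. K > 0 \<Longrightarrow> summable (\<lambda>n. exp (- K / a n ^ CARD('d)))"
begin

abbreviation D :: "'a \<Rightarrow> nat \<Rightarrow> real^'d \<Rightarrow> real^'d \<Rightarrow> real" where
  "D w n u \<equiv> Delta (sample w) n u (a n)"

text \<open>The functional may vary with \<open>n\<close> because the depth of the oscillation
  functional does. All cubes are quantified inside, so that one null set serves them all.\<close>

definition window_le :: "'a \<Rightarrow> (nat \<Rightarrow> (real^'d \<Rightarrow> real) \<Rightarrow> real) \<Rightarrow> real \<Rightarrow> bool" where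
  "window_le w \<phi> b \<longleftrightarrow> (\<forall>c r \<delta>. r > 0 \<and> \<delta> > 0 \<and> cube c r \<subseteq> shrunk_cube \<delta> \<longrightarrow>
    (\<forall>e>0. eventually (\<lambda>n. (LINT u:cube c r|lborel. \<phi> n (D w n u)) \<le> b * r ^ CARD('d) + e) sequentially))"

definition window_tendsto :: "'a \<Rightarrow> ((real^'d \<Rightarrow> real) \<Rightarrow> real) \<Rightarrow> real \<Rightarrow> bool" where
  "window_tendsto w \<phi> b \<longleftrightarrow> window_le w (\<lambda>_. \<phi>) b \<and> window_le w (\<lambda>_ f. - \<phi> f) (- b)"

lemma AE_window_le:
  assumes L: "L > 0"
    and lip: "\<And>n f g e. unif_close e f g \<Longrightarrow> \<bar>\<phi> n f - \<phi> n g\<bar> \<le> L * e"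
    and bd: "\<And>n f. \<bar>\<phi> n f\<bar> \<le> 1"
    and meas: "\<And>n. (\<lambda>p. \<phi> n (Delta (fst p) n (snd p) (a n))) \<in> borel_measurable (window_space n)"
    and mean: "\<And>e \<delta>. e > 0 \<Longrightarrow> \<delta> > 0 \<Longrightarrow> eventually (\<lambda>n. \<forall>u\<in>shrunk_cube \<delta>.
        (\<integral>w. \<phi> n (D w n u) \<partial>M) \<le> b + e) sequentially"
  shows "AE w in M. window_le w \<phi> b"
  unfolding window_le_def
  using a01 by (intro AE_eventually_window_average[OF _ L summ lip bd meas mean]) auto

lemma Delta_pair_measurable[measurable]:
  "(\<lambda>p. Delta (fst p) n (snd p) b t) \<in> borel_measurable (window_space n :: (_ \<times> (real^'d)) measure)"
  by measurable

lemma D_measurable: "(\<lambda>u. D w n u t) \<in> borel_measurable borel"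
  by measurable

lemma eventually_bandwidth: "\<delta> > 0 \<Longrightarrow> \<forall>\<^sub>F n in sequentially. a n \<le> \<delta>"
  using order_tendstoD(2)[OF a0, of \<delta>] by (auto elim: eventually_mono)

lemma AE_window_trig:
  fixes T :: "(real^'d) set" and c :: "real^'d \<Rightarrow> real"
  assumes T: "finite T" "T \<subseteq> cbox 0 1"
  defines "v \<equiv> sheet_var T c"
  shows "AE w in M. window_tendsto w (\<lambda>f. cos (\<Sum>t\<in>T. c t * f t)) (exp (- v / 2))
     \<and> window_tendsto w (\<lambda>f. sin (\<Sum>t\<in>T. c t * f t)) 0"
proof -
  define L where "L = 1 + (\<Sum>t\<in>T. \<bar>c t\<bar>)"
  have L: "L > 0" unfolding L_def by (intro add_pos_nonneg sum_nonneg) auto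
  have lip: "\<bar>(\<Sum>t\<in>T. c t * f t) - (\<Sum>t\<in>T. c t * g t)\<bar> \<le> L * e"
    if fg: "unif_close e f g" for f g :: "real^'d \<Rightarrow> real" and e
  proof -
    have e: "e \<ge> 0" using fg zero_in_unit_cube by (meson abs_ge_zero order_trans)
    have "\<bar>(\<Sum>t\<in>T. c t * f t) - (\<Sum>t\<in>T. c t * g t)\<bar> = \<bar>\<Sum>t\<in>T. c t * (f t - g t)\<bar>"
      by (simp add: sum_subtractf right_diff_distrib)
    also have "\<dots> \<le> (\<Sum>t\<in>T. \<bar>c t\<bar> * e)"
      using fg T by (intro order_trans[OF sum_abs] sum_mono) (auto simp: abs_mult intro!: mult_left_mono)
    also have "\<dots> \<le> L * e" using e by (simp add: L_def sum_distrib_right[symmetric] distrib_right)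
    finally show ?thesis .
  qed
  have char: "\<forall>\<^sub>F n in sequentially. \<forall>u\<in>shrunk_cube \<delta>.
      cmod (expectation (\<lambda>w. iexp (\<Sum>t\<in>T. c t * D w n u t)) - exp (- v / 2)) \<le> e" if "e > 0" "\<delta> > 0" for e \<delta>
    unfolding v_def by (rule char_Delta_uniform_limit[OF T _ a0 mass_at_top that]) (rule a01)
  have mean: "\<forall>\<^sub>F n in sequentially. \<forall>u\<in>shrunk_cube \<delta>.
      \<bar>(\<integral>w. cos (\<Sum>t\<in>T. c t * D w n u t) \<partial>M) - exp (- v / 2)\<bar> \<le> e \<and> \<bar>\<integral>w. sin (\<Sum>t\<in>T. c t * D w n u t) \<partial>M\<bar> \<le> e"
    if "e > 0" "\<delta> > 0" for e \<delta>
    using char[OF that]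
  proof eventually_elim
    case (elim n)
    show ?case
    proof
      fix u :: "real^'d" assume u: "u \<in> shrunk_cube \<delta>"
      let ?X = "\<lambda>w. \<Sum>t\<in>T. c t * D w n u t"
      have int: "integrable M (\<lambda>w. iexp (?X w))"
        by (rule integrable_const_bound[where B = 1]) (auto, measurable)
      let ?E = "(\<integral>w. iexp (?X w) \<partial>M)"
      have re: "Re ?E = (\<integral>w. cos (?X w) \<partial>M)" and im: "Im ?E = (\<integral>w. sin (?X w) \<partial>M)"
        using integral_Re[OF int] integral_Im[OF int] by (simp_all add: Re_exp Im_exp)
      have "cmod (?E - exp (- v / 2)) \<le> e" using elim u by blast
      then have "\<bar>Re (?E - exp (- v / 2))\<bar> \<le> e" "\<bar>Im (?E - exp (- v / 2))\<bar> \<le> e"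
        using abs_Re_le_cmod abs_Im_le_cmod order_trans by blast+
      then show "\<bar>(\<integral>w. cos (?X w) \<partial>M) - exp (- v / 2)\<bar> \<le> e \<and> \<bar>\<integral>w. sin (?X w) \<partial>M\<bar> \<le> e"
        by (simp only: minus_complex.sel Re_complex_of_real Im_complex_of_real re im diff_zero)
    qed
  qed
  \<comment> \<open>One schema for plus and minus cosine and sine, all 1-Lipschitz and bounded by
    1.\<close>
  have trig: "AE w in M. window_le w (\<lambda>n f. h (\<Sum>t\<in>T. c t * f t)) b"
    if h: "\<And>x y. \<bar>h x - h y\<bar> \<le> \<bar>x - y\<bar>" "\<And>x. \<bar>h x\<bar> \<le> 1" and hm[measurable]: "h \<in> borel_measurable borel"
      and m: "\<And>n u e. \<bar>(\<integral>w. cos (\<Sum>t\<in>T. c t * D w n u t) \<partial>M) - exp (- v / 2)\<bar> \<le> e \<Longrightarrow> \<bar>\<integral>w. sin (\<Sum>t\<in>T. c t * D w n u t) \<partial>M\<bar> \<le> e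
        \<Longrightarrow> (\<integral>w. h (\<Sum>t\<in>T. c t * D w n u t) \<partial>M) \<le> b + e"
    for h :: "real \<Rightarrow> real" and b
  proof (rule AE_window_le[OF L])
    show "\<bar>h (\<Sum>t\<in>T. c t * f t) - h (\<Sum>t\<in>T. c t * g t)\<bar> \<le> L * e"
      if "unif_close e f g" for f g e
      using h(1) lip[OF that] by (rule order_trans)
    show "(\<lambda>p. h (\<Sum>t\<in>T. c t * Delta (fst p) n (snd p) (a n) t)) \<in> borel_measurable (window_space n)" for n
      by measurable
    show "\<forall>\<^sub>F n in sequentially. \<forall>u\<in>shrunk_cube \<delta>. (\<integral>w. h (\<Sum>t\<in>T. c t * D w n u t) \<partial>M) \<le> b + e"
      if "e > 0" "\<delta> > 0" for e \<delta>
      using mean[OF that] by eventually_elim (use m in blast)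
  qed (rule h(2))
  have nc: "\<bar>- cos x - - cos y\<bar> \<le> \<bar>x - y\<bar>" and ns: "\<bar>- sin x - - sin y\<bar> \<le> \<bar>x - y\<bar>" for x y :: real
    using abs_cos_diff_le[of x y] abs_sin_diff_le[of x y] by linarith+
  have "AE w in M. window_le w (\<lambda>n f. cos (\<Sum>t\<in>T. c t * f t)) (exp (- v / 2))"
    by (rule trig[OF abs_cos_diff_le]; (simp | linarith))
  moreover have "AE w in M. window_le w (\<lambda>n f. - cos (\<Sum>t\<in>T. c t * f t)) (- exp (- v / 2))"
    by (rule trig[OF nc]; ((simp; fail) | (simp, linarith)))
  moreover have "AE w in M. window_le w (\<lambda>n f. sin (\<Sum>t\<in>T. c t * f t)) 0"
    by (rule trig[OF abs_sin_diff_le]; (simp | linarith))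
  moreover have "AE w in M. window_le w (\<lambda>n f. - sin (\<Sum>t\<in>T. c t * f t)) 0"
    by (rule trig[OF ns]; ((simp; fail) | (simp, linarith)))
  ultimately show ?thesis unfolding window_tendsto_def by eventually_elim simp
qed

text \<open>The depth grows with \<open>n\<close>, but the Lipschitz constant 4 and the bound 1 are
  the same for all \<open>n\<close>. The \<open>chain_rate\<close> at the last level tends to 0,
  which leaves the tail beyond \<open>m\<close>.\<close>

lemma AE_window_osc:
  "AE w in M. window_le w (\<lambda>n f. min 1 (osc_bound m (dlevel (real n * a n ^ CARD('d))) f)) (chain_tail (real CARD('d)) m)"
proof (rule AE_window_le[where L = 4])
  fix n and f g :: "real^'d \<Rightarrow> real" and e
  assume "unif_close e f g"
  from osc_bound_lip[OF this, of m "dlevel (real n * a n ^ CARD('d))"]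
  show "\<bar>min 1 (osc_bound m (dlevel (real n * a n ^ CARD('d))) f) - min 1 (osc_bound m (dlevel (real n * a n ^ CARD('d))) g)\<bar> \<le> 4 * e" by linarith
next
  fix n and f :: "real^'d \<Rightarrow> real"
  show "\<bar>min 1 (osc_bound m (dlevel (real n * a n ^ CARD('d))) f)\<bar> \<le> 1" using osc_bound_nonneg[of m "dlevel (real n * a n ^ CARD('d))" f] by simp
next
  fix n
  show "(\<lambda>p. min 1 (osc_bound m (dlevel (real n * a n ^ CARD('d))) (Delta (fst p) n (snd p) (a n)))) \<in> borel_measurable (window_space n)"
    unfolding osc_bound_def max_incr_def using finite_chain_ends finite_grid_steps by measurable
next
  fix e \<delta> :: real assume e: "e > 0" and \<delta>: "\<delta> > 0"
  have lev: "filterlim (\<lambda>n. dlevel (real n * a n ^ CARD('d))) at_top sequentially"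
    by (rule filterlim_compose[OF filterlim_dlevel mass_at_top])
  have "(\<lambda>n. chain_rate (real CARD('d)) (dlevel (real n * a n ^ CARD('d)))) \<longlonglongrightarrow> 0"
    by (rule filterlim_compose[OF summable_LIMSEQ_zero[OF summable_chain_rate] lev])
  from order_tendstoD(2)[OF this e]
  have e1: "\<forall>\<^sub>F n in sequentially. chain_rate (real CARD('d)) (dlevel (real n * a n ^ CARD('d))) < e" .
  have e2: "\<forall>\<^sub>F n in sequentially. m \<le> dlevel (real n * a n ^ CARD('d))" "\<forall>\<^sub>F n in sequentially. 1 \<le> real n * a n ^ CARD('d)"
    using lev mass_at_top unfolding filterlim_at_top by blast+
  show "\<forall>\<^sub>F n in sequentially. \<forall>u\<in>shrunk_cube \<delta>.
     (\<integral>w. min 1 (osc_bound m (dlevel (real n * a n ^ CARD('d))) (D w n u)) \<partial>M) \<le> chain_tail (real CARD('d)) m + e"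
    using e1 e2 eventually_bandwidth[OF \<delta>] eventually_ge_at_top[of 1]
  proof eventually_elim
    case (elim n)
    show ?case
    proof
      fix u :: "real^'d" assume u: "u \<in> shrunk_cube \<delta>"
      have "(\<integral>w. min 1 (osc_bound m (dlevel (real n * a n ^ CARD('d))) (D w n u)) \<partial>M)
        \<le> chain_tail (real CARD('d)) m + chain_rate (real CARD('d)) (dlevel (real n * a n ^ CARD('d)))"
        unfolding chain_tail_def using a01[OF elim(5)] dlevel(1)[OF elim(3)] elim
        by (intro expectation_osc_bound_le[OF u]) auto
      with elim(1) show "(\<integral>w. min 1 (osc_bound m (dlevel (real n * a n ^ CARD('d))) (D w n u)) \<partial>M) \<le> chain_tail (real CARD('d)) m + e"
        by linarith
    qed
  qed
qed simp

text \<open>A Lipschitz substitute for the indicator of a large value at \<open>t\<close>, from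
  which Markov's inequality will recover tightness. The constant 4 bounds
  \<open>ln 2 + exp 1\<close>.\<close>

lemma AE_window_tight:
  assumes t: "t \<in> cbox 0 (1::real^'d)"
  shows "AE w in M. window_le w (\<lambda>n f. min 1 (\<bar>f t\<bar> / real (Suc l))) (4 / real (Suc l))"
proof (rule AE_window_le[where L = 1])
  fix f g :: "real^'d \<Rightarrow> real" and e
  assume "unif_close e f g"
  then have e: "\<bar>f t - g t\<bar> \<le> e" using t by blast
  have "\<bar>\<bar>f t\<bar> / real (Suc l) - \<bar>g t\<bar> / real (Suc l)\<bar> = \<bar>\<bar>f t\<bar> - \<bar>g t\<bar>\<bar> / real (Suc l)"
    by (simp add: diff_divide_distrib[symmetric] del: of_nat_Suc)
  also have "\<dots> \<le> \<bar>\<bar>f t\<bar> - \<bar>g t\<bar>\<bar> / 1" by (intro divide_left_mono) auto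
  also have "\<dots> \<le> e" unfolding div_by_1 using e by linarith
  finally show "\<bar>min 1 (\<bar>f t\<bar> / real (Suc l)) - min 1 (\<bar>g t\<bar> / real (Suc l))\<bar> \<le> 1 * e" by linarith
next
  fix n
  show "(\<lambda>p. min 1 (\<bar>Delta (fst p) n (snd p) (a n) t\<bar> / real (Suc l))) \<in> borel_measurable (window_space n)"
    by measurable
next
  fix e \<delta> :: real assume e: "e > 0" and \<delta>: "\<delta> > 0"
  have e2: "\<forall>\<^sub>F n in sequentially. 1 \<le> real n * a n ^ CARD('d)"
    using mass_at_top unfolding filterlim_at_top by blast
  show "\<forall>\<^sub>F n in sequentially. \<forall>u\<in>shrunk_cube \<delta>.
     (\<integral>w. min 1 (\<bar>D w n u t\<bar> / real (Suc l)) \<partial>M) \<le> 4 / real (Suc l) + e"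
    using e2 eventually_bandwidth[OF \<delta>] eventually_ge_at_top[of 1]
  proof eventually_elim
    case (elim n)
    note an = a01[OF elim(3)]
    show ?case
    proof
      fix u :: "real^'d" assume u: "u \<in> shrunk_cube \<delta>"
      have mgf: "expectation (\<lambda>w. exp (r * D w n u t)) \<le> exp 1" if "r\<^sup>2 = 1" "\<bar>r\<bar> \<le> 1" for r
        using mgf_Delta[OF u t _ elim(2) elim(3), of r] an elim(1) that by (simp add: order_trans[OF that(2)])
      \<comment> \<open>The maximal inequality with a one-point index set and \<open>s = 1\<close>
        bounds the first absolute moment.\<close>
      have M: "expectation (\<lambda>w. Max ((\<lambda>z. \<bar>D w n u t\<bar>) ` {()})) \<le> (ln (2 * real (card {()})) + exp 1) / 1"
        "integrable M (\<lambda>w. Max ((\<lambda>z. \<bar>D w n u t\<bar>) ` {()}))"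
        using mgf[of 1] mgf[of "-1"] Delta_bounded[OF t _ elim(3)] an
        by (intro expectation_Max_abs_le[where Y = "\<lambda>_ w. D w n u t"]; (measurable | auto))+
      have "ln 2 + exp 1 \<le> (4::real)" using ln_2_less_1 exp_le by linarith
      then have E: "expectation (\<lambda>w. \<bar>D w n u t\<bar>) \<le> 4" using M(1) by simp
      have "(\<integral>w. min 1 (\<bar>D w n u t\<bar> / real (Suc l)) \<partial>M) \<le> (\<integral>w. \<bar>D w n u t\<bar> / real (Suc l) \<partial>M)"
        using M(2) by (intro integral_mono') auto
      also have "\<dots> \<le> 4 / real (Suc l)" using E by (simp add: divide_right_mono del: of_nat_Suc)
      finally show "(\<integral>w. min 1 (\<bar>D w n u t\<bar> / real (Suc l)) \<partial>M) \<le> 4 / real (Suc l) + e" using e by linarith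
    qed
  qed
qed auto

end

section \<open>Integrals, outer and inner measure on a cube\<close>

lemma integral_uniform_cube:
  fixes c :: "real^'d" and f :: "real^'d \<Rightarrow> real"
  assumes r: "r > 0" and [measurable]: "f \<in> borel_measurable borel"
  shows "(\<integral>u. f u \<partial>uniform_measure lborel (cube c r)) = (LINT u:cube c r|lborel. f u) / r ^ CARD('d)"
proof -
  have "uniform_measure lborel (cube c r) = density lborel (\<lambda>u. ennreal (indicator (cube c r) u / r ^ CARD('d)))"
    unfolding uniform_measure_def using r divide_ennreal[of 1 "r ^ CARD('d)"]
    by (intro density_cong) (auto simp: emeasure_cube indicator_def)
  then have "(\<integral>u. f u \<partial>uniform_measure lborel (cube c r)) = (\<integral>u. (indicator (cube c r) u / r ^ CARD('d)) *\<^sub>R f u \<partial>lborel)"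
    using r by (simp add: integral_density indicator_def)
  also have "\<dots> = (\<integral>u. indicator (cube c r) u *\<^sub>R f u / r ^ CARD('d) \<partial>lborel)" by simp
  also have "\<dots> = (LINT u:cube c r|lborel. f u) / r ^ CARD('d)"
    unfolding set_lebesgue_integral_def by (rule integral_divide_zero)
  finally show ?thesis .
qed

lemma prob_space_uniform_cube:
  fixes c :: "real^'d"
  assumes "r > 0" shows "prob_space (uniform_measure lborel (cube c r))"
  using assms by (intro prob_space_uniform_measure) (auto simp: emeasure_cube)

text \<open>\<open>A\<close> may be non-measurable; the Borel set where \<open>f\<close> is at least
  1 covers it, and Markov's inequality bounds the measure of that set.\<close>

lemma outer_measure_cube_le:
  fixes c :: "real^'d" and f :: "real^'d \<Rightarrow> real"
  assumes r: "r > 0" and [measurable]: "f \<in> borel_measurable borel"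
    and f: "\<And>u. 0 \<le> f u" "\<And>u. f u \<le> B" and A: "A \<subseteq> cube c r" "\<And>u. u \<in> A \<Longrightarrow> 1 \<le> f u"
  shows "enn2real (outer_measure_of lebesgue A) / r ^ CARD('d) \<le> (\<integral>u. f u \<partial>uniform_measure lborel (cube c r))"
proof -
  interpret P: prob_space "uniform_measure lborel (cube c r)" by (rule prob_space_uniform_cube[OF r])
  define E where "E = {u\<in>cube c r. 1 \<le> f u}"
  have E[measurable]: "E \<in> sets borel" unfolding E_def by measurable
  have "outer_measure_of lebesgue A \<le> outer_measure_of lebesgue E"
    using A by (intro outer_measure_of_mono) (auto simp: E_def)
  also have "\<dots> = emeasure lborel E" by (simp add: outer_measure_of_eq)
  also have "\<dots> = ennreal (measure lborel E)"
  proof -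
    have "emeasure lborel E \<le> emeasure lborel (cube c r)" by (intro emeasure_mono) (auto simp: E_def)
    also have "\<dots> < \<top>" using r by (simp add: emeasure_cube)
    finally show ?thesis by (intro emeasure_eq_ennreal_measure) auto
  qed
  finally have "enn2real (outer_measure_of lebesgue A) \<le> measure lborel E"
    by (metis enn2real_ennreal enn2real_mono ennreal_less_top measure_nonneg)
  also have "measure lborel E = (LINT u:cube c r|lborel. indicator E u)"
  proof -
    have "(\<lambda>u. indicator (cube c r) u *\<^sub>R indicator E u) = (indicator E :: _ \<Rightarrow> real)"
      by (auto simp: E_def indicator_def)
    then show ?thesis by (simp add: set_lebesgue_integral_def)
  qed
  finally have "enn2real (outer_measure_of lebesgue A) / r ^ CARD('d) \<le> (LINT u:cube c r|lborel. indicator E u) / r ^ CARD('d)"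
    using r by (intro divide_right_mono) auto
  also have "\<dots> = (\<integral>u. indicator E u \<partial>uniform_measure lborel (cube c r))"
    by (rule integral_uniform_cube[OF r, symmetric]) measurable
  also have "\<dots> \<le> (\<integral>u. f u \<partial>uniform_measure lborel (cube c r))"
  proof (rule integral_mono')
    show "integrable (uniform_measure lborel (cube c r)) f"
      using f by (intro P.integrable_const_bound[where B = B]) (auto simp: abs_le_iff)
  qed (use f in \<open>auto simp: E_def indicator_def\<close>)
  finally show ?thesis .
qed

text \<open>A measurable cover \<open>E\<close> of \<open>A\<close> attains the outer measure, and
  \<open>I - E\<close> is a measurable subset of \<open>S\<close>.\<close>

lemma inner_measure_ge:
  assumes I: "I \<in> sets M" "emeasure M I < \<infinity>" and S: "S = I - A" "A \<subseteq> I"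
  shows "measure M I - enn2real (outer_measure_of M A) \<le> enn2real (inner_measure_of M S)"
proof -
  obtain E where E: "E \<in> sets M" "A \<subseteq> E" "outer_measure_of M A = emeasure M E"
    using outer_measure_of_attain[of A M] S I sets.sets_into_space by blast
  have outI: "outer_measure_of M A \<le> emeasure M I"
    using outer_measure_of_mono[OF S(2), of M] outer_measure_of_eq[OF I(1)] by simp
  then have fin: "emeasure M E < \<infinity>" using E(3) I(2) by (metis order.strict_trans1)
  have "emeasure M I \<le> emeasure M (I - E) + emeasure M E"
    using I(1) E(1) emeasure_subadditive[of "I - E" M E] emeasure_mono[of I "(I - E) \<union> E" M] by (auto intro: order_trans)
  also have "emeasure M (I - E) \<le> inner_measure_of M S"
    unfolding inner_measure_of_def using I(1) E S by (intro SUP_upper) auto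
  finally have le: "emeasure M I \<le> inner_measure_of M S + emeasure M E" by (simp add: add_right_mono)
  have "inner_measure_of M S \<le> emeasure M I"
    unfolding inner_measure_of_def using S I by (intro SUP_least emeasure_mono) auto
  then have fin2: "inner_measure_of M S < \<infinity>" using I(2) by (metis order.strict_trans1)
  have "measure M I \<le> enn2real (inner_measure_of M S + emeasure M E)"
    using le fin fin2 unfolding measure_def by (intro enn2real_mono) auto
  also have "\<dots> = enn2real (inner_measure_of M S) + enn2real (emeasure M E)"
    using fin fin2 by (intro enn2real_plus) auto
  finally show ?thesis using E(3) by simp
qed

section \<open>Deterministic consequences for a typical sample\<close>

context local_sample
begin

text \<open>A countable intersection of almost sure events that mentions no particular cube and no
  set of paths. Coefficient vectors are extensional so that there are countably many of
  them.\<close>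

definition typical :: "'a \<Rightarrow> bool" where
  "typical w \<longleftrightarrow>
    (\<forall>m. \<forall>c\<in>PiE (dgrid m) (\<lambda>_. \<rat>).
       let v = sheet_var (dgrid m) c in
       window_tendsto w (\<lambda>f. cos (\<Sum>t\<in>dgrid m. c t * f t)) (exp (- v / 2))
     \<and> window_tendsto w (\<lambda>f. sin (\<Sum>t\<in>dgrid m. c t * f t)) 0) \<and>
    (\<forall>m. window_le w (\<lambda>n f. min 1 (osc_bound m (dlevel (real n * a n ^ CARD('d))) f)) (chain_tail (real CARD('d)) m)) \<and>
    (\<forall>m. \<forall>t\<in>dgrid m. \<forall>l. window_le w (\<lambda>n f. min 1 (\<bar>f t\<bar> / real (Suc l))) (4 / real (Suc l)))"

lemma AE_typical: "AE w in M. typical w"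
proof -
  have grid: "finite (dgrid m)" "dgrid m \<subseteq> cbox 0 (1::real^'d)" for m
    by (rule finite_dgrid dgrid_subset_cube)+
  have "countable (PiE (dgrid m :: (real^'d) set) (\<lambda>_. \<rat> :: real set))" for m
    using grid by (intro countable_PiE countable_rat) auto
  then show ?thesis
    unfolding typical_def Let_def
    using AE_window_trig[OF grid] AE_window_osc AE_window_tight grid(2)
    by (intro AE_conjI; simp only: AE_all_countable AE_ball_countable countable_finite[OF grid(1)]; blast)
qed

context
  fixes w c r \<delta>
  assumes tw: "typical w" and r: "r > 0" and \<delta>: "\<delta> > 0" and sub: "cube c r \<subseteq> (shrunk_cube \<delta> :: (real^'d) set)"
begin

abbreviation P :: "(real^'d) measure" where "P \<equiv> uniform_measure lborel (cube c r)"

lemma prob_space_P: "prob_space P"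
  by (rule prob_space_uniform_cube[OF r])

lemma integral_P_le:
  assumes "window_le w \<phi> b" and "e > 0"
    and "\<And>n. (\<lambda>u. \<phi> n (D w n u)) \<in> borel_measurable borel"
  shows "\<forall>\<^sub>F n in sequentially. (\<integral>u. \<phi> n (D w n u) \<partial>P) \<le> b + e"
proof -
  have rd: "r ^ CARD('d) > 0" using r by simp
  have "\<forall>\<^sub>F n in sequentially. (LINT u:cube c r|lborel. \<phi> n (D w n u)) \<le> b * r ^ CARD('d) + e * r ^ CARD('d)"
    using assms(1) r \<delta> sub mult_pos_pos[OF \<open>e > 0\<close> rd] unfolding window_le_def by blast
  then show ?thesis
    by eventually_elim (use rd in \<open>simp add: integral_uniform_cube[OF r assms(3)] divide_le_eq distrib_right\<close>)
qed

lemma integral_P_tendsto: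
  assumes \<phi>: "window_tendsto w \<phi> b" and m: "\<And>n. (\<lambda>u. \<phi> (D w n u)) \<in> borel_measurable borel"
  shows "(\<lambda>n. \<integral>u. \<phi> (D w n u) \<partial>P) \<longlonglongrightarrow> b"
proof (rule tendstoI)
  fix e :: real assume "e > 0"
  then have e: "e / 2 > 0" by simp
  have "\<forall>\<^sub>F n in sequentially. (\<integral>u. \<phi> (D w n u) \<partial>P) \<le> b + e / 2"
    "\<forall>\<^sub>F n in sequentially. (\<integral>u. - \<phi> (D w n u) \<partial>P) \<le> - b + e / 2"
    using integral_P_le[OF _ e m] integral_P_le[OF _ e borel_measurable_uminus[OF m]] \<phi>
    unfolding window_tendsto_def by blast+
  then show "\<forall>\<^sub>F n in sequentially. dist (\<integral>u. \<phi> (D w n u) \<partial>P) b < e"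
    by eventually_elim (use \<open>e > 0\<close> in \<open>simp add: dist_real_def abs_if\<close>)
qed

text \<open>The sample \<open>w\<close> is fixed; the probability space is the cube with normalised
  Lebesgue measure and the random variable is the corner. Convergence of characteristic functions
  and tightness are those recorded in \<open>typical\<close>.\<close>

lemma integral_P_grid_functional_tendsto:
  fixes g :: "(real^'d \<Rightarrow> real) \<Rightarrow> real" and W :: "'b \<Rightarrow> real^'d \<Rightarrow> real"
  assumes W: "wiener_sheet N W"
    and lip: "\<And>x y e. (\<forall>t\<in>dgrid m. \<bar>x t - y t\<bar> \<le> e) \<Longrightarrow> \<bar>g x - g y\<bar> \<le> L * e"
    and bd: "\<And>x. \<bar>g x\<bar> \<le> B"
  shows "(\<lambda>n. \<integral>u. g (D w n u) \<partial>P) \<longlonglongrightarrow> (\<integral>\<eta>. g (W \<eta>) \<partial>N)"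
proof (rule weak_convergence_of_char[OF finite_dgrid prob_space_P _ _ _ _ _ lip bd])
  let ?T = "dgrid m :: (real^'d) set"
  show "prob_space N" using W by (simp add: wiener_sheet_def)
  show "(\<lambda>u. D w n u t) \<in> borel_measurable P" for n t by (simp add: D_measurable)
  show "(\<lambda>\<eta>. W \<eta> t) \<in> borel_measurable N" if "t \<in> ?T" for t
    using W that dgrid_subset_cube unfolding wiener_sheet_def by blast
  fix c' :: "real^'d \<Rightarrow> real" assume c': "\<And>t. t \<in> ?T \<Longrightarrow> c' t \<in> \<rat>"
  \<comment> \<open>\<open>typical\<close> ranges over extensional coefficients, so
    \<open>c'\<close> is cut off outside the grid; the sums do not change.\<close>
  define k where "k = restrict c' ?T"
  have k: "k \<in> PiE ?T (\<lambda>_. \<rat>)" using c' by (auto simp: k_def)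
  have ksum: "(\<Sum>t\<in>?T. c' t * x t) = (\<Sum>t\<in>?T. k t * x t)" for x by (simp add: k_def)
  define v where "v = (sheet_var ?T k)"
  interpret PP: prob_space P by (rule prob_space_P)
  note [measurable] = D_measurable
  have cs: "(\<lambda>n. \<integral>u. cos (\<Sum>t\<in>?T. k t * D w n u t) \<partial>P) \<longlonglongrightarrow> exp (- v / 2)"
    "(\<lambda>n. \<integral>u. sin (\<Sum>t\<in>?T. k t * D w n u t) \<partial>P) \<longlonglongrightarrow> 0"
    using tw k unfolding typical_def Let_def v_def
    by (intro integral_P_tendsto; (measurable | simp))+
  have "(\<lambda>n. Complex (\<integral>u. cos (\<Sum>t\<in>?T. k t * D w n u t) \<partial>P) (\<integral>u. sin (\<Sum>t\<in>?T. k t * D w n u t) \<partial>P)) \<longlonglongrightarrow> Complex (exp (- v / 2)) 0"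
    by (intro tendsto_Complex cs)
  also have "(\<lambda>n. Complex (\<integral>u. cos (\<Sum>t\<in>?T. k t * D w n u t) \<partial>P) (\<integral>u. sin (\<Sum>t\<in>?T. k t * D w n u t) \<partial>P))
      = (\<lambda>n. \<integral>u. iexp (\<Sum>t\<in>?T. k t * D w n u t) \<partial>P)"
  proof
    fix n
    have int: "integrable P (\<lambda>u. iexp (\<Sum>t\<in>?T. k t * D w n u t))"
      by (rule PP.integrable_const_bound[where B = 1]) (auto, measurable)
    show "Complex (\<integral>u. cos (\<Sum>t\<in>?T. k t * D w n u t) \<partial>P) (\<integral>u. sin (\<Sum>t\<in>?T. k t * D w n u t) \<partial>P) = (\<integral>u. iexp (\<Sum>t\<in>?T. k t * D w n u t) \<partial>P)"
      using integral_Re[OF int] integral_Im[OF int] by (simp add: complex_eq_iff Re_exp Im_exp)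
  qed
  also have "Complex (exp (- v / 2)) 0 = (\<integral>\<eta>. iexp (\<Sum>t\<in>?T. k t * W \<eta> t) \<partial>N)"
    unfolding wiener_sheet_char[OF W finite_dgrid dgrid_subset_cube] v_def
    by (simp add: complex_eq_iff)
  finally show "(\<lambda>n. \<integral>u. iexp (\<Sum>t\<in>?T. c' t * D w n u t) \<partial>P) \<longlonglongrightarrow> (\<integral>\<eta>. iexp (\<Sum>t\<in>?T. c' t * W \<eta> t) \<partial>N)"
    unfolding ksum .
next
  fix t and e :: real assume t: "t \<in> (dgrid m :: (real^'d) set)" and e: "e > 0"
  interpret PP: prob_space P by (rule prob_space_P)
  note [measurable] = D_measurable
  \<comment> \<open>Half of \<open>e\<close> goes to the limit \<open>4 / real (Suc l)\<close>, half
    to the error of the average.\<close>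
  obtain l :: nat where "8 / e < real l" using reals_Archimedean2 by blast
  then have l: "4 / real (Suc l) < e / 2" using e by (simp add: field_simps)
  have "\<forall>\<^sub>F n in sequentially. (\<integral>u. min 1 (\<bar>D w n u t\<bar> / real (Suc l)) \<partial>P) \<le> 4 / real (Suc l) + e / 2"
    using tw t e unfolding typical_def by (intro integral_P_le) auto
  then have "\<forall>\<^sub>F n in sequentially. measure P {u\<in>space P. real (Suc l) < \<bar>D w n u t\<bar>} \<le> e"
  proof eventually_elim
    case (elim n)
    have "measure P {u\<in>space P. real (Suc l) < \<bar>D w n u t\<bar>} = (\<integral>u. indicator {u\<in>space P. real (Suc l) < \<bar>D w n u t\<bar>} u \<partial>P)"
      by simp
    also have "\<dots> \<le> (\<integral>u. min 1 (\<bar>D w n u t\<bar> / real (Suc l)) \<partial>P)"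
    proof (rule integral_mono')
      show "integrable P (\<lambda>u. min 1 (\<bar>D w n u t\<bar> / real (Suc l)))"
        by (rule PP.integrable_const_bound[where B = 1]) auto
    qed (auto simp: indicator_def)
    finally show ?case using elim l by linarith
  qed
  then show "\<exists>K. \<forall>\<^sub>F n in sequentially. measure P {u\<in>space P. K < \<bar>D w n u t\<bar>} \<le> e" by blast
qed

text \<open>The indicator of the event is dominated by \<open>?f\<close>. If the capped oscillation
  is 1, the term \<open>real k * osc n u\<close> is already at least 1. Otherwise the path is within
  \<open>osc n u + h\<close> of its discretisation, and the soft indicator, equal to 1 at the path,
  drops by at most \<open>real k * osc n u + e / 5\<close>. The parameters are chosen in the order
  \<open>k\<close>, \<open>h\<close>, \<open>m\<close>, \<open>n\<close>.\<close>

lemma outer_measure_limsup: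
  fixes W :: "'b \<Rightarrow> real^'d \<Rightarrow> real"
  assumes W: "wiener_sheet N W" and F: "sup_closed F" and e: "e > 0"
  shows "\<forall>\<^sub>F n in sequentially. enn2real (outer_measure_of lebesgue {u \<in> cube c r. D w n u \<in> F}) / r ^ CARD('d)
    \<le> measure N {\<eta> \<in> space N. W \<eta> \<in> F} + e"
proof (cases "F = {}")
  case True
  then show ?thesis using e by (simp add: outer_measure_of_eq)
next
  case False
  note F = F False
  interpret PP: prob_space P by (rule prob_space_P)
  let ?p = "measure N {\<eta> \<in> space N. W \<eta> \<in> F}" and ?d = "real CARD('d)"
  let ?N = "\<lambda>n. real n * a n ^ CARD('d)"
  let ?H = "\<lambda>k m f. soft_ind k F (\<lambda>t. f (dfloor m t))"
  have "\<forall>\<^sub>F k in sequentially. (\<integral>\<eta>. soft_ind k F (W \<eta>) \<partial>N) < ?p + e / 5"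
    using e by (intro order_tendstoD(2)[OF wiener_sheet_functional_limit(2)[OF W F]]) simp
  from eventually_happens'[OF sequentially_bot eventually_conj[OF this eventually_ge_at_top[of 1]]]
  obtain k where k: "(\<integral>\<eta>. soft_ind k F (W \<eta>) \<partial>N) < ?p + e / 5" "k \<ge> 1" by blast
  \<comment> \<open>Budget in fifths of \<open>e\<close>: one for the mean of the discretised soft
    indicator, a strict bound handed on from \<open>k\<close> to \<open>m\<close> to
    \<open>n\<close> at no further cost; two for \<open>real k * (h + h)\<close>, the chain tail and
    its error; one for the constant in \<open>?f\<close>.\<close>
  define h where "h = e / (5 * real k)"
  have h: "h > 0" "real k * h = e / 5" using e k(2) by (auto simp: h_def)
  have ev1: "\<forall>\<^sub>F m in sequentially. (\<integral>\<eta>. ?H k m (W \<eta>) \<partial>N) < ?p + e / 5"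
    using k(1) by (rule order_tendstoD(2)[OF wiener_sheet_functional_limit(1)[OF W F]])
  have ev2: "\<forall>\<^sub>F m in sequentially. chain_tail ?d m < h"
    by (rule order_tendstoD(2)[OF chain_tail_tendsto h(1)])
  from eventually_happens'[OF sequentially_bot eventually_conj[OF ev1 ev2]]
  obtain m where m: "(\<integral>\<eta>. ?H k m (W \<eta>) \<partial>N) < ?p + e / 5" "chain_tail ?d m < h" by blast
  have lip: "\<bar>?H k m x - ?H k m y\<bar> \<le> real k * e'" if "\<forall>t\<in>dgrid m. \<bar>x t - y t\<bar> \<le> e'" for x y e'
    using that dfloor_in_grid by (intro soft_ind_lip F) blast
  have "\<forall>\<^sub>F n in sequentially. (\<integral>u. ?H k m (D w n u) \<partial>P) < ?p + e / 5"
  proof (rule order_tendstoD(2)[OF integral_P_grid_functional_tendsto[OF W, where m = m] m(1)])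
    show "\<bar>?H k m x\<bar> \<le> 1" for x using soft_ind_bounds[OF F(2)] by (simp add: abs_le_iff)
  qed (rule lip)
  moreover
  define osc where "osc n u = min 1 (osc_bound m (dlevel (?N n)) (D w n u))" for n u
  have oscm[measurable]: "osc n \<in> borel_measurable borel" for n
    unfolding osc_def osc_bound_def max_incr_def using finite_chain_ends finite_grid_steps D_measurable by measurable
  have "\<forall>\<^sub>F n in sequentially. (\<integral>u. osc n u \<partial>P) \<le> chain_tail ?d m + h"
    unfolding osc_def
  proof (rule integral_P_le[where \<phi> = "\<lambda>n f. min 1 (osc_bound m (dlevel (?N n)) f)", OF _ h(1)])
    show "(\<lambda>u. min 1 (osc_bound m (dlevel (?N n)) (D w n u))) \<in> borel_measurable borel" for n
      using oscm[of n] by (simp add: osc_def[abs_def])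
  qed (use tw in \<open>simp add: typical_def\<close>)
  moreover
  have Nge: "\<forall>\<^sub>F n in sequentially. 1 \<le> ?N n" using mass_at_top by (simp add: filterlim_at_top)
  have "(\<lambda>n. 2 * ?d / sqrt (?N n)) \<longlonglongrightarrow> 0"
    by (rule real_tendsto_divide_at_top[OF tendsto_const filterlim_compose[OF sqrt_at_top mass_at_top]])
  from order_tendstoD(2)[OF this h(1)] have "\<forall>\<^sub>F n in sequentially. 2 * ?d / sqrt (?N n) < h" .
  ultimately show ?thesis using Nge eventually_ge_at_top[of 1]
  proof eventually_elim
    case (elim n)
    note an = a01[OF elim(5)]
    have Hm[measurable]: "(\<lambda>u. ?H k m (D w n u)) \<in> borel_measurable borel"
      by (rule Lipschitz_rounding_measurable[OF finite_dgrid D_measurable lip])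
    \<comment> \<open>\<open>2 ^ dlevel (?N n)\<close> exceeds half of \<open>?N n\<close>, so the
      left side is at most \<open>2 * ?d / sqrt (?N n)\<close>.\<close>
    have err: "sqrt (?N n) * ?d / 2 ^ dlevel (?N n) < h"
    proof -
      have "?N n / (2 * 2 ^ dlevel (?N n)) \<le> 1"
        using dlevel(2)[OF elim(4)] by simp
      then have "sqrt (?N n) * (sqrt (?N n) / (2 * 2 ^ dlevel (?N n))) \<le> 1"
        using elim(4) by simp
      then have "sqrt (?N n) / (2 * 2 ^ dlevel (?N n)) \<le> 1 / sqrt (?N n)"
        using elim(4) by (simp add: le_divide_eq mult.commute)
      then have "2 * ?d * (sqrt (?N n) / (2 * 2 ^ dlevel (?N n))) \<le> 2 * ?d * (1 / sqrt (?N n))"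
        by (intro mult_left_mono) auto
      with elim(3) show ?thesis by (simp add: mult.commute)
    qed
    let ?f = "\<lambda>u. ?H k m (D w n u) + real k * osc n u + e / 5"
    have osc01: "0 \<le> osc n u" "osc n u \<le> 1" for u using osc_bound_nonneg by (auto simp: osc_def)
    have "enn2real (outer_measure_of lebesgue {u \<in> cube c r. D w n u \<in> F}) / r ^ CARD('d) \<le> (\<integral>u. ?f u \<partial>P)"
    proof (rule outer_measure_cube_le[OF r, where B = "1 + real k + e / 5"])
      show "?f \<in> borel_measurable borel" by measurable
      show "0 \<le> ?f u" for u using soft_ind_bounds[OF F(2)] osc01[of u] e by simp
      show "?f u \<le> 1 + real k + e / 5" for u
        using soft_ind_bounds[OF F(2), of k "\<lambda>t. D w n u (dfloor m t)"] mult_left_mono[OF osc01(2)[of u], of "real k"] by simp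
      fix u assume u: "u \<in> {u \<in> cube c r. D w n u \<in> F}"
      show "1 \<le> ?f u"
      proof (cases "osc_bound m (dlevel (?N n)) (D w n u) \<ge> 1")
        case True
        then have "osc n u = 1" by (simp add: osc_def)
        then show ?thesis using soft_ind_bounds[OF F(2), of k "\<lambda>t. D w n u (dfloor m t)"] k(2) e by simp
      next
        case False
        have "\<forall>t\<in>cbox 0 1. \<bar>D w n u t - D w n u (dfloor m t)\<bar> \<le> osc n u + h"
        proof
          fix t :: "real^'d" assume t: "t \<in> cbox 0 1"
          show "\<bar>D w n u t - D w n u (dfloor m t)\<bar> \<le> osc n u + h"
            using Delta_dist_dfloor[OF t _ elim(5), of "a n" "sample w" u m "dlevel (?N n)"] an err False
            by (simp add: osc_def)
        qed
        from soft_ind_lip[OF F(2) this, of k]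
        have "\<bar>soft_ind k F (D w n u) - ?H k m (D w n u)\<bar> \<le> real k * osc n u + e / 5"
          by (simp add: distrib_left h(2))
        moreover have "soft_ind k F (D w n u) = 1" using u by (simp add: soft_ind_mem)
        ultimately show ?thesis by linarith
      qed
    qed auto
    also have "(\<integral>u. ?f u \<partial>P) = (\<integral>u. ?H k m (D w n u) \<partial>P) + real k * (\<integral>u. osc n u \<partial>P) + e / 5"
    proof -
      have i1: "integrable P (\<lambda>u. ?H k m (D w n u))"
        using soft_ind_bounds[OF F(2)] by (intro PP.integrable_const_bound[where B = 1]) auto
      have i2: "integrable P (osc n)"
        using osc01 by (intro PP.integrable_const_bound[where B = 1]) auto
      show ?thesis using i1 i2 PP.prob_space by simp
    qed
    also have "\<dots> \<le> (?p + e / 5) + real k * (h + h) + e / 5"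
      using elim(1,2) m(2) by (intro add_mono mult_left_mono) auto
    also have "\<dots> \<le> ?p + e" unfolding distrib_left h(2) using e by simp
    finally show ?case .
  qed
qed

text \<open>Obtained from \<open>outer_measure_limsup\<close> for \<open>- G\<close> by taking
  complements, within the cube and on the Wiener side.\<close>

lemma inner_measure_liminf:
  fixes W :: "'b \<Rightarrow> real^'d \<Rightarrow> real"
  assumes W: "wiener_sheet N W" and G: "sup_open G" and e: "e > 0"
  shows "\<forall>\<^sub>F n in sequentially. measure N {\<eta> \<in> space N. W \<eta> \<in> G} - e
    \<le> enn2real (inner_measure_of lebesgue {u \<in> cube c r. D w n u \<in> G}) / r ^ CARD('d)"
proof -
  let ?p = "\<lambda>G. measure N {\<eta> \<in> space N. W \<eta> \<in> G}"
  interpret N: prob_space N using W by (simp add: wiener_sheet_def)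
  have closed: "sup_closed (- G)" using G by (simp add: sup_closed_def)
  have "?p G = 1 - ?p (- G)"
  \<comment> \<open>Measurability of the Wiener event comes from soft indicators and hence needs a
    nonempty closed set.\<close>
  proof (cases "- G = {}")
    case True
    then have "G = UNIV" by blast
    then show ?thesis by (simp add: N.prob_space)
  next
    case False
    have "{\<eta> \<in> space N. W \<eta> \<in> G} = space N - {\<eta> \<in> space N. W \<eta> \<in> - G}" by auto
    then show ?thesis using N.prob_compl[OF wiener_sheet_functional_limit(3)[OF W closed False]] by simp
  qed
  moreover have "\<forall>\<^sub>F n in sequentially. enn2real (outer_measure_of lebesgue {u \<in> cube c r. D w n u \<in> - G}) / r ^ CARD('d)
    \<le> ?p (- G) + e" by (rule outer_measure_limsup[OF W closed e])
  ultimately show ?thesis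
  proof (elim eventually_mono)
    fix n
    let ?A = "{u \<in> cube c r. D w n u \<in> - G}" and ?S = "{u \<in> cube c r. D w n u \<in> G}"
    assume p: "?p G = 1 - ?p (- G)"
      and le: "enn2real (outer_measure_of lebesgue ?A) / r ^ CARD('d) \<le> ?p (- G) + e"
    have "measure lebesgue (cube c r) - enn2real (outer_measure_of lebesgue ?A) \<le> enn2real (inner_measure_of lebesgue ?S)"
      using r by (intro inner_measure_ge) (auto simp: emeasure_cube)
    then have "r ^ CARD('d) - enn2real (outer_measure_of lebesgue ?A) \<le> enn2real (inner_measure_of lebesgue ?S)"
      using r by (simp add: measure_cube)
    then have "(r ^ CARD('d) - enn2real (outer_measure_of lebesgue ?A)) / r ^ CARD('d) \<le> enn2real (inner_measure_of lebesgue ?S) / r ^ CARD('d)"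
      using r by (intro divide_right_mono) auto
    then show "?p G - e \<le> enn2real (inner_measure_of lebesgue ?S) / r ^ CARD('d)"
      using p le r by (simp add: diff_divide_distrib)
  qed
qed

end

end

lemma limsup_ereal_le:
  assumes "\<And>e. e > 0 \<Longrightarrow> \<forall>\<^sub>F n in sequentially. f n \<le> b + e"
  shows "limsup (\<lambda>n. ereal (f n)) \<le> ereal b"
proof (rule ereal_le_epsilon2)
  fix e :: real assume "e > 0"
  from assms[OF this] show "limsup (\<lambda>n. ereal (f n)) \<le> ereal b + ereal e"
    by (intro Limsup_bounded) (auto elim: eventually_mono)
qed

lemma liminf_ereal_ge:
  assumes "\<And>e. e > 0 \<Longrightarrow> \<forall>\<^sub>F n in sequentially. b - e \<le> f n"
  shows "ereal b \<le> liminf (\<lambda>n. ereal (f n))"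
proof (rule ereal_le_epsilon2)
  fix e :: real assume "e > 0"
  from assms[OF this] have "ereal (b - e) \<le> liminf (\<lambda>n. ereal (f n))"
    by (intro Liminf_bounded) (auto elim: eventually_mono)
  then have "ereal (b - e) + ereal e \<le> liminf (\<lambda>n. ereal (f n)) + ereal e" by (rule add_right_mono)
  then show "ereal b \<le> liminf (\<lambda>n. ereal (f n)) + ereal e" by simp
qed

theorem theorem1:
  fixes M :: "'a measure" and U :: "nat \<Rightarrow> 'a \<Rightarrow> real^'d" and a :: "nat \<Rightarrow> real"
    and N :: "'b measure" and W :: "'b \<Rightarrow> real^'d \<Rightarrow> real"
  assumes "prob_space M"
    and "prob_space.indep_vars M (\<lambda>_. borel) U {1..}"
    and "\<And>i. i \<ge> 1 \<Longrightarrow> distr M borel (U i) = uniform_measure lborel (cbox 0 1)"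
    and "\<And>n. n \<ge> 1 \<Longrightarrow> 0 < a n \<and> a n \<le> 1"
    and "\<And>n. n \<ge> 1 \<Longrightarrow> a (Suc n) \<le> a n"
    and "a \<longlonglongrightarrow> 0"
    and "\<And>n. n \<ge> 1 \<Longrightarrow> real n * a n ^ CARD('d) \<le> real (Suc n) * a (Suc n) ^ CARD('d)"
    and "filterlim (\<lambda>n. real n * a n ^ CARD('d)) at_top sequentially"
    and "liminf (\<lambda>n. ereal (ln (1 / a n) / ln (ln (real n)))) > 1"
    and "wiener_sheet N W"
  shows "AE \<omega> in M. \<forall>c r \<delta>. r > 0 \<and> \<delta> > 0 \<and>
           cbox c (c + r *\<^sub>R 1) \<subseteq> cbox 0 ((1 - \<delta>) *\<^sub>R 1) \<longrightarrow>
      (\<forall>F. sup_closed F \<longrightarrow>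
         limsup (\<lambda>n. ereal (enn2real (outer_measure_of lebesgue
              {u \<in> cbox c (c + r *\<^sub>R 1). Delta (\<lambda>i. U i \<omega>) n u (a n) \<in> F})
            / measure lebesgue (cbox c (c + r *\<^sub>R 1))))
         \<le> ereal (measure N {\<eta> \<in> space N. W \<eta> \<in> F})) \<and>
      (\<forall>G. sup_open G \<longrightarrow>
         liminf (\<lambda>n. ereal (enn2real (inner_measure_of lebesgue
              {u \<in> cbox c (c + r *\<^sub>R 1). Delta (\<lambda>i. U i \<omega>) n u (a n) \<in> G})
            / measure lebesgue (cbox c (c + r *\<^sub>R 1))))
         \<ge> ereal (measure N {\<eta> \<in> space N. W \<eta> \<in> G}))"
proof -
  interpret prob_space M by fact
  have card: "CARD('d) \<ge> 1" by (simp add: Suc_leI)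
  interpret local_sample M U a
    by standard (use assms summable_exp_bandwidth[OF assms(4) card assms(9)] in auto)
  show ?thesis
    \<comment> \<open>The event mentions neither the cube nor the set of paths, so all quantifiers
      of the conclusion are introduced after the sample is fixed.\<close>
    using AE_typical
  proof eventually_elim
    case (elim w)
    show ?case
    proof (intro allI impI, elim conjE)
      fix c :: "real^'d" and r \<delta> :: real
      assume r: "r > 0" and \<delta>: "\<delta> > 0" and sub: "cbox c (c + r *\<^sub>R 1) \<subseteq> cbox 0 ((1 - \<delta>) *\<^sub>R 1)"
      have m: "measure lebesgue (cbox c (c + r *\<^sub>R 1)) = r ^ CARD('d)" using r by (simp add: measure_cube)
      show "(\<forall>F. sup_closed F \<longrightarrow>
         limsup (\<lambda>n. ereal (enn2real (outer_measure_of lebesgue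
              {u \<in> cbox c (c + r *\<^sub>R 1). Delta (\<lambda>i. U i w) n u (a n) \<in> F})
            / measure lebesgue (cbox c (c + r *\<^sub>R 1))))
         \<le> ereal (measure N {\<eta> \<in> space N. W \<eta> \<in> F})) \<and>
      (\<forall>G. sup_open G \<longrightarrow>
         liminf (\<lambda>n. ereal (enn2real (inner_measure_of lebesgue
              {u \<in> cbox c (c + r *\<^sub>R 1). Delta (\<lambda>i. U i w) n u (a n) \<in> G})
            / measure lebesgue (cbox c (c + r *\<^sub>R 1))))
         \<ge> ereal (measure N {\<eta> \<in> space N. W \<eta> \<in> G}))"
        unfolding m
        using outer_measure_limsup[OF elim r \<delta> sub assms(10)] inner_measure_liminf[OF elim r \<delta> sub assms(10)]
        by (intro conjI allI impI limsup_ereal_le liminf_ereal_ge)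
    qed
  qed
qed

end
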